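(* Let $a\in BV([0,1])$ satisfy $a(x)\ge a_0>0$ for all $x\in(0,1)$, for some constant $a_0>0$. Let $T>2/\sqrt{a_0}$. Then for every pair of initial data $\{y^0,y^1\}\in L^2(0,1)\times H^{-1}(0,1)$ there exists a control $v\in L^2(0,T)$ such that the solution $y$ of $$y''-(a(x)y_x)_x=0 \text{ in } (0,1)\times(0,T),\quad y(0,t)=v(t),\ y(1,t)=0 \text{ for } t\in(0,T),\quad y(\cdot,0)=y^0,\ y'(\cdot,0)=y^1 \text{ in }(0,1)$$ satisfies $y(\cdot,T)=y'(\cdot,T)=0$.
   Context: Here $'$ denotes $\partial/\partial t$ and $y_x=\partial y/\partial x$. Solutions with data in $L^2(0,1)\times H^{-1}(0,1)$ and boundary control $v\in L^2(0,T)$ are understood in the weak (transposition) sense, and belong to $C([0,T];L^2(0,1))\cap C^1([0,T];H^{-1}(0,1))$, so that $y(T)$ and $y'(T)$ are well defined. *)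

theory Defs
  imports "HOL-Analysis.Analysis"
begin

definition BV01 :: "(real \<Rightarrow> real) \<Rightarrow> bool" where
  "BV01 a \<longleftrightarrow> (\<exists>M. \<forall>(n::nat) (p::nat \<Rightarrow> real).
      p 0 = 0 \<and> p n = 1 \<and> (\<forall>i<n. p i \<le> p (Suc i)) \<longrightarrow>
      (\<Sum>i<n. \<bar>a (p (Suc i)) - a (p i)\<bar>) \<le> M)"

definition L2on :: "real set \<Rightarrow> (real \<Rightarrow> real) \<Rightarrow> bool" where
  "L2on S f \<longleftrightarrow> set_borel_measurable lborel S f \<and>
     set_integrable lborel S (\<lambda>x. (f x)\<^sup>2)"

definition H01_deriv :: "(real \<Rightarrow> real) \<Rightarrow> (real \<Rightarrow> real) \<Rightarrow> bool" where
  "H01_deriv \<phi> g \<longleftrightarrow> L2on {0..1} g \<and>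
     (\<forall>x\<in>{0..1}. \<phi> x = (LINT s:{0..x}|lborel. g s)) \<and> \<phi> 1 = 0"

definition H01 :: "(real \<Rightarrow> real) \<Rightarrow> bool" where
  "H01 \<phi> \<longleftrightarrow> (\<exists>g. H01_deriv \<phi> g)"

definition Hm1 :: "((real \<Rightarrow> real) \<Rightarrow> real) \<Rightarrow> bool" where
  "Hm1 l \<longleftrightarrow>
     (\<forall>\<phi> \<psi>. H01 \<phi> \<longrightarrow> H01 \<psi> \<longrightarrow> l (\<lambda>x. \<phi> x + \<psi> x) = l \<phi> + l \<psi>) \<and>
     (\<forall>\<phi> c. H01 \<phi> \<longrightarrow> l (\<lambda>x. c * \<phi> x) = c * l \<phi>) \<and>
     (\<exists>C. \<forall>\<phi> g. H01_deriv \<phi> g \<longrightarrow>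
        \<bar>l \<phi>\<bar> \<le> C * sqrt (LINT x:{0..1}|lborel. (g x)\<^sup>2))"

definition Hm1_close :: "((real \<Rightarrow> real) \<Rightarrow> real) \<Rightarrow> ((real \<Rightarrow> real) \<Rightarrow> real) \<Rightarrow> real \<Rightarrow> bool" where
  "Hm1_close l1 l2 e \<longleftrightarrow> (\<forall>\<phi> g. H01_deriv \<phi> g \<longrightarrow>
        \<bar>l1 \<phi> - l2 \<phi>\<bar> \<le> e * sqrt (LINT x:{0..1}|lborel. (g x)\<^sup>2))"

definition L2_to_Hm1 :: "(real \<Rightarrow> real) \<Rightarrow> (real \<Rightarrow> real) \<Rightarrow> real" where
  "L2_to_Hm1 f = (\<lambda>\<phi>. LINT x:{0..1}|lborel. f x * \<phi> x)"

text \<open>Elements of the domain of A = -(a d/dx)_x with Dirichlet conditions: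
  phi in H^1_0 with derivative g, and a g = psi a.e., where
  psi(x) = c + int_0^x chi, chi in L^2 (i.e. a phi_x in H^1).
  Then (a phi_x)_x = chi and (a phi_x)(0) = c.\<close>
definition domA :: "(real \<Rightarrow> real) \<Rightarrow> (real \<Rightarrow> real) \<Rightarrow> real \<Rightarrow> (real \<Rightarrow> real) \<Rightarrow> bool" where
  "domA a \<phi> c k \<longleftrightarrow> L2on {0..1} k \<and> (\<exists>g. H01_deriv \<phi> g \<and>
      (AE x in lborel. x \<in> {0..1} \<longrightarrow> a x * g x = c + (LINT s:{0..x}|lborel. k s)))"

text \<open>Weak solution y \<in> C([0,T];L^2(0,1)) \<inter> C^1([0,T];H^{-1}(0,1)) of
  y'' - (a y_x)_x = 0, y(0,t) = v(t), y(1,t) = 0, y(0) = y0, y'(0) = y1.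
  y x t is the value at position x and time t; w t is y'(t) \<in> H^{-1}.
  The equation is imposed in the weak form: for every phi in D(A),
  <y'(t),phi> - <y1,phi> = int_0^t ( int_0^1 y(s) (a phi_x)_x dx + v(s) (a phi_x)(0) ) ds.\<close>
definition wave_solution ::
  "(real \<Rightarrow> real) \<Rightarrow> real \<Rightarrow> (real \<Rightarrow> real) \<Rightarrow> ((real \<Rightarrow> real) \<Rightarrow> real) \<Rightarrow> (real \<Rightarrow> real)
   \<Rightarrow> (real \<Rightarrow> real \<Rightarrow> real) \<Rightarrow> (real \<Rightarrow> (real \<Rightarrow> real) \<Rightarrow> real) \<Rightarrow> bool" where
  "wave_solution a T y0 y1 v y w \<longleftrightarrow>
     (\<forall>t\<in>{0..T}. L2on {0..1} (\<lambda>x. y x t)) \<and>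
     (\<forall>t\<in>{0..T}. \<forall>e>0. \<exists>d>0. \<forall>s\<in>{0..T}. \<bar>s - t\<bar> < d \<longrightarrow>
          (LINT x:{0..1}|lborel. (y x s - y x t)\<^sup>2) < e) \<and>
     (\<forall>t\<in>{0..T}. Hm1 (w t)) \<and>
     (\<forall>t\<in>{0..T}. \<forall>e>0. \<exists>d>0. \<forall>s\<in>{0..T}. \<bar>s - t\<bar> < d \<longrightarrow> Hm1_close (w s) (w t) e) \<and>
     (\<forall>t\<in>{0..T}. \<forall>e>0. \<exists>d>0. \<forall>s\<in>{0..T}. s \<noteq> t \<and> \<bar>s - t\<bar> < d \<longrightarrow>
          Hm1_close (L2_to_Hm1 (\<lambda>x. (y x s - y x t) / (s - t))) (w t) e) \<and>
     (AE x in lborel. x \<in> {0..1} \<longrightarrow> y x 0 = y0 x) \<and>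
     (\<forall>\<phi>. H01 \<phi> \<longrightarrow> w 0 \<phi> = y1 \<phi>) \<and>
     (\<forall>\<phi> c k. domA a \<phi> c k \<longrightarrow> (\<forall>t\<in>{0..T}.
          w t \<phi> - y1 \<phi> =
          (LINT s:{0..t}|lborel. (LINT x:{0..1}|lborel. y x s * k x) + v s * c)))"

end

theory Submission
  imports Defs "HOL-Computational_Algebra.Polynomial"
begin

text \<open>
Put \<open>b = 1 / a\<close> and write the equation as the system \<open>y\<^sub>t = p\<^sub>x\<close>, \<open>y\<^sub>x = b p\<^sub>t\<close> with
\<open>y'(t)\<close> represented by \<open>p\<^sub>x\<close>. Regarded as an evolution in \<open>x\<close> starting from \<open>x = 1\<close> with \<open>y = 0\<close>
and \<open>p = q(t)\<close>, it is solved exactly by finite sums when \<open>q\<close> is a polynomial. Energy identities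
with \<open>x\<close> as the evolution variable and a Gronwall argument for \<open>b\<close> of bounded variation show that the state at
time \<open>0\<close> controls \<open>q\<close> in \<open>L\<^sup>2\<close> on \<open>[-\<tau>, \<tau>]\<close>, where \<open>\<tau> = \<integral> sqrt b\<close>, and is controlled by it. The states
reached by polynomials are dense, so every state at time \<open>0\<close> comes from some \<open>q\<close> in \<open>L\<^sup>2(-\<tau>, \<tau>)\<close>; extending \<open>q\<close>
by zero to \<open>t > \<tau>\<close> gives a solution that vanishes for \<open>t \<ge> 2 \<tau>\<close>, and the control is its trace at \<open>x = 0\<close>.
Both density and uniqueness rest on one fact about the Dirichlet Green operator \<open>G\<close>: being
symmetric and injective, it cannot satisfy \<open>\<parallel>G\<^sup>n f\<parallel> \<le> C K\<^sup>n / n!\<close> for all \<open>n\<close> unless \<open>f = 0\<close>.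
\<close>

section \<open>Square integrable functions\<close>

text \<open>Since \<open>b\<close> is only of bounded variation, the route through classical
  solutions and their regularity is closed. Data polynomial in \<open>t\<close> avoid it: the
  expansion in x stops after finitely many terms, differentiation in t is algebra, and general data
  enter only by estimates and L^2 limits. The windows |t| \<le> X(x) + c, with X(x) the travel time
  from the left end, grow at the characteristic rate sqrt b; then the boundary terms are perfect
  squares and the energy has a definite direction of growth. With c = 0 the window closes to a point
  at x = 0, which is why the state at time 0 determines \<open>q\<close> on [-\<tau>, \<tau>]. The
  threshold for T comes from \<tau> \<le> 1 / sqrt a0. Uniqueness is part of the task because the
  claim concerns every solution with the control \<open>v\<close>, while the construction yields
  one.\<close>

definition L2 :: "'a measure \<Rightarrow> ('a \<Rightarrow> real) set" where
  "L2 M = {f \<in> borel_measurable M. integrable M (\<lambda>x. (f x)\<^sup>2)}"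

definition nrm :: "'a measure \<Rightarrow> ('a \<Rightarrow> real) \<Rightarrow> real" where
  "nrm M f = sqrt (LINT x|M. (f x)\<^sup>2)"

lemma L2_meas [measurable_dest]: "f \<in> L2 M \<Longrightarrow> f \<in> borel_measurable M"
  by (simp add: L2_def)

lemma L2_sq: "f \<in> L2 M \<Longrightarrow> integrable M (\<lambda>x. (f x)\<^sup>2)"
  by (simp add: L2_def)

lemma L2_mult:
  assumes "f \<in> L2 M" "g \<in> L2 M"
  shows "integrable M (\<lambda>x. f x * g x)"
proof (rule Bochner_Integration.integrable_bound)
  show "integrable M (\<lambda>x. (f x)\<^sup>2 + (g x)\<^sup>2)"
    using assms by (auto simp: L2_def)
  show "(\<lambda>x. f x * g x) \<in> borel_measurable M"
    using assms by (auto simp: L2_def)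
  have "norm (u * v) \<le> norm (u\<^sup>2 + v\<^sup>2)" for u v :: real
    using sum_squares_bound[of "\<bar>u\<bar>" "\<bar>v\<bar>"] mult_nonneg_nonneg[of "\<bar>u\<bar>" "\<bar>v\<bar>"]
    unfolding real_norm_def abs_mult by (simp add: abs_mult del: mult_nonneg_nonneg)
  then show "AE x in M. norm (f x * g x) \<le> norm ((f x)\<^sup>2 + (g x)\<^sup>2)"
    by simp
qed

lemma L2_scale: "f \<in> L2 M \<Longrightarrow> (\<lambda>x. c * f x) \<in> L2 M"
  by (auto simp: L2_def power_mult_distrib)

lemma L2_add:
  assumes "f \<in> L2 M" "g \<in> L2 M"
  shows "(\<lambda>x. f x + g x) \<in> L2 M"
  using assms L2_mult[OF assms] unfolding L2_def
  by (auto simp: power2_sum mult.assoc intro!: Bochner_Integration.integrable_add)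

lemma L2_diff:
  assumes "f \<in> L2 M" "g \<in> L2 M"
  shows "(\<lambda>x. f x - g x) \<in> L2 M"
  using L2_add[OF assms(1) L2_scale[OF assms(2), of "-1"]] by simp

lemma L2_uminus: "f \<in> L2 M \<Longrightarrow> (\<lambda>x. - f x) \<in> L2 M"
  using L2_scale[of f M "-1"] by simp

lemma L2_zero: "(\<lambda>x. 0) \<in> L2 M"
  by (simp add: L2_def)

lemma nrm_ge0 [simp]: "0 \<le> nrm M f"
  by (simp add: nrm_def)

lemma nrm_sq: "(nrm M f)\<^sup>2 = (LINT x|M. (f x)\<^sup>2)"
  by (simp add: nrm_def)

lemma nrm_scale: "nrm M (\<lambda>x. c * f x) = \<bar>c\<bar> * nrm M f"
  by (simp add: nrm_def power_mult_distrib real_sqrt_mult)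

lemma nrm_uminus: "nrm M (\<lambda>x. - f x) = nrm M f"
  by (simp add: nrm_def)

lemma nrm_commute: "nrm M (\<lambda>x. f x - g x) = nrm M (\<lambda>x. g x - f x)"
  by (simp add: nrm_def power2_commute)

lemma nrm_sq_add:
  assumes "f \<in> L2 M" "g \<in> L2 M"
  shows "(nrm M (\<lambda>x. f x + c * g x))\<^sup>2 = (nrm M f)\<^sup>2 + 2 * c * (LINT x|M. f x * g x) + c\<^sup>2 * (nrm M g)\<^sup>2"
proof -
  have "(LINT x|M. (f x + c * g x)\<^sup>2) = (LINT x|M. (f x)\<^sup>2 + 2 * c * (f x * g x) + c\<^sup>2 * (g x)\<^sup>2)"
    by (simp add: power2_eq_square algebra_simps)
  also have "\<dots> = (LINT x|M. (f x)\<^sup>2) + 2 * c * (LINT x|M. f x * g x) + c\<^sup>2 * (LINT x|M. (g x)\<^sup>2)"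
    using L2_sq[OF assms(1)] L2_sq[OF assms(2)] L2_mult[OF assms] by simp
  finally show ?thesis by (simp add: nrm_sq)
qed

text \<open>The parabola in \<open>c\<close> stays nonnegative, so its value at
  \<open>c = - q / r\<close> gives the claim; for \<open>r = 0\<close> a nonnegative affine function
  has slope zero. Used for Cauchy-Schwarz and, with \<open>p = 0\<close>, as the first-order
  condition of a minimisation.\<close>

lemma quadratic_nonneg_discriminant:
  fixes p q r :: real
  assumes *: "\<And>c. 0 \<le> p + 2 * c * q + c\<^sup>2 * r" and r: "0 \<le> r"
  shows "q\<^sup>2 \<le> p * r"
proof (cases "r = 0")
  case True
  have "q = 0"
  proof (rule ccontr)
    assume "q \<noteq> 0"
    then have "2 * (- (p + 1) / (2 * q)) * q = - p - 1" by (simp add: field_simps)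
    then show False using *[of "- (p + 1) / (2 * q)"] True by simp
  qed
  then show ?thesis using True by simp
next
  case False
  have "0 \<le> (p + 2 * (- q / r) * q + (- q / r)\<^sup>2 * r) * r"
    using *[of "- q / r"] r by simp
  also have "\<dots> = p * r - q\<^sup>2"
    using False by (simp add: field_simps power2_eq_square)
  finally show ?thesis by simp
qed

lemma L2_CS:
  assumes "f \<in> L2 M" "g \<in> L2 M"
  shows "\<bar>\<integral>x. f x * g x \<partial>M\<bar> \<le> nrm M f * nrm M g"
proof -
  have "(LINT x|M. f x * g x)\<^sup>2 \<le> (nrm M f)\<^sup>2 * (nrm M g)\<^sup>2"
    by (rule quadratic_nonneg_discriminant) (use nrm_sq_add[OF assms] in \<open>metis zero_le_power2\<close>, simp)
  then have "\<bar>\<integral>x. f x * g x \<partial>M\<bar>\<^sup>2 \<le> (nrm M f * nrm M g)\<^sup>2"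
    by (simp add: power_mult_distrib)
  then show ?thesis
    by (rule power2_le_imp_le) simp
qed

lemma nrm_triangle:
  assumes "f \<in> L2 M" "g \<in> L2 M"
  shows "nrm M (\<lambda>x. f x + g x) \<le> nrm M f + nrm M g"
proof (rule power2_le_imp_le)
  have "(nrm M (\<lambda>x. f x + g x))\<^sup>2 = (nrm M f)\<^sup>2 + 2 * (LINT x|M. f x * g x) + (nrm M g)\<^sup>2"
    using nrm_sq_add[OF assms, of 1] by simp
  also have "\<dots> \<le> (nrm M f)\<^sup>2 + 2 * (nrm M f * nrm M g) + (nrm M g)\<^sup>2"
    using L2_CS[OF assms] by simp
  finally show "(nrm M (\<lambda>x. f x + g x))\<^sup>2 \<le> (nrm M f + nrm M g)\<^sup>2"
    by (simp add: power2_sum)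
qed simp

lemma nrm_triangle_diff:
  assumes "f \<in> L2 M" "g \<in> L2 M" "h \<in> L2 M"
  shows "nrm M (\<lambda>x. f x - h x) \<le> nrm M (\<lambda>x. f x - g x) + nrm M (\<lambda>x. g x - h x)"
  using nrm_triangle[OF L2_diff[OF assms(1,2)] L2_diff[OF assms(2,3)]] by simp

lemma nrm_diff_ge:
  assumes "f \<in> L2 M" "g \<in> L2 M"
  shows "\<bar>nrm M f - nrm M g\<bar> \<le> nrm M (\<lambda>x. f x - g x)"
  using nrm_triangle[OF L2_diff[OF assms] assms(2)] nrm_triangle[OF L2_diff[OF assms(2,1)] assms(1)]
  by (simp add: nrm_commute[of M g f])

lemma ip_diff_bound:
  assumes "f \<in> L2 M" "g \<in> L2 M" "h \<in> L2 M"
  shows "\<bar>(LINT x|M. f x * h x) - (LINT x|M. g x * h x)\<bar> \<le> nrm M (\<lambda>x. f x - g x) * nrm M h"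
proof -
  have "(LINT x|M. f x * h x) - (LINT x|M. g x * h x) = (LINT x|M. (f x - g x) * h x)"
    using L2_mult[OF assms(1,3)] L2_mult[OF assms(2,3)] by (simp add: left_diff_distrib)
  then show ?thesis using L2_CS[OF L2_diff[OF assms(1,2)] assms(3)] by simp
qed

lemma ip_tendsto:
  assumes "\<And>n. f n \<in> L2 M" "g \<in> L2 M" "h \<in> L2 M" "(\<lambda>n. nrm M (\<lambda>x. f n x - g x)) \<longlonglongrightarrow> 0"
  shows "(\<lambda>n. \<integral>x. f n x * h x \<partial>M) \<longlonglongrightarrow> (LINT x|M. g x * h x)"
proof (rule LIM_zero_cancel, rule Lim_null_comparison)
  show "\<forall>\<^sub>F n in sequentially. norm ((LINT x|M. f n x * h x) - (LINT x|M. g x * h x))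
      \<le> nrm M (\<lambda>x. f n x - g x) * nrm M h"
    using ip_diff_bound[OF assms(1-3)] by simp
  show "(\<lambda>n. nrm M (\<lambda>x. f n x - g x) * nrm M h) \<longlonglongrightarrow> 0"
    using tendsto_mult_left_zero[OF assms(4)] by simp
qed

lemma nrm_eq_0_iff:
  assumes "f \<in> L2 M"
  shows "nrm M f = 0 \<longleftrightarrow> (AE x in M. f x = 0)"
  using integral_nonneg_eq_0_iff_AE[OF L2_sq[OF assms]] by (simp add: nrm_def)

lemma nrm_cong_AE:
  assumes "f \<in> borel_measurable M" "g \<in> borel_measurable M" "AE x in M. f x = g x"
  shows "nrm M f = nrm M g"
  unfolding nrm_def using assms by (intro arg_cong[of _ _ sqrt] integral_cong_AE) auto

lemma L2_abs: "f \<in> L2 M \<Longrightarrow> (\<lambda>x. \<bar>f x\<bar>) \<in> L2 M"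
  by (auto simp: L2_def)

lemma nrm_abs: "nrm M (\<lambda>x. \<bar>f x\<bar>) = nrm M f"
  by (simp add: nrm_def)

section \<open>Completeness, representation of functionals and density in L^2\<close>

lemma L2_nn: 
  assumes "f \<in> L2 M"
  shows "(\<integral>\<^sup>+x. ennreal ((f x)\<^sup>2) \<partial>M) = ennreal ((nrm M f)\<^sup>2)"
  unfolding nrm_sq by (rule nn_integral_eq_integral[OF L2_sq[OF assms]]) simp

lemma L2_I_nn:
  assumes "f \<in> borel_measurable M" "(\<integral>\<^sup>+x. ennreal ((f x)\<^sup>2) \<partial>M) \<le> ennreal (c\<^sup>2)" "0 \<le> c"
  shows "f \<in> L2 M" "nrm M f \<le> c"
proof -
  have "integrable M (\<lambda>x. (f x)\<^sup>2)"
    using assms by (intro integrableI_bounded) (auto simp: le_less_trans)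
  then show *: "f \<in> L2 M" using assms by (simp add: L2_def)
  show "nrm M f \<le> c"
    using assms(2,3) unfolding L2_nn[OF *] by (simp add: power2_le_iff_abs_le)
qed

text \<open>Riesz-Fischer on a finite measure, where the L^2 norm dominates the L^1 norm: a rapidly
  convergent subsequence has increments summable almost everywhere, and Fatou's lemma carries the
  L^2 bounds over to its pointwise limit.\<close>

lemma L2_complete:
  assumes f: "\<And>n::nat. f n \<in> L2 M"
    and fin: "finite_measure M"
    and C: "\<And>e. e > 0 \<Longrightarrow> \<exists>N. \<forall>m\<ge>N. \<forall>n\<ge>N. nrm M (\<lambda>x. f m x - f n x) < e"
  shows "\<exists>g\<in>L2 M. (\<lambda>n. nrm M (\<lambda>x. f n x - g x)) \<longlonglongrightarrow> 0"
proof -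
  interpret finite_measure M by fact
  have [measurable]: "f n \<in> borel_measurable M" for n using f L2_meas by blast
  have "\<forall>k. \<exists>N. \<forall>m\<ge>N. \<forall>n\<ge>N. nrm M (\<lambda>x. f m x - f n x) < (1/2)^k"
    using C by simp
  then obtain N0 where N0: "\<And>k m n. m \<ge> N0 k \<Longrightarrow> n \<ge> N0 k \<Longrightarrow> nrm M (\<lambda>x. f m x - f n x) < (1/2)^k"
    by metis
  \<comment> \<open>Adding up the \<open>N0 i\<close> makes \<open>r\<close> increasing; the extra
    \<open>k\<close> makes \<open>r k\<close> pass every index, which the Fatou estimate below
    needs.\<close>
  define r where "r k = (\<Sum>i\<le>k. N0 i) + k" for k
  have r: "r k \<ge> N0 k" for k
    unfolding r_def by (simp add: member_le_sum trans_le_add1)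
  have rS: "r (Suc k) \<ge> r k" for k unfolding r_def by simp
  have rk: "r k \<ge> k" for k unfolding r_def by simp
  define h where "h k x = f (r (Suc k)) x - f (r k) x" for k x
  have [measurable]: "h k \<in> borel_measurable M" for k unfolding h_def by measurable
  have hL: "h k \<in> L2 M" for k unfolding h_def by (intro L2_diff f)
  have hn: "nrm M (h k) \<le> (1/2)^k" for k
    unfolding h_def using N0[of k "r (Suc k)" "r k"] r[of k] rS[of k] by simp
  define c where "c = nrm M (\<lambda>x. 1)"
  have oneL: "(\<lambda>x. 1) \<in> L2 M" by (simp add: L2_def)
  have h1: "(\<integral>\<^sup>+x. ennreal \<bar>h k x\<bar> \<partial>M) \<le> ennreal (c * (1/2)^k)" for k
  proof -
    have "integrable M (\<lambda>x. \<bar>h k x\<bar>)" using L2_mult[OF L2_abs[OF hL[of k]] oneL] by simp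
    then have "(\<integral>\<^sup>+x. ennreal \<bar>h k x\<bar> \<partial>M) = ennreal (LINT x|M. \<bar>h k x\<bar>)"
      by (intro nn_integral_eq_integral) auto
    also have "(LINT x|M. \<bar>h k x\<bar>) \<le> nrm M (h k) * c"
      using L2_CS[OF L2_abs[OF hL[of k]] oneL] by (simp add: nrm_abs c_def)
    also have "\<dots> \<le> (1/2)^k * c" by (intro mult_right_mono hn) (simp add: c_def)
    finally show ?thesis by (simp add: mult.commute ennreal_leI)
  qed
  have "(\<integral>\<^sup>+x. (\<Sum>k. ennreal \<bar>h k x\<bar>) \<partial>M) = (\<Sum>k. \<integral>\<^sup>+x. ennreal \<bar>h k x\<bar> \<partial>M)"
    by (rule nn_integral_suminf) measurable
  also have "\<dots> \<le> (\<Sum>k. ennreal (c * (1/2)^k))"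
    by (intro suminf_le h1) auto
  also have "\<dots> = ennreal (\<Sum>k. c * (1/2)^k)"
    by (rule suminf_ennreal2) (auto simp: c_def intro!: summable_mult summable_geometric)
  finally have "(\<integral>\<^sup>+x. (\<Sum>k. ennreal \<bar>h k x\<bar>) \<partial>M) \<noteq> \<infinity>" by (auto simp: top_unique)
  then have "AE x in M. (\<Sum>k. ennreal \<bar>h k x\<bar>) \<noteq> \<infinity>"
    by (intro nn_integral_PInf_AE) measurable
  then have conv: "AE x in M. convergent (\<lambda>k. f (r k) x)"
  proof eventually_elim
    case (elim x)
    then have "summable (\<lambda>k. \<bar>h k x\<bar>)"
      by (intro summable_suminf_not_top) auto
    then have "summable (\<lambda>k. h k x)" by (rule summable_rabs_cancel)
    then have "convergent (\<lambda>n. \<Sum>k<n. h k x)" by (simp add: summable_iff_convergent)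
    then have "convergent (\<lambda>n. (\<Sum>k<n. h k x) + f (r 0) x)"
      by (intro convergent_add convergent_const)
    moreover have "(\<Sum>k<n. h k x) + f (r 0) x = f (r n) x" for n
      unfolding h_def by (subst sum_lessThan_telescope) simp
    ultimately show ?case by simp
  qed
  \<comment> \<open>Where the subsequence diverges the value of \<open>lim\<close> is arbitrary;
    this is a null set.\<close>
  define g where "g x = lim (\<lambda>k. f (r k) x)" for x
  have [measurable]: "g \<in> borel_measurable M" unfolding g_def by measurable
  have ge: "f n \<in> L2 M \<and> (\<lambda>x. f n x - g x) \<in> L2 M \<and> nrm M (\<lambda>x. f n x - g x) \<le> e"
    if e: "e > 0" and N: "\<And>m n. m \<ge> N \<Longrightarrow> n \<ge> N \<Longrightarrow> nrm M (\<lambda>x. f m x - f n x) < e" and n: "n \<ge> N" for e N n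
  proof -
    have "(\<integral>\<^sup>+x. ennreal ((f n x - g x)\<^sup>2) \<partial>M) = (\<integral>\<^sup>+x. liminf (\<lambda>k. ennreal ((f n x - f (r k) x)\<^sup>2)) \<partial>M)"
    proof (rule nn_integral_cong_AE)
      show "AE x in M. ennreal ((f n x - g x)\<^sup>2) = liminf (\<lambda>k. ennreal ((f n x - f (r k) x)\<^sup>2))"
        using conv
      proof eventually_elim
        case (elim x)
        then have "(\<lambda>k. f (r k) x) \<longlonglongrightarrow> g x" unfolding g_def by (simp add: convergent_LIMSEQ_iff)
        then have "(\<lambda>k. ennreal ((f n x - f (r k) x)\<^sup>2)) \<longlonglongrightarrow> ennreal ((f n x - g x)\<^sup>2)"
          by (intro tendsto_ennrealI tendsto_intros)
        then show ?case by (intro lim_imp_Liminf[symmetric]) auto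
      qed
    qed
    also have "\<dots> \<le> liminf (\<lambda>k. \<integral>\<^sup>+x. ennreal ((f n x - f (r k) x)\<^sup>2) \<partial>M)"
      by (rule nn_integral_liminf) measurable
    also have "\<dots> = liminf (\<lambda>k. ennreal ((nrm M (\<lambda>x. f n x - f (r k) x))\<^sup>2))"
      by (subst L2_nn) (auto intro!: L2_diff f)
    also have "\<dots> \<le> liminf (\<lambda>k. ennreal (e\<^sup>2))"
    proof (rule Liminf_mono)
      show "\<forall>\<^sub>F k in sequentially. ennreal ((nrm M (\<lambda>x. f n x - f (r k) x))\<^sup>2) \<le> ennreal (e\<^sup>2)"
        using eventually_ge_at_top[of N]
      proof eventually_elim
        case (elim k)
        then have "r k \<ge> N" using rk[of k] by simp
        then have "nrm M (\<lambda>x. f n x - f (r k) x) < e" using N n by blast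
        then show ?case by (intro ennreal_leI power_mono) auto
      qed
    qed
    also have "\<dots> = ennreal (e\<^sup>2)" by (rule Liminf_const) simp
    finally have *: "(\<integral>\<^sup>+x. ennreal ((f n x - g x)\<^sup>2) \<partial>M) \<le> ennreal (e\<^sup>2)" .
    show ?thesis using f[of n] L2_I_nn[OF _ *] e by auto
  qed
  have gL: "g \<in> L2 M"
  proof -
    obtain N where N: "\<And>m n. m \<ge> N \<Longrightarrow> n \<ge> N \<Longrightarrow> nrm M (\<lambda>x. f m x - f n x) < 1"
      using C[of 1] by auto
    have "(\<lambda>x. f N x - g x) \<in> L2 M" using ge[of 1 N N] N by simp
    from L2_diff[OF f[of N] this] show ?thesis by simp
  qed
  show ?thesis
  proof (rule bexI[OF _ gL], rule LIMSEQ_I)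
    fix e :: real assume e: "e > 0"
    obtain N where N: "\<And>m n. m \<ge> N \<Longrightarrow> n \<ge> N \<Longrightarrow> nrm M (\<lambda>x. f m x - f n x) < e/2"
      using C[of "e/2"] e by (metis half_gt_zero)
    show "\<exists>no. \<forall>n\<ge>no. norm (nrm M (\<lambda>x. f n x - g x) - 0) < e"
      using ge[of "e/2" N] N e by (intro exI[of _ N]) force
  qed
qed

text \<open>\<open>W\<close> need not be closed, so the representing element is only a limit of
  members of \<open>W\<close>. It is the limit of a minimising sequence of the squared norm of
  \<open>f\<close> minus \<open>2 * l f\<close>, and stationarity of the limit is the representation
  formula. The approximating sequence is part of the conclusion because the density argument needs
  it.\<close>

lemma L2_Riesz_subspace:
  assumes fin: "finite_measure M"
    and W: "W \<subseteq> L2 M" "(\<lambda>x. 0) \<in> W" "\<And>f g c. f \<in> W \<Longrightarrow> g \<in> W \<Longrightarrow> (\<lambda>x. f x + c * g x) \<in> W"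
    and lin: "\<And>f g c. f \<in> W \<Longrightarrow> g \<in> W \<Longrightarrow> l (\<lambda>x. f x + c * g x) = l f + c * l g"
    and bd: "\<And>f. f \<in> W \<Longrightarrow> \<bar>l f\<bar> \<le> C * nrm M f"
  shows "\<exists>p\<in>L2 M. \<exists>f. (\<forall>n::nat. f n \<in> W) \<and> (\<lambda>n. nrm M (\<lambda>x. f n x - p x)) \<longlonglongrightarrow> 0 \<and>
           (\<forall>g\<in>W. l g = (LINT x|M. p x * g x))"
proof -
  define J where "J f = (nrm M f)\<^sup>2 - 2 * l f" for f
  have Jlow: "J f \<ge> - C\<^sup>2" if "f \<in> W" for f
  proof -
    have "0 \<le> (nrm M f - C)\<^sup>2" by simp
    then have "2 * (C * nrm M f) \<le> (nrm M f)\<^sup>2 + C\<^sup>2" by (simp add: power2_diff mult.commute)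
    then show ?thesis using bd[OF that] by (simp add: J_def)
  qed
  define m where "m = Inf (J ` W)"
  have bb: "bdd_below (J ` W)" by (rule bdd_belowI2[of _ "- C\<^sup>2"]) (rule Jlow)
  have mle: "m \<le> J f" if "f \<in> W" for f
    unfolding m_def by (rule cInf_lower) (use that bb in auto)
  have "\<exists>f\<in>W. J f < m + 1 / Suc n" for n
  proof -
    have "\<exists>y\<in>J ` W. y < m + 1 / Suc n"
      unfolding m_def by (rule cInf_lessD) (use W in auto)
    then show ?thesis by auto
  qed
  then obtain f where fW: "\<And>n. f n \<in> W" and fm: "\<And>n. J (f n) < m + 1 / Suc n" by metis
  have fL: "f n \<in> L2 M" for n using fW W(1) by blast
  \<comment> \<open>Parallelogram law: the midpoint of two almost minimisers still has
    \<open>J\<close> at least \<open>m\<close>, which forces them close together.\<close>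
  have para: "(nrm M (\<lambda>x. f i x - f j x))\<^sup>2 \<le> 2 / Suc i + 2 / Suc j" for i j
  proof -
    define k where "k = (\<lambda>x. f i x + 1 * f j x)"
    have kW: "k \<in> W" unfolding k_def by (rule W(3)) (rule fW)+
    have hW: "(\<lambda>x. 0 + (1/2) * k x) \<in> W" by (rule W(3)[OF W(2) kW])
    have l0: "l (\<lambda>x. 0) = 0" using lin[OF W(2) W(2), of 1] by simp
    have lh: "2 * l (\<lambda>x. 0 + (1/2) * k x) = l (f i) + l (f j)"
      using lin[OF W(2) kW, of "1/2"] lin[OF fW[of i] fW[of j], of 1] l0 by (simp add: k_def)
    have "nrm M (\<lambda>x. 0 + (1/2) * k x) = nrm M k / 2"
      using nrm_scale[of M "1/2" k] by simp
    then have nk: "(nrm M (\<lambda>x. 0 + (1/2) * k x))\<^sup>2 = (nrm M k)\<^sup>2 / 4"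
      by (simp only: power_divide) simp
    have "m \<le> (nrm M k)\<^sup>2 / 4 - (l (f i) + l (f j))"
      using mle[OF hW] unfolding J_def lh nk .
    moreover have "(nrm M k)\<^sup>2 + (nrm M (\<lambda>x. f i x - f j x))\<^sup>2 = 2 * (nrm M (f i))\<^sup>2 + 2 * (nrm M (f j))\<^sup>2"
      using nrm_sq_add[OF fL[of i] fL[of j], of 1] nrm_sq_add[OF fL[of i] fL[of j], of "-1"]
      by (simp add: k_def)
    ultimately show ?thesis using fm[of i] fm[of j] unfolding J_def by simp
  qed
  have "\<exists>N. \<forall>i\<ge>N. \<forall>j\<ge>N. nrm M (\<lambda>x. f i x - f j x) < e" if e: "e > 0" for e
  proof -
    obtain N where N: "4 / e\<^sup>2 < real N" using reals_Archimedean2 by blast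
    have "nrm M (\<lambda>x. f i x - f j x) < e" if "i \<ge> N" "j \<ge> N" for i j
    proof (rule power2_less_imp_less)
      have Npos: "real N > 0" using N e by (smt (verit) divide_pos_pos zero_less_power)
      have "(nrm M (\<lambda>x. f i x - f j x))\<^sup>2 \<le> 2 / Suc i + 2 / Suc j" by (rule para)
      also have "\<dots> \<le> 2 / N + 2 / N"
        using that Npos by (intro add_mono divide_left_mono) auto
      also have "\<dots> < e\<^sup>2" using N Npos e by (simp add: field_simps)
      finally show "(nrm M (\<lambda>x. f i x - f j x))\<^sup>2 < e\<^sup>2" .
    qed (use e in simp)
    then show ?thesis by blast
  qed
  from L2_complete[OF fL fin this] obtain p where p: "p \<in> L2 M"
    and lim: "(\<lambda>n. nrm M (\<lambda>x. f n x - p x)) \<longlonglongrightarrow> 0" by blast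
  have "l g = (LINT x|M. p x * g x)" if g: "g \<in> W" for g
  proof -
    have gL: "g \<in> L2 M" using g W(1) by blast
    \<comment> \<open>Perturbing the minimising sequence by \<open>c * g\<close> and letting
      \<open>n\<close> grow leaves a nonnegative quadratic in \<open>c\<close> without constant
      term, so its linear coefficient is zero.\<close>
    have "0 \<le> 0 + 2 * c * ((LINT x|M. p x * g x) - l g) + c\<^sup>2 * (nrm M g)\<^sup>2" for c
    proof (rule LIMSEQ_le)
      show "(\<lambda>n. - (1 / Suc n)) \<longlonglongrightarrow> 0"
        using tendsto_minus[OF LIMSEQ_Suc[OF lim_1_over_n]] by simp
      show "(\<lambda>n. 2 * c * ((LINT x|M. f n x * g x) - l g) + c\<^sup>2 * (nrm M g)\<^sup>2)
          \<longlonglongrightarrow> 0 + 2 * c * ((LINT x|M. p x * g x) - l g) + c\<^sup>2 * (nrm M g)\<^sup>2"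
        unfolding add_0_left by (intro tendsto_intros ip_tendsto fL p gL lim)
      have "- (1 / Suc n) \<le> 2 * c * ((LINT x|M. f n x * g x) - l g) + c\<^sup>2 * (nrm M g)\<^sup>2" for n
        using mle[OF W(3)[OF fW[of n] g, of c]] fm[of n]
        unfolding J_def nrm_sq_add[OF fL gL] lin[OF fW g] by (simp add: algebra_simps)
      then show "\<exists>N. \<forall>n\<ge>N. - (1 / Suc n) \<le> 2 * c * ((LINT x|M. f n x * g x) - l g) + c\<^sup>2 * (nrm M g)\<^sup>2"
        by blast
    qed
    from quadratic_nonneg_discriminant[OF this] show ?thesis by simp
  qed
  then show ?thesis using p fW lim by blast
qed

text \<open>The functional given by \<open>f\<close> on \<open>W\<close> is represented by some
  \<open>p\<close> in the closure of \<open>W\<close>; then \<open>f - p\<close> is orthogonal to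
  \<open>W\<close>, hence null by \<open>orth\<close>, and the sequence for \<open>p\<close> also
  converges to \<open>f\<close>.\<close>

lemma L2_dense_subspace:
  assumes fin: "finite_measure M"
    and W: "W \<subseteq> L2 M" "(\<lambda>x. 0) \<in> W" "\<And>f g c. f \<in> W \<Longrightarrow> g \<in> W \<Longrightarrow> (\<lambda>x. f x + c * g x) \<in> W"
    and orth: "\<And>f. f \<in> L2 M \<Longrightarrow> (\<And>g. g \<in> W \<Longrightarrow> (LINT x|M. f x * g x) = 0) \<Longrightarrow> AE x in M. f x = 0"
    and f: "f \<in> L2 M"
  shows "\<exists>s. (\<forall>n::nat. s n \<in> W) \<and> (\<lambda>n. nrm M (\<lambda>x. s n x - f x)) \<longlonglongrightarrow> 0"
proof -
  have WL: "g \<in> L2 M" if "g \<in> W" for g using that W(1) by blast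
  obtain p s where p: "p \<in> L2 M" and s: "\<And>n::nat. s n \<in> W" "(\<lambda>n. nrm M (\<lambda>x. s n x - p x)) \<longlonglongrightarrow> 0"
    and l: "\<And>g. g \<in> W \<Longrightarrow> (LINT x|M. f x * g x) = (LINT x|M. p x * g x)"
  proof -
    have "\<exists>p\<in>L2 M. \<exists>s. (\<forall>n::nat. s n \<in> W) \<and> (\<lambda>n. nrm M (\<lambda>x. s n x - p x)) \<longlonglongrightarrow> 0 \<and>
           (\<forall>g\<in>W. (LINT x|M. f x * g x) = (LINT x|M. p x * g x))"
    proof (rule L2_Riesz_subspace[OF fin W, where C = "nrm M f"])
      fix g h c assume "g \<in> W" "h \<in> W"
      then have "integrable M (\<lambda>x. f x * g x)" "integrable M (\<lambda>x. f x * h x)"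
        by (auto intro!: L2_mult f WL)
      then show "(LINT x|M. f x * (g x + c * h x)) = (LINT x|M. f x * g x) + c * (LINT x|M. f x * h x)"
        by (simp add: algebra_simps)
    qed (auto intro!: L2_CS f WL)
    then show ?thesis using that by blast
  qed
  have "AE x in M. f x - p x = 0"
  proof (rule orth)
    show "(\<lambda>x. f x - p x) \<in> L2 M" by (intro L2_diff f p)
    fix g assume g: "g \<in> W"
    show "(LINT x|M. (f x - p x) * g x) = 0"
      using l[OF g] L2_mult[OF f WL[OF g]] L2_mult[OF p WL[OF g]] by (simp add: left_diff_distrib)
  qed
  then have "nrm M (\<lambda>x. s n x - p x) = nrm M (\<lambda>x. s n x - f x)" for n
    using L2_diff[OF WL[OF s(1)] p] L2_diff[OF WL[OF s(1)] f]
    by (intro nrm_cong_AE) (auto simp: L2_def elim: eventually_mono)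
  then show ?thesis using s by auto
qed

text \<open>Iterates of a symmetric operator satisfy \<open>m\<^sub>n\<^sub>+\<^sub>1\<^sup>2 \<le> m\<^sub>n m\<^sub>n\<^sub>+\<^sub>2\<close>, so they decay at most geometrically.\<close>

lemma log_convex_factorial_decay:
  fixes m :: "nat \<Rightarrow> real"
  assumes pos: "\<And>n. 0 \<le> m n" and lc: "\<And>n. (m (Suc n))\<^sup>2 \<le> m n * m (Suc (Suc n))"
    and decay: "\<And>n. m n \<le> C * K ^ n / fact n"
  shows "m 1 = 0"
proof (rule ccontr)
  assume "m 1 \<noteq> 0"
  then have m1: "m 1 > 0" using pos[of 1] by simp
  have m0: "m 0 > 0" using lc[of 0] m1 pos[of 0] by (cases "m 0 = 0") auto
  \<comment> \<open>The ratios \<open>m (Suc n) / m n\<close> do not decrease, so this first one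
    gives a geometric lower bound, which the factorial defeats. Only \<open>m 1\<close> can be
    claimed to vanish: a sequence with \<open>m 0 > 0\<close> and zeros after it can satisfy all
    hypotheses.\<close>
  define r where "r = m 1 / m 0"
  have rpos: "r > 0" using m0 m1 by (simp add: r_def)
  have step: "m n > 0 \<and> m (Suc n) \<ge> r * m n" for n
  proof (induction n)
    case 0 then show ?case using m0 by (simp add: r_def)
  next
    case (Suc n)
    then have p: "m (Suc n) > 0" using rpos by (smt (verit) mult_pos_pos)
    have "m n * (r * m (Suc n)) \<le> m (Suc n) * m (Suc n)"
      using Suc p mult_right_mono[of "r * m n" "m (Suc n)" "m (Suc n)"] by (simp add: mult_ac)
    also have "\<dots> \<le> m n * m (Suc (Suc n))" using lc[of n] by (simp add: power2_eq_square)
    finally have "r * m (Suc n) \<le> m (Suc (Suc n))" using Suc by (simp only: mult_le_cancel_left_pos)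
    then show ?case using p by simp
  qed
  have low: "m 0 * r ^ n \<le> m n" for n
  proof (induction n)
    case (Suc n)
    have "m 0 * r ^ Suc n = r * (m 0 * r ^ n)" by simp
    also have "\<dots> \<le> r * m n" using Suc rpos by (intro mult_left_mono) auto
    also have "\<dots> \<le> m (Suc n)" using step[of n] by simp
    finally show ?case .
  qed simp
  have "m 0 \<le> C * ((K / r) ^ n / fact n)" for n
  proof -
    have "m 0 * r ^ n \<le> C * K ^ n / fact n" using low[of n] decay[of n] by simp
    then show ?thesis using rpos by (simp add: field_simps power_divide)
  qed
  moreover have "(\<lambda>n. C * ((K / r) ^ n / fact n)) \<longlonglongrightarrow> C * 0"
    by (intro tendsto_mult tendsto_const) (use summable_LIMSEQ_zero[OF summable_exp[of "K / r"]] in \<open>simp add: field_simps\<close>)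
  ultimately have "m 0 \<le> 0" by (intro LIMSEQ_le_const[of _ 0]) auto
  then show False using m0 by simp
qed

text \<open>A substitute for the mean value theorem when the derivative is missing on a countable
  set, later the discontinuities of the coefficient. If \<open>f b < f a\<close>, a slightly tilted
  \<open>g\<close> still falls. The image of \<open>D\<close> is countable, so some level
  \<open>y\<close> between the end values of \<open>g\<close> is not attained on \<open>D\<close>.
  At the last point where \<open>g\<close> equals \<open>y\<close> its derivative is positive, so
  \<open>g\<close> rises above \<open>y\<close> and must return to it later.\<close>

lemma mono_countable_exceptions:
  fixes f :: "real \<Rightarrow> real"
  assumes D: "countable D" and ab: "a \<le> b" and cont: "continuous_on {a..b} f"
    and der: "\<And>x. a < x \<Longrightarrow> x < b \<Longrightarrow> x \<notin> D \<Longrightarrow> (f has_real_derivative f' x) (at x)"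
    and nn: "\<And>x. a < x \<Longrightarrow> x < b \<Longrightarrow> x \<notin> D \<Longrightarrow> 0 \<le> f' x"
  shows "f a \<le> f b"
proof (rule ccontr)
  assume "\<not> f a \<le> f b"
  then have less: "f b < f a" and ab: "a < b" using ab by (auto simp: le_less)
  \<comment> \<open>Half the mean slope of descent: adding \<open>e * (x - a)\<close> restores only
    half of the drop \<open>f a - f b\<close>.\<close>
  define e where "e = (f a - f b) / (2 * (b - a))"
  have e: "e > 0" using less ab by (simp add: e_def)
  define g where "g x = f x + e * (x - a)" for x
  have "e * (b - a) = (f a - f b) / 2"
    unfolding e_def using ab by (metis diff_gt_0_iff_gt less_irrefl nonzero_divide_mult_cancel_right times_divide_eq_left divide_divide_eq_left mult.commute nonzero_mult_div_cancel_right)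
  then have gab: "g b < g a" using less by (simp add: g_def)
  have gcont: "continuous_on {a..b} g" unfolding g_def by (intro continuous_intros cont)
  have "countable (g ` D)" using D by simp
  then have "uncountable ({g b<..<g a} - g ` D)"
    using gab by (intro uncountable_minus_countable uncountable_open_interval[THEN iffD2])
  then obtain y where y: "g b < y" "y < g a" "y \<notin> g ` D"
    using not_finite_existsD by (metis Diff_iff countable_empty ex_in_conv greaterThanLessThan_iff)
  define S where "S = {x\<in>{a..b}. g x = y}"
  have "closed S" unfolding S_def by (intro continuous_closed_preimage_constant gcont) auto
  moreover have "bounded S" by (rule bounded_subset[of "{a..b}"]) (auto simp: S_def)
  ultimately have "compact S" by (simp add: compact_eq_bounded_closed)
  moreover have "S \<noteq> {}"
    using IVT2'[of g b y a] y ab gcont unfolding S_def by force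
  ultimately obtain s where s: "s \<in> S" "\<And>t. t \<in> S \<Longrightarrow> t \<le> s"
    using compact_attains_sup by metis
  have sab: "a < s" "s < b" using s(1) y by (auto simp: S_def le_less)
  have "s \<notin> D" using s(1) y by (auto simp: S_def)
  then have "(g has_real_derivative f' s + e) (at s)"
    unfolding g_def by (auto intro!: derivative_eq_intros der sab)
  from DERIV_pos_inc_right[OF this] nn[OF sab \<open>s \<notin> D\<close>] e
  obtain d where d: "d > 0" "\<And>h. h > 0 \<Longrightarrow> h < d \<Longrightarrow> g s < g (s + h)" by force
  define h where "h = min (d/2) ((b - s)/2)"
  have h: "h > 0" "h < d" "s + h < b" using d(1) sab by (auto simp: h_def min_def field_simps)
  have gs: "g (s + h) > y" using d(2)[OF h(1,2)] s(1) by (simp add: S_def)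
  have "\<exists>x\<ge>s+h. x \<le> b \<and> g x = y"
    by (rule IVT2') (use gs y h sab in \<open>auto intro: continuous_on_subset[OF gcont]\<close>)
  then obtain x where "x \<ge> s + h" "x \<le> b" "g x = y" by blast
  then have "x \<in> S" using h sab by (simp add: S_def)
  then show False using s(2)[of x] \<open>x \<ge> s + h\<close> h by simp
qed

text \<open>Gronwall for a variation function \<open>V\<close> that may jump, so that no
  differential inequality is available. The step inequality is iterated on a uniform partition of
  mesh 1/n; its error term is of second order and adds up to
  \<open>\<bar>K\<bar> / n * (V 1 - V 0)\<close>, which vanishes as n grows. \<open>Ph\<close>
  collects what the energy loses, \<open>Ps\<close> what it receives.\<close>

lemma bv_gronwall:
  fixes F :: "real \<Rightarrow> real"
  assumes V: "\<And>s t. 0 \<le> s \<Longrightarrow> s \<le> t \<Longrightarrow> t \<le> 1 \<Longrightarrow> V s \<le> V t"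
    and Ph: "\<And>s t. 0 \<le> s \<Longrightarrow> s \<le> t \<Longrightarrow> t \<le> 1 \<Longrightarrow> Ph s \<le> Ph t"
    and Ps: "\<And>s t. 0 \<le> s \<Longrightarrow> s \<le> t \<Longrightarrow> t \<le> 1 \<Longrightarrow> Ps s \<le> Ps t"
    and F: "\<And>s. 0 \<le> s \<Longrightarrow> s \<le> 1 \<Longrightarrow> 0 \<le> F s"
    and step: "\<And>s t. 0 \<le> s \<Longrightarrow> s \<le> t \<Longrightarrow> t \<le> 1 \<Longrightarrow>
      F t + Ph t - Ph s \<le> F s * (1 + (V t - V s)) + Ps t - Ps s + K * (V t - V s) * (t - s)"
  shows "F 1 + Ph 1 - Ph 0 \<le> exp (V 1 - V 0) * (F 0 + Ps 1 - Ps 0)"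
proof -
  have main: "F 1 + Ph 1 - Ph 0 \<le> exp (V 1 - V 0) * (F 0 + Ps 1 - Ps 0 + \<bar>K\<bar> / n * (V 1 - V 0))"
    if n: "n > 0" for n :: nat
  proof -
    have "F (k/n) + Ph (k/n) - Ph 0 \<le> exp (V (k/n) - V 0) * (F 0 + Ps (k/n) - Ps 0 + \<bar>K\<bar> / n * (V (k/n) - V 0))"
      if "k \<le> n" for k :: nat
      using that
    proof (induction k)
      case 0 then show ?case by simp
    next
      case (Suc k)
      define s t where "s = real k / n" and "t = real (Suc k) / n"
      have st: "0 \<le> s" "s \<le> t" "t \<le> 1" "s \<le> 1" and ts: "t - s = 1 / n"
        using Suc.prems n by (auto simp: s_def t_def divide_simps)
      define A where "A = F 0 + Ps s - Ps 0 + \<bar>K\<bar> / n * (V s - V 0)"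
      define d where "d = V t - V s"
      have d: "d \<ge> 0" using V st by (simp add: d_def)
      have V0: "V 0 \<le> V s" "V 0 \<le> V t" using V[of 0 s] V[of 0 t] st by auto
      have IH: "F s + Ph s - Ph 0 \<le> exp (V s - V 0) * A"
        using Suc unfolding A_def s_def by simp
      have "F t + Ph t - Ph 0 \<le> F s * (1 + d) + (Ph s - Ph 0) + (Ps t - Ps s + K * d * (1 / n))"
        using step[of s t] st unfolding ts d_def by simp
      also have "\<dots> \<le> (F s + Ph s - Ph 0) * exp d + (Ps t - Ps s + \<bar>K\<bar> / n * d)"
      proof -
        have "F s * (1 + d) \<le> F s * exp d" using F st by (intro mult_left_mono) auto
        moreover have "(Ph s - Ph 0) * 1 \<le> (Ph s - Ph 0) * exp d"
          using Ph[of 0 s] st d by (intro mult_left_mono) auto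
        moreover have "K * d * (1 / n) \<le> \<bar>K\<bar> / n * d"
          using d n by (simp add: divide_simps mult_right_mono)
        ultimately show ?thesis by (simp add: algebra_simps)
      qed
      also have "\<dots> \<le> exp (V s - V 0) * A * exp d + exp (V t - V 0) * (Ps t - Ps s + \<bar>K\<bar> / n * d)"
      proof (rule add_mono)
        show "(F s + Ph s - Ph 0) * exp d \<le> exp (V s - V 0) * A * exp d"
          using IH by (rule mult_right_mono) simp
        have "0 \<le> Ps t - Ps s + \<bar>K\<bar> / n * d" using Ps[of s t] st d by simp
        moreover have "1 \<le> exp (V t - V 0)" using V0 by simp
        ultimately show "Ps t - Ps s + \<bar>K\<bar> / n * d \<le> exp (V t - V 0) * (Ps t - Ps s + \<bar>K\<bar> / n * d)"
          by (metis mult_left_le_imp_le mult_le_cancel_right1 linorder_not_less)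
      qed
      also have "exp (V s - V 0) * A * exp d = exp (V t - V 0) * A"
        by (simp add: d_def exp_diff field_simps)
      also have "exp (V t - V 0) * A + exp (V t - V 0) * (Ps t - Ps s + \<bar>K\<bar> / n * d)
          = exp (V t - V 0) * (F 0 + Ps t - Ps 0 + \<bar>K\<bar> / n * (V t - V 0))"
        unfolding A_def d_def by (simp add: algebra_simps diff_divide_distrib add_divide_distrib)
      finally show ?case unfolding t_def .
    qed
    from this[of n] n show ?thesis by simp
  qed
  show ?thesis
  proof (rule LIMSEQ_le_const)
    have "(\<lambda>n::nat. exp (V 1 - V 0) * (F 0 + Ps 1 - Ps 0 + \<bar>K\<bar> / n * (V 1 - V 0)))
        \<longlonglongrightarrow> exp (V 1 - V 0) * (F 0 + Ps 1 - Ps 0 + 0 * (V 1 - V 0))"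
      by (intro tendsto_intros lim_const_over_n)
    then show "(\<lambda>n::nat. exp (V 1 - V 0) * (F 0 + Ps 1 - Ps 0 + \<bar>K\<bar> / n * (V 1 - V 0)))
        \<longlonglongrightarrow> exp (V 1 - V 0) * (F 0 + Ps 1 - Ps 0)" by simp
    show "\<exists>N. \<forall>n\<ge>N. F 1 + Ph 1 - Ph 0 \<le> exp (V 1 - V 0) * (F 0 + Ps 1 - Ps 0 + \<bar>K\<bar> / real n * (V 1 - V 0))"
      using main by (intro exI[of _ 1]) auto
  qed
qed

section \<open>Primitives and the Green operator\<close>

abbreviation MI :: "real \<Rightarrow> real \<Rightarrow> real measure" where
  "MI u w \<equiv> restrict_space lborel {u..w}"

abbreviation U01 :: "real measure" where
  "U01 \<equiv> MI 0 1"

lemma finite_MI: "finite_measure (MI u w)"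
  by (rule finite_measureI) (use emeasure_compact_finite[of "{u..w}"] in \<open>simp add: emeasure_restrict_space\<close>)

lemma measurable_MI: "f \<in> borel_measurable borel \<Longrightarrow> f \<in> borel_measurable (MI u w)"
  by (rule measurable_restrict_space1) simp

lemma AE_MI: "(AE x in MI u w. P x) \<longleftrightarrow> (AE x in lborel. x \<in> {u..w} \<longrightarrow> P x)"
  by (rule AE_restrict_space_iff) simp

lemma LINT_MI: "(LINT x:{u..w}|lborel. f x) = (LINT x|MI u w. f x)" for f :: "real \<Rightarrow> real"
  by (simp add: integral_restrict_space set_lebesgue_integral_def)

lemma set_integrable_MI: "set_integrable lborel {u..w} f \<longleftrightarrow> integrable (MI u w) f" for f :: "real \<Rightarrow> real"
  by (rule set_integrable_eq) simp

lemma L2on_iff: "L2on {u..w} f \<longleftrightarrow> f \<in> L2 (MI u w)"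
  unfolding L2on_def L2_def mem_Collect_eq set_integrable_MI set_borel_measurable_def
  by (subst borel_measurable_restrict_space_iff) auto

lemma continuous_MI_meas: "continuous_on {u..w} g \<Longrightarrow> g \<in> borel_measurable (MI u w)" for g :: "real \<Rightarrow> real"
  using borel_measurable_continuous_on_indicator[of "{u..w}" g]
  by (subst borel_measurable_restrict_space_iff) auto

lemma integrable_bounded_mult:
  fixes h g :: "'a \<Rightarrow> real"
  assumes h: "integrable M h" and g: "g \<in> borel_measurable M" and bd: "\<And>x. x \<in> space M \<Longrightarrow> \<bar>g x\<bar> \<le> K"
  shows "integrable M (\<lambda>x. g x * h x)"
proof (rule Bochner_Integration.integrable_bound)
  show "integrable M (\<lambda>x. K * \<bar>h x\<bar>)" using h by simp
  show "(\<lambda>x. g x * h x) \<in> borel_measurable M" using g h by measurable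
  show "AE x in M. norm (g x * h x) \<le> norm (K * \<bar>h x\<bar>)"
  proof (rule AE_I2)
    fix x assume "x \<in> space M"
    then have "\<bar>g x\<bar> \<le> \<bar>K\<bar>" using bd[of x] by simp
    then show "norm (g x * h x) \<le> norm (K * \<bar>h x\<bar>)" by (simp add: abs_mult mult_right_mono)
  qed
qed

lemma integrable_const_MI [simp]: "integrable (MI u w) (\<lambda>x. c::real)"
  by (rule finite_measure.integrable_const[OF finite_MI])

lemma continuous_bounded_MI:
  fixes g :: "real \<Rightarrow> real"
  assumes "continuous_on {u..w} g"
  obtains K where "\<And>x. x \<in> {u..w} \<Longrightarrow> \<bar>g x\<bar> \<le> K"
proof -
  have "bounded (g ` {u..w})" by (intro compact_imp_bounded compact_continuous_image assms) auto
  then obtain K where "\<forall>x\<in>{u..w}. \<bar>g x\<bar> \<le> K" unfolding bounded_iff by auto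
  then show ?thesis by (intro that) blast
qed

lemma integrable_continuous_mult:
  fixes h g :: "real \<Rightarrow> real"
  assumes h: "integrable (MI u w) h" and g: "continuous_on {u..w} g"
  shows "integrable (MI u w) (\<lambda>x. g x * h x)"
proof -
  obtain K where "\<And>x. x \<in> {u..w} \<Longrightarrow> \<bar>g x\<bar> \<le> K" using continuous_bounded_MI[OF g] by blast
  then show ?thesis by (intro integrable_bounded_mult[OF h continuous_MI_meas[OF g]]) (auto simp: space_restrict_space)
qed

lemma integrable_continuous_MI:
  fixes g :: "real \<Rightarrow> real"
  shows "continuous_on {u..w} g \<Longrightarrow> integrable (MI u w) g"
  using integrable_continuous_mult[OF integrable_const_MI[where c=1]] by simp

lemma continuous_L2:
  fixes g :: "real \<Rightarrow> real"
  assumes "continuous_on {u..w} g"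
  shows "g \<in> L2 (MI u w)"
  unfolding L2_def by (auto intro!: continuous_MI_meas integrable_continuous_MI continuous_intros assms)

lemma L2_bounded_mult:
  assumes h: "h \<in> L2 M" and g: "g \<in> borel_measurable M" and bd: "\<And>x. x \<in> space M \<Longrightarrow> \<bar>g x\<bar> \<le> K"
  shows "(\<lambda>x. g x * h x) \<in> L2 M"
proof -
  have "integrable M (\<lambda>x. (g x)\<^sup>2 * (h x)\<^sup>2)"
  proof (rule integrable_bounded_mult[OF L2_sq[OF h]])
    show "(\<lambda>x. (g x)\<^sup>2) \<in> borel_measurable M" using g by measurable
    show "\<bar>(g x)\<^sup>2\<bar> \<le> K\<^sup>2" if "x \<in> space M" for x
      using power_mono[OF bd[OF that], of 2] by simp
  qed
  then show ?thesis
    unfolding L2_def mem_Collect_eq power_mult_distrib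
    by (intro conjI borel_measurable_times L2_meas[OF h] g)
qed

lemma L2_integrable: "f \<in> L2 (MI u w) \<Longrightarrow> integrable (MI u w) f"
  using L2_mult[of f "MI u w" "\<lambda>_. 1"] continuous_L2[of u w "\<lambda>_. 1"] by simp

text \<open>Together with \<open>Tl\<close>, the integrals over [0,x] and [x,1], written over the
  fixed measure \<open>U01\<close> with an indicator, so that both are total in \<open>x\<close> and
  exchanging them is a plain Fubini argument.\<close>

definition Pr :: "(real \<Rightarrow> real) \<Rightarrow> real \<Rightarrow> real" where
  "Pr f x = (LINT s|U01. indicator {0..x} s * f s)"

definition Tl :: "(real \<Rightarrow> real) \<Rightarrow> real \<Rightarrow> real" where
  "Tl f x = (LINT s|U01. indicator {x..1} s * f s)"

lemma integrable_indicator_mult: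
  fixes f :: "real \<Rightarrow> real"
  assumes "integrable (MI u w) f" "A \<in> sets borel"
  shows "integrable (MI u w) (\<lambda>s. indicator A s * f s)"
proof (rule integrable_bounded_mult[OF assms(1), where K=1])
  show "indicator A \<in> borel_measurable (MI u w)"
    using assms(2) by (intro measurable_MI borel_measurable_indicator)
qed (auto simp: indicator_def)

lemma AE_MI_neq: "AE s in MI u w. s \<noteq> (x::real)"
  using AE_lborel_singleton[of x] by (auto simp: AE_MI elim: eventually_mono)

lemma Pr_Tl:
  assumes f: "integrable U01 f" and x: "0 \<le> x" "x \<le> 1"
  shows "Pr f x + Tl f x = (LINT s|U01. f s)"
proof -
  have "Pr f x + Tl f x = (LINT s|U01. indicator {0..x} s * f s + indicator {x..1} s * f s)"
    unfolding Pr_def Tl_def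
    by (rule Bochner_Integration.integral_add[symmetric]) (auto intro!: integrable_indicator_mult f)
  also have "\<dots> = (LINT s|U01. f s)"
  proof (rule integral_cong_AE)
    show "AE s in U01. indicator {0..x} s * f s + indicator {x..1} s * f s = f s"
      using AE_MI_neq[of x] AE_space
      by eventually_elim (use x in \<open>auto simp: indicator_def space_restrict_space\<close>)
  qed (use f in \<open>auto intro!: borel_measurable_integrable integrable_indicator_mult Bochner_Integration.integrable_add\<close>)
  finally show ?thesis .
qed

lemma Pr_LINT: "x \<le> 1 \<Longrightarrow> Pr f x = (LINT s:{0..x}|lborel. f s)"
  unfolding Pr_def set_lebesgue_integral_def
  by (subst integral_restrict_space) (auto intro!: Bochner_Integration.integral_cong simp: indicator_def)

lemma Pr_HK:
  assumes f: "integrable U01 f" and x: "0 \<le> x" "x \<le> 1"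
  shows "f integrable_on {0..x}" "Pr f x = integral {0..x} f"
proof -
  have "set_integrable lborel {0..1} f" using f by (simp add: set_integrable_MI)
  then have *: "set_integrable lborel {0..x} f" by (rule set_integrable_subset) (use x in auto)
  show "f integrable_on {0..x}" by (rule set_borel_integral_eq_integral[OF *])
  show "Pr f x = integral {0..x} f"
    using set_borel_integral_eq_integral(2)[OF *] Pr_LINT[OF x(2), of f] by simp
qed

lemma integral_U01_HK:
  fixes f :: "real \<Rightarrow> real"
  shows "integrable U01 f \<Longrightarrow> (LINT x|U01. f x) = integral {0..1} f"
  using set_borel_integral_eq_integral(2)[of "{0..1}" f] by (simp add: set_integrable_MI LINT_MI)

lemma Pr_cont: "integrable U01 f \<Longrightarrow> continuous_on {0..1} (Pr f)"
  using indefinite_integral_continuous_1[OF Pr_HK(1)[of f 1]]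
  by (subst continuous_on_cong[OF refl Pr_HK(2)]) auto

lemma Pr_0: "Pr f 0 = 0"
proof -
  have "Pr f 0 = (LINT s|U01. 0)"
    unfolding Pr_def
  proof (rule integral_cong_AE)
    have *: "(\<lambda>s. indicator {0..0} s * f s) = (\<lambda>s. indicator {0} s * f 0)"
      by (auto simp: indicator_def)
    show "(\<lambda>s. indicator {0..0} s * f s) \<in> borel_measurable U01"
      unfolding * by (intro measurable_MI) measurable
    show "AE s in U01. indicator {0..0} s * f s = 0"
      using AE_MI_neq[of 0] by eventually_elim (auto simp: indicator_def)
  qed simp
  then show ?thesis by simp
qed

lemma Tl_eq:
  assumes "integrable U01 f" "0 \<le> x" "x \<le> 1"
  shows "Tl f x = (LINT s|U01. f s) - Pr f x"
  using Pr_Tl[OF assms] by simp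

lemma Tl_cont: "integrable U01 f \<Longrightarrow> continuous_on {0..1} (Tl f)"
  by (subst continuous_on_cong[OF refl Tl_eq]) (auto intro!: continuous_intros Pr_cont)

lemma Tl_0: "integrable U01 f \<Longrightarrow> Tl f 0 = (LINT s|U01. f s)"
  by (simp add: Tl_eq Pr_0)

lemma Pr_1: "Pr f 1 = (LINT s|U01. f s)"
  unfolding Pr_def by (rule Bochner_Integration.integral_cong) (auto simp: space_restrict_space)

lemma Tl_1: "integrable U01 f \<Longrightarrow> Tl f 1 = 0"
  by (simp add: Tl_eq Pr_1)

lemma Tl_uminus: "Tl (\<lambda>s. - f s) x = - Tl f x"
  unfolding Tl_def by simp

lemma Tl_add:
  assumes "integrable U01 f" "integrable U01 g"
  shows "Tl (\<lambda>s. f s + c * g s) x = Tl f x + c * Tl g x"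
proof -
  have "Tl (\<lambda>s. f s + c * g s) x = (LINT s|U01. indicator {x..1} s * f s + c * (indicator {x..1} s * g s))"
    unfolding Tl_def by (rule Bochner_Integration.integral_cong) (auto simp: algebra_simps)
  also have "\<dots> = Tl f x + c * Tl g x"
    unfolding Tl_def using assms by (simp add: integrable_indicator_mult)
  finally show ?thesis .
qed

lemma Tl_deriv:
  assumes f: "integrable U01 f" and x: "0 < x" "x < 1" and c: "isCont f x"
  shows "(Tl f has_real_derivative - f x) (at x)"
proof -
  have "((\<lambda>u. integral {0..u} f) has_vector_derivative f x) (at x within ({0..1} - {}))"
    using x by (intro integral_has_vector_derivative_continuous_at Pr_HK(1)[OF f])
      (auto intro: continuous_at_imp_continuous_within c)
  then have "((\<lambda>u. integral {0..u} f) has_real_derivative f x) (at x within {0..1})"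
    by (simp add: has_real_derivative_iff_has_vector_derivative)
  then have "((\<lambda>u. integral {0..u} f) has_real_derivative f x) (at x)"
    using x at_within_Icc_at[of 0 x 1] by simp
  then have "((\<lambda>u. (LINT s|U01. f s) - integral {0..u} f) has_real_derivative - f x) (at x)"
    by (auto intro!: derivative_eq_intros)
  then show ?thesis
    by (rule has_field_derivative_transform_within_open[where S = "{0<..<1}"])
      (use x in \<open>auto simp: Tl_eq[OF f] Pr_HK(2)[OF f]\<close>)
qed

lemma Pr_deriv:
  assumes f: "integrable U01 f" and x: "0 < x" "x < 1" and c: "isCont f x"
  shows "(Pr f has_real_derivative f x) (at x)"
proof -
  have "((\<lambda>u. (LINT s|U01. f s) - Tl f u) has_real_derivative f x) (at x)"
    using Tl_deriv[OF f x c] by (auto intro!: derivative_eq_intros)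
  then show ?thesis
    by (rule has_field_derivative_transform_within_open[where S = "{0<..<1}"])
      (use x in \<open>auto simp: Tl_eq[OF f]\<close>)
qed

text \<open>Fubini on the triangle s \<le> x. This is integration by parts with no derivative taken,
  and the weak identities below rest on it.\<close>

lemma swap_Tl_Pr:
  assumes f: "integrable U01 f" and h: "integrable U01 h"
  shows "(LINT s|U01. f s * Tl h s) = (LINT x|U01. h x * Pr f x)"
proof -
  interpret U: finite_measure U01 by (rule finite_MI)
  interpret pair_sigma_finite U01 U01 ..
  have [measurable]: "f \<in> borel_measurable U01" "h \<in> borel_measurable U01"
    using f h by auto
  have m1: "(\<lambda>x. x) \<in> borel_measurable U01" by (intro measurable_MI) simp
  have [measurable]: "(\<lambda>p. fst p :: real) \<in> borel_measurable (U01 \<Otimes>\<^sub>M U01)"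
    "(\<lambda>p. snd p :: real) \<in> borel_measurable (U01 \<Otimes>\<^sub>M U01)"
    using measurable_compose[OF measurable_fst m1] measurable_compose[OF measurable_snd m1] by auto
  define k where "k s x = (if s \<le> x then 1 else 0) * (f s * h x)" for s x :: real
  have 1: "integrable (U01 \<Otimes>\<^sub>M U01) (\<lambda>p. f (fst p) * h (snd p))"
  proof (rule Fubini_integrable)
    show "integrable U01 (\<lambda>s. \<integral>x. norm (f (fst (s, x)) * h (snd (s, x))) \<partial>U01)"
      using f by (simp add: abs_mult)
    show "AE s in U01. integrable U01 (\<lambda>x. f (fst (s, x)) * h (snd (s, x)))"
      using h by simp
  qed measurable
  have 2: "integrable (U01 \<Otimes>\<^sub>M U01) (case_prod k)"
  proof (rule Bochner_Integration.integrable_bound[OF 1])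
    show "case_prod k \<in> borel_measurable (U01 \<Otimes>\<^sub>M U01)"
      unfolding k_def by measurable
    show "AE p in U01 \<Otimes>\<^sub>M U01. norm (case_prod k p) \<le> norm (f (fst p) * h (snd p))"
      by (rule AE_I2) (auto simp: k_def)
  qed
  have "(LINT s|U01. f s * Tl h s) = (LINT s|U01. (LINT x|U01. k s x))"
  proof (rule Bochner_Integration.integral_cong[OF refl])
    fix s assume "s \<in> space U01"
    have "f s * Tl h s = (LINT x|U01. f s * (indicator {s..1} x * h x))"
      unfolding Tl_def by simp
    also have "\<dots> = (LINT x|U01. k s x)"
      by (rule Bochner_Integration.integral_cong) (auto simp: k_def indicator_def space_restrict_space)
    finally show "f s * Tl h s = (LINT x|U01. k s x)" .
  qed
  also have "\<dots> = (LINT x|U01. (LINT s|U01. k s x))"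
    by (rule Fubini_integral[OF 2, symmetric])
  also have "\<dots> = (LINT x|U01. h x * Pr f x)"
  proof (rule Bochner_Integration.integral_cong[OF refl])
    fix x assume "x \<in> space U01"
    have "h x * Pr f x = (LINT s|U01. h x * (indicator {0..x} s * f s))"
      unfolding Pr_def by simp
    also have "\<dots> = (LINT s|U01. k s x)"
      by (rule Bochner_Integration.integral_cong) (auto simp: k_def indicator_def space_restrict_space)
    finally show "(LINT s|U01. k s x) = h x * Pr f x" by simp
  qed
  finally show ?thesis .
qed

text \<open>The positive and negative parts of \<open>f\<close>, used as densities, give finite
  measures that agree on all half-lines and hence coincide; densities are unique almost
  everywhere.\<close>

lemma Pr_zero_AE:
  assumes f: "integrable U01 f" and z: "\<And>x. 0 \<le> x \<Longrightarrow> x \<le> 1 \<Longrightarrow> Pr f x = 0"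
  shows "AE x in U01. f x = 0"
proof -
  define F where "F s = indicator {0..1} s * f s" for s
  have F: "integrable lborel F"
    using f unfolding F_def by (subst (asm) integrable_restrict_space) auto
  then have [measurable]: "F \<in> borel_measurable borel" by auto
  have tail: "(LINT s|lborel. indicator {x<..} s * F s) = 0" for x
  proof -
    \<comment> \<open>Clamping \<open>x\<close> to [0,1] changes the half-line only outside the
      support of \<open>F\<close>, up to null sets.\<close>
    define x' where "x' = max 0 (min 1 x)"
    have "(LINT s|lborel. indicator {x<..} s * F s) = (LINT s|U01. indicator {x<..} s * f s)"
      by (subst integral_restrict_space) (auto simp: F_def mult_ac)
    also have "\<dots> = Tl f x'"
      unfolding Tl_def
    proof (rule integral_cong_AE)
      show "AE s in U01. indicator {x<..} s * f s = indicator {x'..1} s * f s"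
        using AE_MI_neq[of x] AE_MI_neq[of 1] AE_MI_neq[of 0] AE_space
        by eventually_elim (auto simp: indicator_def space_restrict_space x'_def)
    qed (auto intro!: borel_measurable_integrable integrable_indicator_mult f)
    also have "\<dots> = 0"
      using Tl_eq[OF f, of x'] z[of x'] z[of 1] Pr_1[of f] by (simp add: x'_def)
    finally show ?thesis .
  qed
  define N1 where "N1 = density lborel (\<lambda>s. ennreal (max 0 (F s)))"
  define N2 where "N2 = density lborel (\<lambda>s. ennreal (max 0 (- F s)))"
  have ip: "integrable lborel (\<lambda>s. indicator {x<..} s * max 0 (F s))"
    and im: "integrable lborel (\<lambda>s. indicator {x<..} s * max 0 (- F s))" for x
    using integrable_mult_indicator[of "{x<..}" lborel "\<lambda>s. max 0 (F s)"]
      integrable_mult_indicator[of "{x<..}" lborel "\<lambda>s. max 0 (- F s)"] F by auto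
  have e1: "emeasure N1 {x<..} = ennreal (LINT s|lborel. indicator {x<..} s * max 0 (F s))" for x
  proof -
    have "emeasure N1 {x<..} = (\<integral>\<^sup>+s. ennreal (indicator {x<..} s * max 0 (F s)) \<partial>lborel)"
      unfolding N1_def by (subst emeasure_density) (auto intro!: nn_integral_cong simp: indicator_def)
    then show ?thesis using nn_integral_eq_integral[OF ip[of x]] by simp
  qed
  have e2: "emeasure N2 {x<..} = ennreal (LINT s|lborel. indicator {x<..} s * max 0 (- F s))" for x
  proof -
    have "emeasure N2 {x<..} = (\<integral>\<^sup>+s. ennreal (indicator {x<..} s * max 0 (- F s)) \<partial>lborel)"
      unfolding N2_def by (subst emeasure_density) (auto intro!: nn_integral_cong simp: indicator_def)
    then show ?thesis using nn_integral_eq_integral[OF im[of x]] by simp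
  qed
  have "N1 = N2"
  proof (rule measure_eqI_lessThan)
    show "sets N1 = sets borel" "sets N2 = sets borel" by (auto simp: N1_def N2_def)
    show "emeasure N1 {x<..} < \<infinity>" for x by (simp add: e1)
    fix x
    have "(LINT s|lborel. indicator {x<..} s * max 0 (F s)) - (LINT s|lborel. indicator {x<..} s * max 0 (- F s))
        = (LINT s|lborel. indicator {x<..} s * max 0 (F s) - indicator {x<..} s * max 0 (- F s))"
      by (rule Bochner_Integration.integral_diff[symmetric]) (rule ip im)+
    also have "\<dots> = (LINT s|lborel. indicator {x<..} s * F s)"
      by (rule Bochner_Integration.integral_cong) (auto simp: max_def algebra_simps)
    finally show "emeasure N1 {x<..} = emeasure N2 {x<..}" using tail[of x] by (simp add: e1 e2)
  qed
  then have "AE s in lborel. ennreal (max 0 (F s)) = ennreal (max 0 (- F s))"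
    unfolding N1_def N2_def
    by (intro sigma_finite_measure.density_unique[OF sigma_finite_lborel]) auto
  then have "AE s in lborel. F s = 0"
    by eventually_elim (auto simp: max_def split: if_splits)
  then show ?thesis unfolding AE_MI F_def by eventually_elim (auto simp: indicator_def)
qed

lemma continuous_AE_zero:
  fixes g :: "real \<Rightarrow> real"
  assumes c: "continuous_on {0..1} g" and z: "AE x in U01. g x = 0" and x: "x \<in> {0..1}"
  shows "g x = 0"
proof -
  have "integral {0..1} (\<lambda>x. (g x)\<^sup>2) = (LINT x|U01. (g x)\<^sup>2)"
    by (intro integral_U01_HK[symmetric] integrable_continuous_MI continuous_intros c)
  also have "\<dots> = 0"
    using z integral_nonneg_eq_0_iff_AE[OF integrable_continuous_MI[of 0 1 "\<lambda>x. (g x)\<^sup>2"]] c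
    by (auto intro!: continuous_intros)
  finally have "(\<lambda>x. (g x)\<^sup>2) x = 0"
    using x has_integral_0_cbox_imp_0[of 0 1 "\<lambda>x. (g x)\<^sup>2" x]
      integrable_integral[OF integrable_continuous_real[of 0 1 "\<lambda>x. (g x)\<^sup>2"]] c
    by (auto intro!: continuous_intros)
  then show ?thesis by simp
qed

lemma ip_cong_U01:
  fixes f g h :: "real \<Rightarrow> real"
  shows "(\<And>x. x \<in> {0..1} \<Longrightarrow> g x = h x) \<Longrightarrow> (LINT x|U01. f x * g x) = (LINT x|U01. f x * h x)"
  by (rule Bochner_Integration.integral_cong) (auto simp: space_restrict_space)

section \<open>The coefficient and its Dirichlet Green operator\<close>

locale wave_coeff =
  fixes b V :: "real \<Rightarrow> real" and bl bu :: real
  assumes bl: "0 < bl" and b_ge: "\<And>x. bl \<le> b x" and b_le: "\<And>x. b x \<le> bu"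
    and V_mono: "mono V" and bV: "\<And>x y. x \<le> y \<Longrightarrow> \<bar>b y - b x\<bar> \<le> V y - V x"
begin

lemma b_pos: "0 < b x"
  using bl b_ge[of x] by simp

lemma b_meas [measurable]: "b \<in> borel_measurable borel"
proof -
  have "mono (\<lambda>x. V x - b x)"
    by (rule monoI) (use bV in \<open>smt (verit)\<close>)
  then have "(\<lambda>x. V x - (V x - b x)) \<in> borel_measurable borel"
    using V_mono by (intro borel_measurable_diff borel_measurable_mono)
  then show ?thesis by simp
qed

text \<open>Taken from \<open>V\<close> rather than \<open>b\<close>: monotonicity makes this set
  countable, and off it \<open>b\<close> is continuous as well.\<close>

definition D :: "real set" where "D = {x. \<not> isCont V x}"

lemma D_countable: "countable D"
  unfolding D_def by (rule mono_ctble_discont[OF V_mono])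

lemma b_cont:
  assumes "x \<notin> D"
  shows "isCont b x"
proof -
  have "isCont V x" using assms by (simp add: D_def)
  then have "((\<lambda>y. \<bar>V y - V x\<bar>) \<longlongrightarrow> \<bar>V x - V x\<bar>) (at x)"
    unfolding isCont_def by (intro tendsto_intros)
  then have "((\<lambda>y. \<bar>V y - V x\<bar>) \<longlongrightarrow> 0) (at x)" by simp
  then have "((\<lambda>y. b y - b x) \<longlongrightarrow> 0) (at x)"
  proof (rule Lim_null_comparison[rotated], intro always_eventually allI)
    fix y show "norm (b y - b x) \<le> \<bar>V y - V x\<bar>"
      using bV[of x y] bV[of y x] by (cases "x \<le> y") auto
  qed
  then show ?thesis unfolding isCont_def by (rule LIM_zero_cancel)
qed

lemma b_abs: "\<bar>b x\<bar> \<le> bu"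
  using b_pos[of x] b_le[of x] by simp

lemma b_int_mult: "integrable U01 f \<Longrightarrow> integrable U01 (\<lambda>x. b x * f x)"
  by (rule integrable_bounded_mult[where K = bu]) (auto intro: b_abs measurable_MI)

lemma b_L2_mult: "f \<in> L2 U01 \<Longrightarrow> (\<lambda>x. b x * f x) \<in> L2 U01"
  by (rule L2_bounded_mult[where K = bu]) (auto intro: b_abs measurable_MI)

lemma b_int: "integrable U01 b"
  using b_int_mult[of "\<lambda>_. 1"] by simp

lemma b_int_cont: "continuous_on {0..1} f \<Longrightarrow> integrable U01 (\<lambda>x. b x * f x)"
  by (intro b_int_mult integrable_continuous_MI)

lemma b_integral_pos: "0 < (LINT x|U01. b x)"
proof -
  have "(LINT x|U01. bl) \<le> (LINT x|U01. b x)"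
    by (rule integral_mono) (auto intro: b_int b_ge)
  moreover have "measure U01 (space U01) = 1"
    by (simp add: space_restrict_space measure_restrict_space)
  ultimately show ?thesis using bl by simp
qed

text \<open>For u = \<open>G f\<close> the flux a u_x is \<open>Tl f + cc f\<close>, since its
  derivative must be -f. The constant makes u_x = \<open>Gd f\<close> integrate to zero, so that u
  vanishes at x = 1.\<close>

definition cc :: "(real \<Rightarrow> real) \<Rightarrow> real" where
  "cc f = - (LINT x|U01. b x * Tl f x) / (LINT x|U01. b x)"

definition Gd :: "(real \<Rightarrow> real) \<Rightarrow> real \<Rightarrow> real" where
  "Gd f x = b x * (Tl f x + cc f)"

text \<open>Green's operator of \<open>-(a u\<^sub>x)\<^sub>x\<close> with Dirichlet conditions.\<close>

definition G :: "(real \<Rightarrow> real) \<Rightarrow> real \<Rightarrow> real" where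
  "G f = Pr (Gd f)"

lemma Tl_L1_cont: "f \<in> L2 U01 \<Longrightarrow> continuous_on {0..1} (Tl f)"
  by (intro Tl_cont L2_integrable)

lemma Gd_L2: "f \<in> L2 U01 \<Longrightarrow> Gd f \<in> L2 U01"
  unfolding Gd_def by (rule b_L2_mult, rule continuous_L2, intro continuous_on_add continuous_on_const Tl_L1_cont)

lemma Gd_integral:
  assumes "f \<in> L2 U01"
  shows "(LINT x|U01. Gd f x) = 0"
proof -
  have "(LINT x|U01. Gd f x) = (LINT x|U01. b x * Tl f x + cc f * b x)"
    by (simp add: Gd_def algebra_simps)
  also have "\<dots> = (LINT x|U01. b x * Tl f x) + cc f * (LINT x|U01. b x)"
    using b_int_cont[OF Tl_L1_cont[OF assms]] b_int by simp
  also have "\<dots> = 0" using b_integral_pos by (simp add: cc_def)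
  finally show ?thesis .
qed

lemma G_cont: "f \<in> L2 U01 \<Longrightarrow> continuous_on {0..1} (G f)"
  unfolding G_def by (intro Pr_cont L2_integrable Gd_L2)

lemma G_L2: "f \<in> L2 U01 \<Longrightarrow> G f \<in> L2 U01"
  by (rule continuous_L2[OF G_cont])

lemma Gn_L2: "f \<in> L2 U01 \<Longrightarrow> (G ^^ n) f \<in> L2 U01"
  by (induction n) (auto intro: G_L2)

text \<open>Both come from exchanging \<open>Pr\<close> for \<open>Tl\<close>. The first formula
  feeds the energy identity in \<open>G_inj\<close>; the second is symmetric in \<open>f\<close> and
  \<open>h\<close>, which is the symmetry of \<open>G\<close>.\<close>

lemma G_form:
  assumes f: "f \<in> L2 U01" and h: "h \<in> L2 U01"
  shows "(LINT x|U01. G f x * h x) = (LINT x|U01. b x * (Tl f x + cc f) * Tl h x)"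
    and "(LINT x|U01. G f x * h x) = (LINT x|U01. b x * Tl f x * Tl h x)
      - (LINT x|U01. b x * Tl f x) * (LINT x|U01. b x * Tl h x) / (LINT x|U01. b x)"
proof -
  show *: "(LINT x|U01. G f x * h x) = (LINT x|U01. b x * (Tl f x + cc f) * Tl h x)"
    using swap_Tl_Pr[OF L2_integrable[OF Gd_L2[OF f]] L2_integrable[OF h]]
    unfolding G_def by (simp add: Gd_def mult.commute)
  have "(LINT x|U01. b x * (Tl f x + cc f) * Tl h x) = (LINT x|U01. b x * (Tl f x * Tl h x) + cc f * (b x * Tl h x))"
    by (simp add: algebra_simps)
  also have "\<dots> = (LINT x|U01. b x * (Tl f x * Tl h x)) + cc f * (LINT x|U01. b x * Tl h x)"
    using b_int_cont[OF continuous_on_mult[OF Tl_L1_cont[OF f] Tl_L1_cont[OF h]]] b_int_cont[OF Tl_L1_cont[OF h]] by simp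
  finally show "(LINT x|U01. G f x * h x) = (LINT x|U01. b x * Tl f x * Tl h x)
      - (LINT x|U01. b x * Tl f x) * (LINT x|U01. b x * Tl h x) / (LINT x|U01. b x)"
    unfolding * by (simp add: cc_def mult.assoc)
qed

lemma G_symm:
  assumes f: "f \<in> L2 U01" and h: "h \<in> L2 U01"
  shows "(LINT x|U01. G f x * h x) = (LINT x|U01. f x * G h x)"
proof -
  have "(LINT x|U01. f x * G h x) = (LINT x|U01. G h x * f x)" by (simp add: mult.commute)
  then show ?thesis
    unfolding G_form(2)[OF f h] G_form(2)[OF h f] by (simp add: mult_ac)
qed

text \<open>The pairing of \<open>G f\<close> with \<open>f\<close> equals the integral of
  \<open>b\<close> times the squared flux \<open>Tl f + cc f\<close>. If it is zero, the continuous
  flux vanishes identically; at x = 1 this gives \<open>cc f = 0\<close>, and then all tail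
  integrals of \<open>f\<close> vanish.\<close>

lemma G_inj:
  assumes f: "f \<in> L2 U01" and z: "AE x in U01. G f x = 0"
  shows "AE x in U01. f x = 0"
proof -
  let ?T = "\<lambda>x. Tl f x + cc f"
  have cT: "continuous_on {0..1} ?T" by (intro continuous_intros Tl_L1_cont f)
  have iT: "integrable U01 (\<lambda>x. b x * (?T x)\<^sup>2)" by (intro b_int_cont continuous_intros cT)
  have "(LINT x|U01. b x * (?T x)\<^sup>2) = (LINT x|U01. b x * ?T x * Tl f x + cc f * Gd f x)"
    by (simp add: Gd_def power2_eq_square algebra_simps)
  also have "\<dots> = (LINT x|U01. b x * ?T x * Tl f x) + cc f * (LINT x|U01. Gd f x)"
    using b_int_cont[OF continuous_on_mult[OF cT Tl_L1_cont[OF f]]] L2_integrable[OF Gd_L2[OF f]]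
    by (simp add: mult.assoc)
  also have "\<dots> = (LINT x|U01. G f x * f x)"
    unfolding Gd_integral[OF f] G_form(1)[OF f f] by simp
  also have "\<dots> = (LINT x|U01. 0)"
    using z L2_mult[OF G_L2[OF f] f] by (intro integral_cong_AE) (auto elim: eventually_mono)
  finally have "AE x in U01. b x * (?T x)\<^sup>2 = 0"
    using integral_nonneg_eq_0_iff_AE[OF iT] b_pos by (simp add: less_imp_le)
  then have "AE x in U01. ?T x = 0"
    using b_pos by (auto elim!: eventually_mono simp: less_le)
  then have T0: "?T x = 0" if "x \<in> {0..1}" for x
    using continuous_AE_zero[OF cT _ that] by blast
  have "cc f = 0" using T0[of 1] Tl_1[OF L2_integrable[OF f]] by simp
  then have Tz: "Tl f x = 0" if "x \<in> {0..1}" for x using T0[OF that] by simp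
  show ?thesis
    using Tl_eq[OF L2_integrable[OF f]] Tz Tz[of 0] Tl_0[OF L2_integrable[OF f]]
    by (intro Pr_zero_AE L2_integrable f) auto
qed

text \<open>Symmetry turns the squared norm of iterate n+1 into the pairing of iterates n and n+2,
  which is the log-convexity required. It yields \<open>G f = 0\<close>, and injectivity removes the
  last \<open>G\<close>.\<close>

lemma G_decay_zero:
  assumes f: "f \<in> L2 U01" and d: "\<And>n. nrm U01 ((G ^^ n) f) \<le> C * K ^ n / fact n"
  shows "AE x in U01. f x = 0"
proof -
  have "nrm U01 ((G ^^ 1) f) = 0"
  proof (rule log_convex_factorial_decay[where C = C and K = K])
    fix n
    have "(nrm U01 ((G ^^ Suc n) f))\<^sup>2 = (LINT x|U01. G ((G ^^ n) f) x * (G ^^ Suc n) f x)"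
      unfolding nrm_sq by (simp add: power2_eq_square)
    also have "\<dots> = (LINT x|U01. (G ^^ n) f x * (G ^^ Suc (Suc n)) f x)"
      using G_symm[OF Gn_L2[OF f, of n] Gn_L2[OF f, of "Suc n"]] by simp
    also have "\<dots> \<le> nrm U01 ((G ^^ n) f) * nrm U01 ((G ^^ Suc (Suc n)) f)"
      using L2_CS[OF Gn_L2[OF f, of n] Gn_L2[OF f, of "Suc (Suc n)"]] by linarith
    finally show "(nrm U01 ((G ^^ Suc n) f))\<^sup>2 \<le> nrm U01 ((G ^^ n) f) * nrm U01 ((G ^^ Suc (Suc n)) f)" .
  qed (use d in auto)
  then have "AE x in U01. G f x = 0" using nrm_eq_0_iff[OF G_L2[OF f]] by simp
  then show ?thesis by (rule G_inj[OF f])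
qed

section \<open>The Volterra operator and totality of the expansion coefficients\<close>

definition Vo :: "(real \<Rightarrow> real) \<Rightarrow> real \<Rightarrow> real" where
  "Vo f = Tl (\<lambda>s. b s * Tl f s)"

lemma Vo_cont: "f \<in> L2 U01 \<Longrightarrow> continuous_on {0..1} (Vo f)"
  unfolding Vo_def by (intro Tl_cont b_int_cont Tl_L1_cont)

lemma Vo_L2: "f \<in> L2 U01 \<Longrightarrow> Vo f \<in> L2 U01"
  by (rule continuous_L2[OF Vo_cont])

lemma Von_L2: "f \<in> L2 U01 \<Longrightarrow> (Vo ^^ n) f \<in> L2 U01"
  by (induction n) (auto intro: Vo_L2)

text \<open>\<open>Vo f\<close> solves (a u_x)_x = f with zero Cauchy data at x = 1, so
  \<open>G f\<close> and \<open>- Vo f\<close> satisfy the same equation. They differ by a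
  homogeneous solution vanishing at x = 1, a multiple of \<open>Tl b\<close>: \<open>G\<close> is a
  rank-one perturbation of a Volterra operator.\<close>

lemma G_Vo:
  assumes f: "f \<in> L2 U01" and x: "x \<in> {0..1}"
  shows "G f x = - Vo f x - cc f * Tl b x"
proof -
  have "G f x = - Tl (Gd f) x"
    unfolding G_def using Tl_eq[OF L2_integrable[OF Gd_L2[OF f]], of x] Gd_integral[OF f] x by simp
  also have "Tl (Gd f) x = Tl (\<lambda>s. b s * Tl f s + cc f * b s) x"
    by (simp add: Gd_def[abs_def] algebra_simps)
  also have "\<dots> = Vo f x + cc f * Tl b x"
    unfolding Vo_def by (rule Tl_add[OF b_int_cont[OF Tl_L1_cont[OF f]] b_int])
  finally show ?thesis by simp
qed

text \<open>Coefficients of p = sum of cA_j q^(2j) and y = sum of cB_j q^(2j+1), found by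
  integrating p_x = y_t and y_x = b p_t from x = 1. For b = 1 they are (x-1)^(2j) / (2j)! and
  (x-1)^(2j+1) / (2j+1)!.\<close>

fun cA cB :: "nat \<Rightarrow> real \<Rightarrow> real" where
  "cA 0 x = 1"
| "cA (Suc j) x = - Tl (cB j) x"
| "cB j x = - Tl (\<lambda>s. b s * cA j s) x"

declare cB.simps [simp del]

lemma cA_cont: "continuous_on {0..1} (cA j)"
  and cB_cont: "continuous_on {0..1} (cB j)"
proof -
  have "continuous_on {0..1} (cA j) \<and> continuous_on {0..1} (cB j)"
  proof (induction j)
    case 0
    have "cA 0 = (\<lambda>_. 1)" by auto
    then show ?case
      by (auto simp: cB.simps[abs_def] b_int intro!: continuous_intros Tl_cont)
  next
    case (Suc j)
    have 1: "cA (Suc j) = (\<lambda>x. - Tl (cB j) x)" by auto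
    have 2: "cB (Suc j) = (\<lambda>x. - Tl (\<lambda>s. b s * cA (Suc j) s) x)" by (auto simp: cB.simps)
    have "continuous_on {0..1} (cA (Suc j))"
      unfolding 1 using Suc by (intro continuous_intros Tl_cont integrable_continuous_MI) auto
    then show ?case
      unfolding 2 by (auto intro!: continuous_intros Tl_cont b_int_cont simp del: cA.simps)
  qed
  then show "continuous_on {0..1} (cA j)" "continuous_on {0..1} (cB j)" by auto
qed

lemma cB_L2: "cB j \<in> L2 U01" and cA_L2: "cA j \<in> L2 U01"
  by (auto intro: continuous_L2 cA_cont cB_cont)

lemma Vo_cB: "Vo (cB j) = cB (Suc j)"
proof -
  have "cB (Suc j) x = - Tl (\<lambda>s. - (b s * Tl (cB j) s)) x" for x by (simp add: cB.simps[of "Suc j"])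
  then show ?thesis by (simp add: Tl_uminus Vo_def fun_eq_iff)
qed

lemma cB_0: "cB 0 x = - Tl b x"
  by (simp add: cB.simps)

lemma G_cB: "x \<in> {0..1} \<Longrightarrow> G (cB j) x = - cB (Suc j) x + cc (cB j) * cB 0 x"
  by (simp add: G_Vo[OF cB_L2] Vo_cB cB_0)

text \<open>Integrating c (1-s)^k over [x,1] raises the exponent by one and divides by the new
  exponent, the source of the factorial decay. The evaluation compares \<open>Tl g\<close> with the
  explicit primitive; both are zero at x = 1.\<close>

lemma Tl_bound:
  assumes m: "f \<in> borel_measurable U01" and f: "\<And>s. s \<in> {0..1} \<Longrightarrow> \<bar>f s\<bar> \<le> c * (1 - s) ^ k" and x: "x \<in> {0..1}"
  shows "\<bar>Tl f x\<bar> \<le> c * (1 - x) ^ Suc k / Suc k"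
proof -
  define g where "g s = c * (1 - s) ^ k" for s :: real
  have gc: "continuous_on {0..1} g" unfolding g_def by (intro continuous_intros)
  have gi: "integrable U01 g" by (rule integrable_continuous_MI[OF gc])
  have fi: "integrable U01 f"
    by (rule Bochner_Integration.integrable_bound[OF gi m])
      (use f in \<open>auto intro!: AE_I2 simp: g_def space_restrict_space intro: order_trans[OF _ abs_ge_self]\<close>)
  have "\<bar>Tl f x\<bar> \<le> (LINT s|U01. \<bar>indicator {x..1} s * f s\<bar>)"
    unfolding Tl_def by (rule integral_abs_bound)
  also have "\<dots> \<le> (LINT s|U01. indicator {x..1} s * g s)"
  proof (rule integral_mono)
    show "integrable U01 (\<lambda>s. \<bar>indicator {x..1} s * f s\<bar>)" "integrable U01 (\<lambda>s. indicator {x..1} s * g s)"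
      by (auto intro!: integrable_abs integrable_indicator_mult fi gi simp del: abs_mult)
  qed (use f in \<open>auto simp: abs_mult g_def space_restrict_space indicator_def\<close>)
  also have "\<dots> = Tl g x" by (simp add: Tl_def)
  also have "Tl g x = c * (1 - x) ^ Suc k / Suc k"
  proof -
    define H where "H u = Tl g u - c / Suc k * (1 - u) ^ Suc k" for u
    have Hc: "continuous_on {0..1} H" unfolding H_def by (intro continuous_intros Tl_cont gi) auto
    have Hd: "(H has_real_derivative 0) (at u)" if "0 < u" "u < 1" for u
    proof -
      have "isCont g u" unfolding g_def by (intro continuous_intros)
      note T = Tl_deriv[OF gi that this]
      have "((\<lambda>u. (1 - u) ^ Suc k) has_real_derivative - (real (Suc k) * (1 - u) ^ k)) (at u)"
        by (rule derivative_eq_intros refl)+ simp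
      from DERIV_diff[OF T DERIV_cmult[OF this, of "c / Suc k"]]
      show ?thesis by (simp add: g_def H_def[abs_def] del: of_nat_Suc)
    qed
    have "H x = H 1"
    proof (cases "x = 1")
      case False
      then show ?thesis
        using DERIV_isconst_end[of x 1 H] x Hd continuous_on_subset[OF Hc, of "{x..1}"] by auto
    qed simp
    then show ?thesis by (simp add: H_def Tl_1[OF gi])
  qed
  finally show ?thesis .
qed

text \<open>The first application of \<open>Vo\<close> is spent on passing from the L^2 norm to a
  pointwise bound. Each later one consists of two tail integrals and gains two powers and two
  divisors; keeping one of each suffices.\<close>

lemma Vo_bound:
  assumes f: "f \<in> L2 U01" and x: "x \<in> {0..1}"
  shows "\<bar>(Vo ^^ Suc n) f x\<bar> \<le> bu ^ Suc n * nrm U01 f * (1 - x) ^ n / fact n"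
  using x
proof (induction n arbitrary: x)
  case 0
  have one: "nrm U01 (\<lambda>_. 1) = 1"
    by (simp add: nrm_def space_restrict_space measure_restrict_space)
  have Tb: "\<bar>Tl f s\<bar> \<le> nrm U01 f" for s
  proof -
    have "\<bar>Tl f s\<bar> \<le> (LINT u|U01. \<bar>indicator {s..1} u * f u\<bar>)"
      unfolding Tl_def by (rule integral_abs_bound)
    also have "\<dots> \<le> (LINT u|U01. \<bar>f u\<bar> * 1)"
    proof (rule integral_mono)
      show "integrable U01 (\<lambda>u. \<bar>indicator {s..1} u * f u\<bar>)"
        by (intro integrable_abs integrable_indicator_mult L2_integrable f) simp
    qed (use L2_integrable[OF f] in \<open>auto simp: abs_mult indicator_def\<close>)
    also have "\<dots> \<le> nrm U01 f * 1"
      using L2_CS[OF L2_abs[OF f] continuous_L2[of 0 1 "\<lambda>_. 1"]] by (simp add: nrm_abs one)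
    finally show ?thesis by simp
  qed
  have "\<bar>Tl (\<lambda>s. b s * Tl f s) x\<bar> \<le> bu * nrm U01 f * (1 - x) ^ Suc 0 / Suc 0"
  proof (rule Tl_bound)
    show "(\<lambda>s. b s * Tl f s) \<in> borel_measurable U01"
      by (intro borel_measurable_integrable b_int_cont Tl_L1_cont f)
    show "\<bar>b s * Tl f s\<bar> \<le> bu * nrm U01 f * (1 - s) ^ 0" for s
      using mult_mono[OF b_abs[of s] Tb[of s]] b_abs[of s] by (simp add: abs_mult)
  qed (use 0 in simp)
  also have "\<dots> \<le> bu * nrm U01 f"
    using 0 b_abs[of 0] by (auto intro!: mult_left_le mult_nonneg_nonneg)
  finally show ?case by (simp add: Vo_def)
next
  case (Suc n)
  let ?h = "(Vo ^^ Suc n) f"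
  define c where "c = bu ^ Suc n * nrm U01 f / fact n"
  have bu0: "bu \<ge> 0" using b_abs[of 0] by simp
  have hL: "?h \<in> L2 U01" by (rule Von_L2[OF f])
  have c0: "c \<ge> 0" using bu0 by (simp add: c_def)
  have 1: "\<bar>Tl ?h s\<bar> \<le> c * (1 - s) ^ Suc n / Suc n" if "s \<in> {0..1}" for s
    by (rule Tl_bound[OF L2_meas[OF hL] _ that]) (use Suc.IH in \<open>simp add: c_def\<close>)
  have "\<bar>Tl (\<lambda>s. b s * Tl ?h s) x\<bar> \<le> bu * c / Suc n * (1 - x) ^ Suc (Suc n) / Suc (Suc n)"
  proof (rule Tl_bound)
    show "(\<lambda>s. b s * Tl ?h s) \<in> borel_measurable U01"
      by (intro borel_measurable_integrable b_int_cont Tl_L1_cont hL)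
    fix s :: real assume s: "s \<in> {0..1}"
    have "\<bar>b s * Tl ?h s\<bar> \<le> bu * (c * (1 - s) ^ Suc n / Suc n)"
      unfolding abs_mult by (intro mult_mono b_abs 1 s bu0) auto
    then show "\<bar>b s * Tl ?h s\<bar> \<le> bu * c / Suc n * (1 - s) ^ Suc n" by simp
  qed (use Suc.prems in simp)
  also have "\<dots> \<le> bu * c / Suc n * (1 - x) ^ Suc n"
  proof -
    have x: "0 \<le> x" "x \<le> 1" using Suc.prems by auto
    have "bu * c / Suc n * (1 - x) ^ Suc (Suc n) / Suc (Suc n) = (bu * c / Suc n * (1 - x) ^ Suc n) * ((1 - x) / Suc (Suc n))"
      by simp
    also have "\<dots> \<le> bu * c / Suc n * (1 - x) ^ Suc n"
      using x bu0 c0 by (intro mult_left_le) (auto simp: divide_simps)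
    finally show ?thesis .
  qed
  also have "\<dots> = bu ^ Suc (Suc n) * nrm U01 f * (1 - x) ^ Suc n / fact (Suc n)"
    by (simp add: c_def field_simps)
  finally show ?case by (subst funpow.simps(2), subst o_apply, subst Vo_def)
qed

text \<open>Orthogonality to \<open>cB 0\<close> turns the adjoint of the quasinilpotent operator \<open>Vo\<close> into \<open>- G\<close>.\<close>

lemma cB_total:
  assumes f: "f \<in> L2 U01" and o: "\<And>j. (LINT x|U01. f x * cB j x) = 0"
  shows "AE x in U01. f x = 0"
proof -
  \<comment> \<open>Orthogonality to all \<open>cB j\<close> passes to every iterate, since
    \<open>G\<close> maps \<open>cB j\<close> into the span of \<open>cB (Suc j)\<close> and
    \<open>cB 0\<close>.\<close>
  have on: "(LINT x|U01. (G ^^ n) f x * cB j x) = 0" for n j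
  proof (induction n arbitrary: j)
    case (Suc n)
    let ?h = "(G ^^ n) f"
    have i: "integrable U01 (\<lambda>x. ?h x * cB i x)" for i by (intro L2_mult Gn_L2 f cB_L2)
    have "(LINT x|U01. (G ^^ Suc n) f x * cB j x) = (LINT x|U01. ?h x * G (cB j) x)"
      using G_symm[OF Gn_L2[OF f] cB_L2] by simp
    also have "\<dots> = (LINT x|U01. ?h x * (- cB (Suc j) x + cc (cB j) * cB 0 x))"
      by (rule ip_cong_U01) (rule G_cB)
    also have "\<dots> = (LINT x|U01. - (?h x * cB (Suc j) x) + cc (cB j) * (?h x * cB 0 x))"
      by (simp add: algebra_simps)
    also have "\<dots> = 0" using i Suc by simp
    finally show ?case .
  qed (use o in simp)
  have adj: "(LINT x|U01. (G ^^ n) f x * h x) = (- 1) ^ n * (LINT x|U01. f x * (Vo ^^ n) h x)" if h: "h \<in> L2 U01" for n h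
    using h
  proof (induction n arbitrary: h)
    case (Suc n)
    let ?k = "(G ^^ n) f"
    have i: "integrable U01 (\<lambda>x. ?k x * cB 0 x)" "integrable U01 (\<lambda>x. ?k x * Vo h x)"
      by (intro L2_mult Gn_L2 f cB_L2 Vo_L2 Suc.prems)+
    have "(LINT x|U01. (G ^^ Suc n) f x * h x) = (LINT x|U01. ?k x * G h x)"
      using G_symm[OF Gn_L2[OF f] Suc.prems] by simp
    also have "\<dots> = (LINT x|U01. ?k x * (- Vo h x + cc h * cB 0 x))"
      by (rule ip_cong_U01) (simp add: G_Vo[OF Suc.prems] cB_0)
    also have "\<dots> = (LINT x|U01. - (?k x * Vo h x) + cc h * (?k x * cB 0 x))"
      by (simp add: algebra_simps)
    also have "\<dots> = - (LINT x|U01. ?k x * Vo h x)" using i on by simp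
    also have "\<dots> = (- 1) ^ Suc n * (LINT x|U01. f x * (Vo ^^ Suc n) h x)"
      using Suc.IH[OF Vo_L2[OF Suc.prems]] by (simp add: funpow_swap1)
    finally show ?case .
  qed simp
  have bu0: "bu \<ge> 0" using b_abs[of 0] by simp
  \<comment> \<open>For h = G^(n+1) f the adjoint formula bounds the squared norm of h by the norm
    of f times the norm of Vo^(n+1) h. The latter is the norm of h times a factorially small factor,
    and one norm of h cancels. Starting from \<open>G f\<close> provides the index n+1.\<close>
  have "nrm U01 ((G ^^ n) (G f)) \<le> (nrm U01 f * bu) * bu ^ n / fact n" for n
  proof -
    let ?h = "(G ^^ Suc n) f"
    define c where "c = bu ^ Suc n * nrm U01 ?h / fact n"
    have c0: "c \<ge> 0" using bu0 by (simp add: c_def)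
    have hL: "?h \<in> L2 U01" by (rule Gn_L2[OF f])
    have Vb: "\<bar>(Vo ^^ Suc n) ?h x\<bar> \<le> c" if x: "x \<in> {0..1}" for x
    proof -
      have "\<bar>(Vo ^^ Suc n) ?h x\<bar> \<le> bu ^ Suc n * nrm U01 ?h * (1 - x) ^ n / fact n"
        by (rule Vo_bound[OF hL x])
      also have "\<dots> = c * (1 - x) ^ n" by (simp add: c_def)
      also have "\<dots> \<le> c" using x c0 by (intro mult_left_le power_le_one) auto
      finally show ?thesis .
    qed
    have nV: "nrm U01 ((Vo ^^ Suc n) ?h) \<le> c"
    proof -
      have "(LINT x|U01. ((Vo ^^ Suc n) ?h x)\<^sup>2) \<le> (LINT x|U01. c\<^sup>2)"
      proof (rule integral_mono)
        show "((Vo ^^ Suc n) ?h x)\<^sup>2 \<le> c\<^sup>2" if "x \<in> space U01" for x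
          using power_mono[OF Vb[of x], of 2] that by (simp add: space_restrict_space)
        show "integrable U01 (\<lambda>x. ((Vo ^^ Suc n) ?h x)\<^sup>2)" by (rule L2_sq[OF Von_L2[OF hL]])
      qed simp
      also have "\<dots> = c\<^sup>2" by (simp add: space_restrict_space measure_restrict_space)
      finally show ?thesis using c0 by (simp add: nrm_def real_le_lsqrt)
    qed
    have "(nrm U01 ?h)\<^sup>2 = (LINT x|U01. ?h x * ?h x)" unfolding nrm_sq by (simp add: power2_eq_square)
    also have "\<dots> \<le> \<bar>\<integral>x. f x * (Vo ^^ Suc n) ?h x \<partial>U01\<bar>"
      unfolding adj[OF hL, of "Suc n"] by (rule order_trans[OF abs_ge_self]) (simp add: abs_mult power_abs)
    also have "\<dots> \<le> nrm U01 f * c"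
      using L2_CS[OF f Von_L2[OF hL, of "Suc n"]] nV mult_left_mono[OF nV nrm_ge0[of U01 f]] by linarith
    finally have "nrm U01 ?h * nrm U01 ?h \<le> nrm U01 ?h * (nrm U01 f * bu * bu ^ n / fact n)"
      by (simp add: c_def power2_eq_square mult_ac)
    then have "nrm U01 ?h = 0 \<or> nrm U01 ?h \<le> nrm U01 f * bu * bu ^ n / fact n"
      using nrm_ge0[of U01 ?h] by (metis less_le mult_le_cancel_left_pos)
    then have "nrm U01 ?h \<le> nrm U01 f * bu * bu ^ n / fact n"
      using bu0 by (elim disjE) simp_all
    then show ?thesis by (simp add: funpow_swap1)
  qed
  from G_decay_zero[OF G_L2[OF f] this] have "AE x in U01. G f x = 0" .
  then show ?thesis by (rule G_inj[OF f])
qed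

text \<open>Because \<open>cA (Suc j)\<close> is a tail integral of \<open>cB j\<close>, exchanging
  the integrals makes the primitive of \<open>f\<close> orthogonal to every \<open>cB j\<close>; the
  primitive vanishes, and with it \<open>f\<close>.\<close>

lemma cA_total:
  assumes f: "f \<in> L2 U01" and o: "\<And>j. (LINT x|U01. f x * cA j x) = 0"
  shows "AE x in U01. f x = 0"
proof -
  have fi: "integrable U01 f" by (rule L2_integrable[OF f])
  have Pc: "continuous_on {0..1} (Pr f)" by (rule Pr_cont[OF fi])
  have "(LINT x|U01. Pr f x * cB j x) = 0" for j
    using swap_Tl_Pr[OF fi L2_integrable[OF cB_L2[of j]]] o[of "Suc j"] by (simp add: mult.commute)
  then have "AE x in U01. Pr f x = 0" by (rule cB_total[OF continuous_L2[OF Pc]])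
  from continuous_AE_zero[OF Pc this] show ?thesis
    by (intro Pr_zero_AE[OF fi]) simp
qed

end

section \<open>Polynomial solutions and energy estimates\<close>

definition pdiff :: "(real \<Rightarrow> real poly) \<Rightarrow> real poly \<Rightarrow> real \<Rightarrow> bool" where
  "pdiff p p' x \<longleftrightarrow> (\<exists>n. \<forall>z. degree (p z) \<le> n) \<and>
     (\<forall>i. ((\<lambda>z. coeff (p z) i) has_real_derivative coeff p' i) (at x))"

definition pcont :: "(real \<Rightarrow> real poly) \<Rightarrow> bool" where
  "pcont p \<longleftrightarrow> (\<exists>n. \<forall>z. degree (p z) \<le> n) \<and> (\<forall>i. continuous_on {0..1} (\<lambda>z. coeff (p z) i))"

lemma degree_bounded_mult:
  assumes "\<exists>n. \<forall>z. degree (p z) \<le> n" "\<exists>n. \<forall>z. degree (q z) \<le> n"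
  shows "\<exists>n. \<forall>z::real. degree (p z * q z :: real poly) \<le> n"
  using assms by (meson add_mono degree_mult_le order_trans)

lemma pdiff_mult:
  assumes "pdiff p p' x" "pdiff q q' x"
  shows "pdiff (\<lambda>z. p z * q z) (p' * q x + p x * q') x"
proof -
  have "((\<lambda>z. coeff (p z * q z) i) has_real_derivative coeff (p' * q x + p x * q') i) (at x)" for i
  proof -
    have "((\<lambda>z. coeff (p z) k * coeff (q z) (i - k)) has_real_derivative
        coeff p' k * coeff (q x) (i - k) + coeff (p x) k * coeff q' (i - k)) (at x)" for k
      using assms DERIV_mult'[of "\<lambda>z. coeff (p z) k" "coeff p' k" x UNIV "\<lambda>z. coeff (q z) (i - k)" "coeff q' (i - k)"]
      by (simp add: pdiff_def add.commute)
    then have "((\<lambda>z. \<Sum>k\<le>i. coeff (p z) k * coeff (q z) (i - k)) has_real_derivative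
        (\<Sum>k\<le>i. coeff p' k * coeff (q x) (i - k) + coeff (p x) k * coeff q' (i - k))) (at x)"
      by (rule DERIV_sum)
    then show ?thesis by (simp add: coeff_mult sum.distrib)
  qed
  then show ?thesis
    using assms degree_bounded_mult[of p q] by (simp add: pdiff_def)
qed

lemma pcont_mult:
  assumes "pcont p" "pcont q"
  shows "pcont (\<lambda>z. p z * q z)"
proof -
  have "continuous_on {0..1} (\<lambda>z. coeff (p z * q z) i)" for i
    unfolding coeff_mult using assms by (intro continuous_intros) (auto simp: pcont_def)
  then show ?thesis
    using assms degree_bounded_mult[of p q] by (simp add: pcont_def)
qed

lemma poly_sum_upto:
  fixes p :: "real poly"
  assumes "degree p \<le> n"
  shows "poly p t = (\<Sum>i\<le>n. coeff p i * t ^ i)"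
  unfolding poly_altdef
  by (rule sum.mono_neutral_left) (use assms in \<open>auto intro: coeff_eq_0\<close>)

lemma integral_poly_upto:
  fixes p :: "real poly"
  assumes "degree p \<le> n" "s \<le> r"
  shows "integral {s..r} (poly p) = (\<Sum>i\<le>n. coeff p i * (r ^ Suc i - s ^ Suc i) / Suc i)"
proof (rule integral_unique)
  have "(poly p has_integral (\<Sum>i\<le>n. coeff p i * r ^ Suc i / Suc i) - (\<Sum>i\<le>n. coeff p i * s ^ Suc i / Suc i)) {s..r}"
  proof (rule fundamental_theorem_of_calculus[OF assms(2)])
    fix t
    have "((\<lambda>t. coeff p i * t ^ Suc i / Suc i) has_real_derivative coeff p i * t ^ i) (at t within {s..r})" for i
    proof -
      have "((\<lambda>t. t ^ Suc i) has_real_derivative (real (Suc i) * t ^ i)) (at t within {s..r})"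
        by (rule derivative_eq_intros refl)+ simp
      from DERIV_cmult[OF this, of "coeff p i / Suc i"] show ?thesis by (simp del: of_nat_Suc)
    qed
    then show "((\<lambda>t. \<Sum>i\<le>n. coeff p i * t ^ Suc i / Suc i) has_vector_derivative poly p t) (at t within {s..r})"
      unfolding poly_sum_upto[OF assms(1)] has_real_derivative_iff_has_vector_derivative[symmetric]
      by (rule DERIV_sum)
  qed
  then show "(poly p has_integral (\<Sum>i\<le>n. coeff p i * (r ^ Suc i - s ^ Suc i) / Suc i)) {s..r}"
    by (simp add: sum_subtractf right_diff_distrib diff_divide_distrib)
qed

lemma integral_pderiv:
  fixes p :: "real poly"
  assumes "s \<le> r"
  shows "integral {s..r} (poly (pderiv p)) = poly p r - poly p s"
  by (rule integral_unique, rule fundamental_theorem_of_calculus[OF assms])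
    (auto simp: has_real_derivative_iff_has_vector_derivative[symmetric] intro: poly_DERIV DERIV_subset)

lemma poly_integrable: "poly p integrable_on {s..r}" for p :: "real poly"
  by (intro integrable_continuous_real continuous_intros)

text \<open>Coefficientwise differentiability with bounded degree (\<open>pdiff\<close>) turns the
  integral into a finite sum of coefficients times powers of the endpoints, so Leibniz's rule
  becomes the product rule and no limit is taken under the integral.\<close>

lemma leibniz_poly:
  assumes p: "pdiff p p' x" and R: "(R has_real_derivative R') (at x)" and S: "(S has_real_derivative S') (at x)"
    and le: "\<And>z. S z \<le> R z"
  shows "((\<lambda>z. integral {S z..R z} (poly (p z))) has_real_derivative
     integral {S x..R x} (poly p') + poly (p x) (R x) * R' - poly (p x) (S x) * S') (at x)"
proof -
  obtain n0 where n0: "\<And>z. degree (p z) \<le> n0" using p by (auto simp: pdiff_def)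
  define n where "n = max n0 (degree p')"
  have n: "degree (p z) \<le> n" "degree p' \<le> n" for z using n0[of z] by (auto simp: n_def)
  have "((\<lambda>z. coeff (p z) i * (R z ^ Suc i - S z ^ Suc i) / Suc i) has_real_derivative
      coeff p' i * (R x ^ Suc i - S x ^ Suc i) / Suc i + coeff (p x) i * R x ^ i * R' - coeff (p x) i * S x ^ i * S') (at x)" for i
  proof -
    have pw: "((\<lambda>z. Q z ^ Suc i) has_real_derivative real (Suc i) * (Q x ^ i * Q')) (at x)"
      if "(Q has_real_derivative Q') (at x)" for Q Q'
      using DERIV_power[OF that, of "Suc i"] by (simp add: mult_ac)
    have "((\<lambda>z. coeff (p z) i) has_real_derivative coeff p' i) (at x)" using p by (simp add: pdiff_def)
    note * = DERIV_cmult[OF DERIV_mult[OF this DERIV_diff[OF pw[OF R] pw[OF S]]], of "1 / Suc i"]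
    have "(\<lambda>z. coeff (p z) i * (R z ^ Suc i - S z ^ Suc i) / Suc i)
        = (\<lambda>z. 1 / Suc i * (coeff (p z) i * (R z ^ Suc i - S z ^ Suc i)))" by auto
    then show ?thesis
      by (simp only:, intro DERIV_cong[OF *]) (simp add: divide_simps, simp add: algebra_simps)
  qed
  then have "((\<lambda>z. \<Sum>i\<le>n. coeff (p z) i * (R z ^ Suc i - S z ^ Suc i) / Suc i) has_real_derivative
      (\<Sum>i\<le>n. coeff p' i * (R x ^ Suc i - S x ^ Suc i) / Suc i + coeff (p x) i * R x ^ i * R' - coeff (p x) i * S x ^ i * S')) (at x)"
    by (rule DERIV_sum)
  then show ?thesis
    unfolding integral_poly_upto[OF n(1) le] integral_poly_upto[OF n(2) le] poly_sum_upto[OF n(1)]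
    by (simp add: sum.distrib sum_subtractf sum_distrib_right)
qed

lemma pcont_poly:
  assumes "pcont p" "continuous_on {0..1} R"
  shows "continuous_on {0..1} (\<lambda>z. poly (p z) (R z))"
proof -
  obtain n where n: "\<And>z. degree (p z) \<le> n" using assms by (auto simp: pcont_def)
  show ?thesis
    unfolding poly_sum_upto[OF n] using assms by (intro continuous_intros) (auto simp: pcont_def)
qed

lemma pcont_integral:
  assumes "pcont p" "continuous_on {0..1} R" "continuous_on {0..1} S" "\<And>z. S z \<le> R z"
  shows "continuous_on {0..1} (\<lambda>z. integral {S z..R z} (poly (p z)))"
proof -
  obtain n where n: "\<And>z. degree (p z) \<le> n" using assms by (auto simp: pcont_def)
  show ?thesis
    unfolding integral_poly_upto[OF n assms(4)] using assms by (intro continuous_intros) (auto simp: pcont_def)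
qed

lemma pderiv_sum_poly: "pderiv (\<Sum>i\<in>I. f i) = (\<Sum>i\<in>I. pderiv (f i))"
  by (induction I rule: infinite_finite_induct) (simp_all add: pderiv_add)

lemma smult_sum_poly: "smult c (\<Sum>i\<in>I. f i) = (\<Sum>i\<in>I. smult c (f i))" for f :: "_ \<Rightarrow> real poly"
  by (induction I rule: infinite_finite_induct) (simp_all add: smult_add_right)

lemma higher_pderiv_eq_0: "degree p < k \<Longrightarrow> (pderiv ^^ k) p = 0" for p :: "real poly"
  by (rule poly_eqI) (simp add: coeff_higher_pderiv coeff_eq_0)

lemma higher_pderiv_lin: "(pderiv ^^ k) (p + smult c q) = (pderiv ^^ k) p + smult c ((pderiv ^^ k) q)" for p :: "real poly"
  by (induction k) (simp_all add: pderiv_add pderiv_smult)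

lemma higher_pderiv_shift: "(pderiv ^^ k) (pcompose p [:s, 1:]) = pcompose ((pderiv ^^ k) p) [:s, 1:]" for p :: "real poly"
  by (induction k) (simp_all add: pderiv_pcompose pderiv_pCons)

section \<open>Solutions polynomial in t\<close>

context wave_coeff
begin

text \<open>For a polynomial \<open>q\<close>, the pair \<open>(YY q, PP q)\<close> solves \<open>y\<^sub>x = b p\<^sub>t\<close>, \<open>p\<^sub>x = y\<^sub>t\<close> with
  Cauchy data \<open>y = 0\<close>, \<open>p = q\<close> on the side \<open>x = 1\<close>; values are polynomials in \<open>t\<close>.\<close>

definition expn :: "(nat \<Rightarrow> real \<Rightarrow> real) \<Rightarrow> nat \<Rightarrow> nat \<Rightarrow> real poly \<Rightarrow> real \<Rightarrow> real poly" where
  "expn c k n q x = (\<Sum>j\<le>n. smult (c j x) ((pderiv ^^ (2 * j + k)) q))"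

definition PP :: "real poly \<Rightarrow> real \<Rightarrow> real poly" where
  "PP q = expn cA 0 (degree q) q"

definition YY :: "real poly \<Rightarrow> real \<Rightarrow> real poly" where
  "YY q = expn cB 1 (degree q) q"

text \<open>Derivatives beyond the degree vanish, so the truncation index can be raised freely;
  polynomials of different degree are compared at a common index.\<close>

lemma expn_upto: "degree q \<le> n \<Longrightarrow> expn c k (degree q) q x = expn c k n q x"
  unfolding expn_def by (rule sum.mono_neutral_left) (auto simp: higher_pderiv_eq_0 simp del: funpow.simps)

lemma PP_upto: "degree q \<le> n \<Longrightarrow> PP q x = expn cA 0 n q x"
  and YY_upto: "degree q \<le> n \<Longrightarrow> YY q x = expn cB 1 n q x"
  unfolding PP_def YY_def by (rule expn_upto, assumption)+

lemma expn_lin: "expn d k n (p + smult c q) x = expn d k n p x + smult c (expn d k n q x)"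
  unfolding expn_def higher_pderiv_lin
  by (simp add: smult_add_right sum.distrib mult.commute smult_sum_poly del: funpow.simps)

lemma pderiv_expn: "pderiv (expn c k n q x) = expn c k n (pderiv q) x"
  by (simp add: expn_def pderiv_sum_poly pderiv_smult funpow_swap1 del: funpow.simps)

lemma expn_shift: "expn c k n (pcompose q [:s, 1:]) x = pcompose (expn c k n q x) [:s, 1:]"
  by (simp add: expn_def higher_pderiv_shift pcompose_sum pcompose_smult del: funpow.simps)

lemma PP_lin: "PP (p + smult c q) x = PP p x + smult c (PP q x)"
  and YY_lin: "YY (p + smult c q) x = YY p x + smult c (YY q x)"
proof -
  define n where "n = max (degree p) (degree q)"
  have n: "degree p \<le> n" "degree q \<le> n" "degree (p + smult c q) \<le> n"
    unfolding n_def by (auto intro!: degree_add_le degree_smult_le[THEN order_trans])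
  show "PP (p + smult c q) x = PP p x + smult c (PP q x)" "YY (p + smult c q) x = YY p x + smult c (YY q x)"
    using n by (simp_all add: PP_upto[of _ n] YY_upto[of _ n] expn_lin)
qed

lemma pderiv_PP: "pderiv (PP q x) = PP (pderiv q) x"
  and pderiv_YY: "pderiv (YY q x) = YY (pderiv q) x"
  by (simp_all add: PP_upto[of _ "degree q"] YY_upto[of _ "degree q"] degree_pderiv pderiv_expn)

lemma PP_shift: "PP (pcompose q [:s, 1:]) x = pcompose (PP q x) [:s, 1:]"
  and YY_shift: "YY (pcompose q [:s, 1:]) x = pcompose (YY q x) [:s, 1:]"
  by (simp_all add: PP_def YY_def degree_pcompose expn_shift)

lemma cB_1: "cB j 1 = 0"
  unfolding cB.simps by (simp add: Tl_1 b_int_cont cA_cont)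

lemma cA_1: "cA (Suc j) 1 = 0"
  by (simp add: Tl_1 integrable_continuous_MI cB_cont)

lemma YY_1: "YY q 1 = 0"
  by (simp add: YY_def expn_def cB_1)

lemma PP_1: "PP q 1 = q"
proof -
  have "PP q 1 = expn cA 0 (Suc (degree q)) q 1" by (rule PP_upto) simp
  also have "\<dots> = q" unfolding expn_def by (subst sum.atMost_Suc_shift) (simp add: cA_1 del: cA.simps(2) funpow.simps)
  finally show ?thesis .
qed

lemma degree_higher_pderiv_le: "degree ((pderiv ^^ k) q) \<le> degree q" for q :: "real poly"
  by (induction k) (auto simp: degree_pderiv)

lemma expn_degree: "degree (expn c k n q x) \<le> degree q"
  unfolding expn_def by (intro degree_sum_le degree_smult_le[THEN order_trans] degree_higher_pderiv_le) auto

lemma PP_degree: "degree (PP q x) \<le> degree q" and YY_degree: "degree (YY q x) \<le> degree q"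
  unfolding PP_def YY_def by (rule expn_degree)+

lemma expn_pcont:
  assumes "\<And>j. continuous_on {0..1} (c j)"
  shows "pcont (expn c k n q)"
proof -
  have "continuous_on {0..1} (\<lambda>z. coeff (expn c k n q z) i)" for i
    unfolding expn_def coeff_sum coeff_smult by (intro continuous_intros assms)
  then show ?thesis unfolding pcont_def using expn_degree by blast
qed

lemma PP_pcont: "pcont (PP q)" and YY_pcont: "pcont (YY q)"
  unfolding PP_def YY_def by (intro expn_pcont cA_cont cB_cont)+

lemma isCont_interior: "continuous_on {0..1} g \<Longrightarrow> 0 < x \<Longrightarrow> x < 1 \<Longrightarrow> isCont g x" for g :: "real \<Rightarrow> real"
  using continuous_on_interior[of "{0..1}" g x] by simp

lemma cA_deriv:
  assumes "0 < x" "x < 1"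
  shows "(cA (Suc j) has_real_derivative cB j x) (at x)"
proof -
  have "cA (Suc j) = (\<lambda>x. - Tl (cB j) x)" by auto
  then show ?thesis
    using DERIV_minus[OF Tl_deriv[OF integrable_continuous_MI[OF cB_cont[of j]] assms isCont_interior[OF cB_cont[of j] assms]]] by simp
qed

lemma cB_deriv:
  assumes "0 < x" "x < 1" "x \<notin> D"
  shows "(cB j has_real_derivative b x * cA j x) (at x)"
proof -
  have "cB j = (\<lambda>x. - Tl (\<lambda>s. b s * cA j s) x)" by (auto simp: cB.simps)
  moreover have "isCont (\<lambda>s. b s * cA j s) x"
    by (intro continuous_intros b_cont assms isCont_interior[OF cA_cont])
  ultimately show ?thesis
    using DERIV_minus[OF Tl_deriv[OF b_int_cont[OF cA_cont] assms(1,2), of j]] by simp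
qed

text \<open>This is p_x = y_t. It holds at every interior \<open>x\<close>, jumps of
  \<open>b\<close> included, because the \<open>cB j\<close> are continuous; the term j = 0 of
  \<open>PP\<close> does not depend on \<open>x\<close> and is split off.\<close>

lemma PP_pdiff:
  assumes "0 < x" "x < 1"
  shows "pdiff (PP q) (pderiv (YY q x)) x"
proof -
  have *: "PP q z = q + (\<Sum>j\<le>degree q. smult (cA (Suc j) z) ((pderiv ^^ (2 * Suc j)) q))" for z
  proof -
    have "PP q z = expn cA 0 (Suc (degree q)) q z" by (rule PP_upto) simp
    then show ?thesis unfolding expn_def by (subst (asm) sum.atMost_Suc_shift) simp
  qed
  have "((\<lambda>z. coeff (PP q z) i) has_real_derivative coeff (pderiv (YY q x)) i) (at x)" for i
  proof -
    have "((\<lambda>z. coeff q i + (\<Sum>j\<le>degree q. cA (Suc j) z * coeff ((pderiv ^^ (2 * Suc j)) q) i)) has_real_derivative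
       0 + (\<Sum>j\<le>degree q. cB j x * coeff ((pderiv ^^ (2 * Suc j)) q) i)) (at x)"
      by (intro DERIV_add DERIV_const DERIV_sum DERIV_cmult_right cA_deriv assms)
    then show ?thesis
      unfolding * YY_def expn_def
      by (simp add: coeff_sum pderiv_sum_poly pderiv_smult del: cA.simps)
  qed
  then show ?thesis using PP_degree by (auto simp: pdiff_def)
qed

text \<open>This is y_x = b p_t. Here the integrand \<open>b * cA j\<close> must be continuous at
  \<open>x\<close>, which excludes \<open>D\<close>.\<close>

lemma YY_pdiff:
  assumes "0 < x" "x < 1" "x \<notin> D"
  shows "pdiff (YY q) (smult (b x) (pderiv (PP q x))) x"
proof -
  have "((\<lambda>z. coeff (YY q z) i) has_real_derivative coeff (smult (b x) (pderiv (PP q x))) i) (at x)" for i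
  proof -
    have "((\<lambda>z. \<Sum>j\<le>degree q. cB j z * coeff ((pderiv ^^ (2 * j + 1)) q) i) has_real_derivative
       (\<Sum>j\<le>degree q. b x * cA j x * coeff ((pderiv ^^ (2 * j + 1)) q) i)) (at x)"
      by (intro DERIV_sum DERIV_cmult_right cB_deriv assms)
    then show ?thesis
      unfolding YY_def PP_def expn_def
      by (simp add: coeff_sum pderiv_sum_poly pderiv_smult sum_distrib_left smult_sum_poly mult.assoc)
  qed
  then show ?thesis using YY_degree by (auto simp: pdiff_def)
qed

section \<open>Travel time and energy estimates in the x-direction\<close>

definition sg :: "real \<Rightarrow> real" where "sg x = sqrt (b x)"
text \<open>Travel time from the left end: \<open>sg\<close> is the slowness 1 / sqrt a, and
  \<open>tau\<close> is the time a wave needs to cross the interval.\<close>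

definition XX :: "real \<Rightarrow> real" where "XX = Pr sg"
definition tau :: real where "tau = XX 1"

lemma sg_sq: "sg x * sg x = b x"
  using b_pos[of x] by (simp add: sg_def)

lemma sg_bounds: "sqrt bl \<le> sg x" "sg x \<le> sqrt bu" "0 < sg x"
  using b_ge[of x] b_le[of x] b_pos[of x] by (auto simp: sg_def)

lemma sg_int: "integrable U01 sg"
proof -
  have "sg \<in> borel_measurable borel" unfolding sg_def[abs_def] by measurable
  then have "sg \<in> borel_measurable U01" by (rule measurable_MI)
  from integrable_bounded_mult[OF integrable_const_MI[where c=1] this, of "sqrt bu"]
  show ?thesis using sg_bounds by (simp add: abs_of_pos)
qed

lemma XX_cont: "continuous_on {0..1} XX"
  unfolding XX_def by (rule Pr_cont[OF sg_int])

lemma XX_nonneg: "0 \<le> XX x"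
  unfolding XX_def Pr_def
  by (intro Bochner_Integration.integral_nonneg) (auto simp: indicator_def less_imp_le[OF sg_bounds(3)])

lemma XX_0: "XX 0 = 0"
  by (simp add: XX_def Pr_0)

lemma XX_deriv:
  assumes "0 < x" "x < 1" "x \<notin> D"
  shows "(XX has_real_derivative sg x) (at x)"
  unfolding XX_def
proof (rule Pr_deriv[OF sg_int assms(1,2)])
  show "isCont sg x" unfolding sg_def by (intro continuous_intros b_cont assms)
qed

text \<open>Gronwall factor of the relative variation of \<open>b\<close>: an increment of
  \<open>b\<close> changes the weighted energy by at most that increment over \<open>bl\<close>
  times the energy.\<close>

definition EV :: real where "EV = exp ((V 1 - V 0) / bl)"

text \<open>EI + b EJ is not differentiable where \<open>b\<close> jumps, so on [s,t] the weight is
  frozen at one value \<kappa> and the monotonicity lemma is applied to EI + \<kappa> EJ. Freezing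
  costs at most K (V t - V s) per unit length, and correcting the weight at an endpoint costs (V t -
  V s) / bl times the energy: these are the two terms that \<open>bv_gronwall\<close> accepts.
  \<open>P\<close> carries the rate at which the energy is fed.\<close>

lemma bv_energy:
  fixes EI EJ :: "real \<Rightarrow> real"
  assumes cI: "continuous_on {0..1} EI" and cJ: "continuous_on {0..1} EJ" and cP: "continuous_on {0..1} P"
    and nI: "\<And>x. 0 \<le> EI x" and nJ: "\<And>x. 0 \<le> EJ x"
    and dI: "\<And>x. 0 < x \<Longrightarrow> x < 1 \<Longrightarrow> x \<notin> D \<Longrightarrow> (EI has_real_derivative EI' x) (at x)"
    and dJ: "\<And>x. 0 < x \<Longrightarrow> x < 1 \<Longrightarrow> x \<notin> D \<Longrightarrow> (EJ has_real_derivative EJ' x) (at x)"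
    and dP: "\<And>x. 0 < x \<Longrightarrow> x < 1 \<Longrightarrow> x \<notin> D \<Longrightarrow> (P has_real_derivative P' x) (at x)"
    and P0: "\<And>x. 0 < x \<Longrightarrow> x < 1 \<Longrightarrow> x \<notin> D \<Longrightarrow> 0 \<le> P' x"
    and K: "\<And>x. 0 < x \<Longrightarrow> x < 1 \<Longrightarrow> x \<notin> D \<Longrightarrow> \<bar>EJ' x\<bar> \<le> K"
  shows "(\<And>x. 0 < x \<Longrightarrow> x < 1 \<Longrightarrow> x \<notin> D \<Longrightarrow> EI' x + b x * EJ' x \<le> P' x) \<Longrightarrow>
      EI 1 + b 1 * EJ 1 \<le> EV * (EI 0 + b 0 * EJ 0 + P 1 - P 0)"
    and "(\<And>x. 0 < x \<Longrightarrow> x < 1 \<Longrightarrow> x \<notin> D \<Longrightarrow> P' x \<le> EI' x + b x * EJ' x) \<Longrightarrow>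
      EI 0 + b 0 * EJ 0 + P 1 - P 0 \<le> EV * (EI 1 + b 1 * EJ 1)"
proof -
  define F where "F x = EI x + b x * EJ x" for x
  have F0: "0 \<le> F x" for x using nI[of x] nJ[of x] b_pos[of x] by (simp add: F_def)
  have EJF: "EJ x \<le> F x / bl" for x
  proof -
    have "bl * EJ x \<le> b x * EJ x" by (intro mult_right_mono b_ge nJ)
    also have "\<dots> \<le> F x" using nI[of x] by (simp add: F_def)
    finally show ?thesis using bl by (simp add: pos_le_divide_eq mult.commute)
  qed
  have Vm: "V s \<le> V t" if "s \<le> t" for s t using V_mono that by (rule monoD)
  have Pm: "P s \<le> P t" if "0 \<le> s" "s \<le> t" "t \<le> 1" for s t
    by (rule mono_countable_exceptions[OF D_countable that(2), where f' = P'])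
      (use that dP P0 continuous_on_subset[OF cP, of "{s..t}"] in auto)
  have dev: "\<bar>(\<kappa> - b x) * EJ' x\<bar> \<le> K * (V t - V s)"
    if "\<bar>\<kappa> - b x\<bar> \<le> V t - V s" "0 < x" "x < 1" "x \<notin> D" for \<kappa> x s t
    unfolding abs_mult using mult_mono[OF that(1) K[OF that(2-4)]] that(1) by (simp add: mult.commute)
  have bdist: "\<bar>b t - b x\<bar> \<le> V t - V s" "\<bar>b s - b x\<bar> \<le> V t - V s" if "s \<le> x" "x \<le> t" for s x t
    using bV[OF that(1)] bV[OF that(2)] Vm[OF that(1)] Vm[OF that(2)] by auto
  have cF: "continuous_on {s..t} (\<lambda>x. c * P x + d * x + e * (EI x + \<kappa> * EJ x))" if "0 \<le> s" "t \<le> 1" for s t c d e \<kappa>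
    by (rule continuous_on_subset[of "{0..1}"]) (use that in \<open>auto intro!: continuous_intros cI cJ cP\<close>)
  have dF: "((\<lambda>x. c * P x + d * x + e * (EI x + \<kappa> * EJ x)) has_real_derivative c * P' x + d + e * (EI' x + \<kappa> * EJ' x)) (at x)"
    if "0 < x" "x < 1" "x \<notin> D" for c d e \<kappa> x
    by (auto intro!: derivative_eq_intros dI dJ dP that)
  show "EI 1 + b 1 * EJ 1 \<le> EV * (EI 0 + b 0 * EJ 0 + P 1 - P 0)"
    if up: "\<And>x. 0 < x \<Longrightarrow> x < 1 \<Longrightarrow> x \<notin> D \<Longrightarrow> EI' x + b x * EJ' x \<le> P' x"
  proof -
    \<comment> \<open>Upward estimate: the weight is frozen at \<open>b t\<close>, exact at the
      right end, so that the correction falls on the known energy at \<open>s\<close>.\<close>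
    have "F 1 + 0 - 0 \<le> exp (V 1 / bl - V 0 / bl) * (F 0 + P 1 - P 0)"
    proof (rule bv_gronwall[where V = "\<lambda>x. V x / bl" and Ph = "\<lambda>_. 0" and K = "K * bl"])
      fix s t :: real assume st: "0 \<le> s" "s \<le> t" "t \<le> 1"
      have "1 * P s + (K * (V t - V s)) * s + (-1) * (EI s + b t * EJ s)
          \<le> 1 * P t + (K * (V t - V s)) * t + (-1) * (EI t + b t * EJ t)"
      proof (rule mono_countable_exceptions[OF D_countable st(2) cF dF])
        fix x assume x: "s < x" "x < t" "x \<notin> D"
        then have x': "0 < x" "x < 1" using st by auto
        show "0 \<le> 1 * P' x + K * (V t - V s) + (-1) * (EI' x + b t * EJ' x)"
          using up[OF x' x(3)] dev[OF bdist(1)[of s x t] x' x(3)] x by (simp add: algebra_simps)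
      qed (use st in auto)
      then have "F t \<le> F s + (b t - b s) * EJ s + (P t - P s) + K * (V t - V s) * (t - s)"
        by (simp add: F_def algebra_simps)
      also have "(b t - b s) * EJ s \<le> (V t - V s) * (F s / bl)"
        using bdist(1)[of s s t] st by (intro mult_mono EJF nJ) (auto simp: Vm)
      finally have "F t \<le> F s + (V t - V s) * (F s / bl) + (P t - P s) + K * (V t - V s) * (t - s)" by simp
      moreover have "K * (V t - V s) = K * bl * (V t / bl - V s / bl)" for t s using bl by (simp add: right_diff_distrib)
      moreover have "(V t - V s) * (F r / bl) = F r * (V t / bl - V s / bl)" for t s r using bl by (simp add: algebra_simps diff_divide_distrib)
      ultimately show "F t + 0 - 0 \<le> F s * (1 + (V t / bl - V s / bl)) + P t - P s + K * bl * (V t / bl - V s / bl) * (t - s)"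
        by (simp add: distrib_left)
    qed (use Vm Pm F0 bl in \<open>auto simp: divide_right_mono\<close>)
    then show ?thesis by (simp add: F_def EV_def diff_divide_distrib)
  qed
  show "EI 0 + b 0 * EJ 0 + P 1 - P 0 \<le> EV * (EI 1 + b 1 * EJ 1)"
    if lo: "\<And>x. 0 < x \<Longrightarrow> x < 1 \<Longrightarrow> x \<notin> D \<Longrightarrow> P' x \<le> EI' x + b x * EJ' x"
  proof -
    \<comment> \<open>For the downward estimate the interval is run through from 1 to 0, with the
      weight frozen at \<open>b s\<close>; after the reflection it is \<open>- V (1 - u)\<close>
      that increases.\<close>
    have "F (1 - 1) + - P (1 - 1) - - P (1 - 0) \<le> exp (- V (1 - 1) / bl - - V (1 - 0) / bl) * (F (1 - 0) + 0 - 0)"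
    proof (rule bv_gronwall[where F = "\<lambda>u. F (1 - u)" and V = "\<lambda>u. - V (1 - u) / bl" and Ph = "\<lambda>u. - P (1 - u)" and Ps = "\<lambda>_. 0" and K = "K * bl"])
      fix u v :: real assume uv: "0 \<le> u" "u \<le> v" "v \<le> 1"
      define s t where "s = 1 - v" and "t = 1 - u"
      have st: "0 \<le> s" "s \<le> t" "t \<le> 1" using uv by (auto simp: s_def t_def)
      have "(-1) * P s + (K * (V t - V s)) * s + 1 * (EI s + b s * EJ s)
          \<le> (-1) * P t + (K * (V t - V s)) * t + 1 * (EI t + b s * EJ t)"
      proof (rule mono_countable_exceptions[OF D_countable st(2) cF dF])
        fix x assume x: "s < x" "x < t" "x \<notin> D"
        then have x': "0 < x" "x < 1" using st by auto
        show "0 \<le> (-1) * P' x + K * (V t - V s) + 1 * (EI' x + b s * EJ' x)"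
          using lo[OF x' x(3)] dev[OF bdist(2)[of s x t] x' x(3)] x by (simp add: algebra_simps)
      qed (use st in auto)
      then have "F s + P t - P s \<le> F t + (b s - b t) * EJ t + K * (V t - V s) * (t - s)"
        by (simp add: F_def algebra_simps)
      also have "(b s - b t) * EJ t \<le> (V t - V s) * (F t / bl)"
        using bdist(2)[of s t t] st by (intro mult_mono EJF nJ) (auto simp: Vm)
      finally have "F s + P t - P s \<le> F t + (V t - V s) * (F t / bl) + K * (V t - V s) * (t - s)" by simp
      moreover have "K * (V t - V s) = K * bl * (V t / bl - V s / bl)" for t s using bl by (simp add: right_diff_distrib)
      moreover have "(V t - V s) * (F r / bl) = F r * (V t / bl - V s / bl)" for t s r using bl by (simp add: algebra_simps diff_divide_distrib)
      ultimately show "F (1 - v) + - P (1 - v) - - P (1 - u)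
          \<le> F (1 - u) * (1 + (- V (1 - v) / bl - - V (1 - u) / bl)) + 0 - 0 + K * bl * (- V (1 - v) / bl - - V (1 - u) / bl) * (v - u)"
        unfolding s_def t_def by (simp add: distrib_left)
    qed (use Vm Pm F0 bl in \<open>auto simp: divide_right_mono\<close>)
    then show ?thesis by (simp add: F_def EV_def diff_divide_distrib)
  qed
qed


lemma integral_poly_0 [simp]: "integral S (poly (0 :: real poly)) = 0"
proof -
  have "poly (0 :: real poly) = (\<lambda>_. 0)" by auto
  then show ?thesis by simp
qed

lemma integral_square_nonneg: "0 \<le> integral {s..r} (poly (p * p))" for p :: "real poly"
  by (rule integral_nonneg[OF poly_integrable]) simp

text \<open>\<open>u\<close>, \<open>p\<close> stand for y and p at the upper end of the window,
  \<open>v\<close>, \<open>r\<close> for those at the lower end, \<open>s\<close> for sqrt b. The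
  flux 2 b y p and the terms from endpoints moving at rate \<open>s\<close> combine into
  squares.\<close>

lemma characteristic_square:
  fixes s u v p r :: real
  shows "2 * (s * s) * (u * p) - 2 * (s * s) * (v * r) + s * (u\<^sup>2 + v\<^sup>2 + s * s * (p\<^sup>2 + r\<^sup>2))
    = s * ((u + s * p)\<^sup>2 + (v - s * r)\<^sup>2)"
  by (simp add: power2_eq_square algebra_simps)

text \<open>With \<open>b\<close> frozen, the bulk terms form the t-derivative of 2 b y p and
  integrate to endpoint values. The window grows at rate \<open>sg\<close>, so these complete the
  moving-endpoint terms to squares, and the energy can only grow with \<open>x\<close>. The margin
  \<open>c\<close> is zero in the estimate of the state and half the observation time in that of the
  trace.\<close>

lemma YY_energy:
  fixes c :: real
  assumes c: "0 \<le> c"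
  defines "EI \<equiv> \<lambda>q x. integral {- (XX x + c)..XX x + c} (poly (YY q x * YY q x))"
    and "EJ \<equiv> \<lambda>q x. integral {- (XX x + c)..XX x + c} (poly (PP q x * PP q x))"
    and "dE \<equiv> \<lambda>q x. (poly (YY q x) (XX x + c) + sg x * poly (PP q x) (XX x + c))\<^sup>2
        + (poly (YY q x) (- (XX x + c)) - sg x * poly (PP q x) (- (XX x + c)))\<^sup>2"
  shows "\<exists>EI' EJ' K. (\<forall>x. 0 < x \<longrightarrow> x < 1 \<longrightarrow> x \<notin> D \<longrightarrow>
      (EI q has_real_derivative EI' x) (at x) \<and> (EJ q has_real_derivative EJ' x) (at x) \<and>
      \<bar>EJ' x\<bar> \<le> K \<and> EI' x + b x * EJ' x = sg x * dE q x)"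
    and "continuous_on {0..1} (EI q)" and "continuous_on {0..1} (EJ q)"
proof -
  define R where "R x = XX x + c" for x
  have R0: "0 \<le> R x" for x using XX_nonneg[of x] c by (simp add: R_def)
  have Rle: "- R x \<le> R x" for x using R0[of x] by simp
  have Rc: "continuous_on {0..1} R" unfolding R_def by (intro continuous_intros XX_cont)
  show "continuous_on {0..1} (EI q)" "continuous_on {0..1} (EJ q)"
    unfolding EI_def EJ_def R_def[symmetric]
    by (intro pcont_integral pcont_mult YY_pcont PP_pcont continuous_on_minus Rc Rle)+
  let ?W = "\<lambda>x. integral {- R x..R x} (poly (pderiv (YY q x) * PP q x + PP q x * pderiv (YY q x)))"
  define EJ' where "EJ' x = ?W x + poly (PP q x * PP q x) (R x) * sg x - poly (PP q x * PP q x) (- R x) * (- sg x)" for x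
  define EI' where "EI' x = integral {- R x..R x} (poly (smult (b x) (pderiv (PP q x)) * YY q x + YY q x * smult (b x) (pderiv (PP q x))))
      + poly (YY q x * YY q x) (R x) * sg x - poly (YY q x * YY q x) (- R x) * (- sg x)" for x
  \<comment> \<open>\<open>EJ'\<close> inherits the discontinuities of \<open>sg\<close>; apart from
    this bounded factor it is built from continuous functions of \<open>x\<close>.\<close>
  have "\<exists>K. \<forall>x\<in>{0..1}. \<bar>EJ' x\<bar> \<le> K"
  proof -
    have "continuous_on {0..1} (\<lambda>x. poly (PP q x * PP q x) (R x) + poly (PP q x * PP q x) (- R x))"
      by (intro continuous_on_add pcont_poly pcont_mult PP_pcont continuous_on_minus Rc)
    then obtain K1 where K1: "\<And>x. x \<in> {0..1} \<Longrightarrow> \<bar>poly (PP q x * PP q x) (R x) + poly (PP q x * PP q x) (- R x)\<bar> \<le> K1"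
      using continuous_bounded_MI by blast
    have "continuous_on {0..1} (\<lambda>x. integral {- R x..R x} (poly (YY (pderiv q) x * PP q x)))"
      by (intro pcont_integral pcont_mult YY_pcont PP_pcont continuous_on_minus Rc Rle)
    then obtain K2 where K2: "\<And>x. x \<in> {0..1} \<Longrightarrow> \<bar>integral {- R x..R x} (poly (YY (pderiv q) x * PP q x))\<bar> \<le> K2"
      using continuous_bounded_MI by blast
    have W: "?W x = 2 * integral {- R x..R x} (poly (YY (pderiv q) x * PP q x))" for x
    proof -
      have "poly (pderiv (YY q x) * PP q x + PP q x * pderiv (YY q x)) = (\<lambda>t. 2 * poly (YY (pderiv q) x * PP q x) t)"
        by (auto simp: pderiv_YY)
      then show ?thesis by (simp only: integral_mult_right)
    qed
    have "\<bar>EJ' x\<bar> \<le> 2 * K2 + K1 * sqrt bu" if x: "x \<in> {0..1}" for x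
    proof -
      have "\<bar>EJ' x\<bar> = \<bar>?W x + (poly (PP q x * PP q x) (R x) + poly (PP q x * PP q x) (- R x)) * sg x\<bar>"
        by (simp add: EJ'_def algebra_simps)
      also have "\<dots> \<le> \<bar>?W x\<bar> + \<bar>poly (PP q x * PP q x) (R x) + poly (PP q x * PP q x) (- R x)\<bar> * sg x"
        by (rule order_trans[OF abs_triangle_ineq]) (use sg_bounds(3)[of x] in \<open>simp add: abs_mult\<close>)
      also have "\<dots> \<le> 2 * K2 + K1 * sqrt bu"
        using K1[OF x] K2[OF x] sg_bounds[of x] order_trans[OF abs_ge_zero K1[OF x]] unfolding W
        by (intro add_mono mult_mono) (auto simp: abs_mult)
      finally show ?thesis .
    qed
    then show ?thesis by blast
  qed
  then obtain K where K: "\<And>x. x \<in> {0..1} \<Longrightarrow> \<bar>EJ' x\<bar> \<le> K" by blast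
  have "(EI q has_real_derivative EI' x) (at x) \<and> (EJ q has_real_derivative EJ' x) (at x) \<and>
      \<bar>EJ' x\<bar> \<le> K \<and> EI' x + b x * EJ' x = sg x * dE q x"
    if x: "0 < x" "x < 1" "x \<notin> D" for x
  proof (intro conjI)
    have Rd: "(R has_real_derivative sg x) (at x)"
      unfolding R_def using XX_deriv[OF x] by (auto intro!: derivative_eq_intros)
    have Rd': "((\<lambda>x. - R x) has_real_derivative - sg x) (at x)"
      using Rd by (auto intro!: derivative_eq_intros)
    show "(EI q has_real_derivative EI' x) (at x)"
      unfolding EI_def EI'_def R_def[symmetric]
      by (rule leibniz_poly[OF pdiff_mult[OF YY_pdiff[OF x] YY_pdiff[OF x]] Rd Rd' Rle])
    show "(EJ q has_real_derivative EJ' x) (at x)"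
      unfolding EJ_def EJ'_def R_def[symmetric]
      by (rule leibniz_poly[OF pdiff_mult[OF PP_pdiff[OF x(1,2)] PP_pdiff[OF x(1,2)]] Rd Rd' Rle])
    show "\<bar>EJ' x\<bar> \<le> K" using K x by simp
    let ?y = "YY q x" and ?p = "PP q x"
    have sum: "integral {- R x..R x} (poly (smult (b x) (pderiv ?p) * ?y + ?y * smult (b x) (pderiv ?p))) + b x * ?W x
        = 2 * b x * (poly ?y (R x) * poly ?p (R x)) - 2 * b x * (poly ?y (- R x) * poly ?p (- R x))"
    proof -
      have "integral {- R x..R x} (poly (smult (b x) (pderiv ?p) * ?y + ?y * smult (b x) (pderiv ?p))) + b x * ?W x
        = integral {- R x..R x} (\<lambda>t. poly (smult (b x) (pderiv ?p) * ?y + ?y * smult (b x) (pderiv ?p)) t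
            + b x * poly (pderiv ?y * ?p + ?p * pderiv ?y) t)"
        unfolding integral_mult_right[symmetric]
        by (rule Henstock_Kurzweil_Integration.integral_add[symmetric])
          (auto intro!: integrable_continuous_real continuous_intros)
      also have "\<dots> = integral {- R x..R x} (poly (pderiv (smult (2 * b x) (?y * ?p))))"
        by (rule arg_cong[of _ _ "integral _"]) (auto simp: pderiv_smult pderiv_mult algebra_simps)
      also have "\<dots> = poly (smult (2 * b x) (?y * ?p)) (R x) - poly (smult (2 * b x) (?y * ?p)) (- R x)"
        by (rule integral_pderiv[OF Rle])
      finally show ?thesis by simp
    qed
    have "EI' x + b x * EJ' x = 2 * b x * (poly ?y (R x) * poly ?p (R x)) - 2 * b x * (poly ?y (- R x) * poly ?p (- R x))
       + sg x * ((poly ?y (R x))\<^sup>2 + (poly ?y (- R x))\<^sup>2 + b x * ((poly ?p (R x))\<^sup>2 + (poly ?p (- R x))\<^sup>2))"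
      unfolding sum[symmetric] EI'_def EJ'_def by (simp add: algebra_simps power2_eq_square)
    also have "\<dots> = sg x * dE q x"
      unfolding dE_def R_def[symmetric] sg_sq[of x, symmetric] by (rule characteristic_square)
    finally show "EI' x + b x * EJ' x = sg x * dE q x" .
  qed
  then show "\<exists>EI' EJ' K. (\<forall>x. 0 < x \<longrightarrow> x < 1 \<longrightarrow> x \<notin> D \<longrightarrow>
      (EI q has_real_derivative EI' x) (at x) \<and> (EJ q has_real_derivative EJ' x) (at x) \<and>
      \<bar>EJ' x\<bar> \<le> K \<and> EI' x + b x * EJ' x = sg x * dE q x)" by blast
qed

text \<open>The energy over |t| \<le> XX x + c at x = 0 is at most \<open>EV\<close> times the
  energy at x = 1, where y = 0 and p = q. On the way the window has widened by \<open>tau\<close> on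
  each side: finite speed of propagation.\<close>

lemma trace_bound_HK:
  assumes c: "0 \<le> c"
  shows "integral {- c..c} (poly (YY q 0 * YY q 0)) \<le> EV * bu * integral {- (tau + c)..tau + c} (poly (q * q))"
proof -
  define EI where "EI x = integral {- (XX x + c)..XX x + c} (poly (YY q x * YY q x))" for x
  define EJ where "EJ x = integral {- (XX x + c)..XX x + c} (poly (PP q x * PP q x))" for x
  obtain EI' EJ' K where *: "\<And>x. 0 < x \<Longrightarrow> x < 1 \<Longrightarrow> x \<notin> D \<Longrightarrow>
      (EI has_real_derivative EI' x) (at x) \<and> (EJ has_real_derivative EJ' x) (at x) \<and>
      \<bar>EJ' x\<bar> \<le> K \<and> EI' x + b x * EJ' x = sg x * ((poly (YY q x) (XX x + c) + sg x * poly (PP q x) (XX x + c))\<^sup>2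
        + (poly (YY q x) (- (XX x + c)) - sg x * poly (PP q x) (- (XX x + c)))\<^sup>2)"
    using YY_energy(1)[OF c, of q] unfolding EI_def[symmetric, abs_def] EJ_def[symmetric, abs_def] by blast
  have n: "0 \<le> EI x" "0 \<le> EJ x" for x
    unfolding EI_def EJ_def by (rule integral_square_nonneg)+
  have "EI 0 + b 0 * EJ 0 + 0 - 0 \<le> EV * (EI 1 + b 1 * EJ 1)"
  proof (rule bv_energy(2)[where P = "\<lambda>_. 0" and P' = "\<lambda>_. 0" and EI' = EI' and EJ' = EJ' and K = K])
    show "continuous_on {0..1} EI" "continuous_on {0..1} EJ"
      using YY_energy(2,3)[OF c, of q] by (simp_all add: EI_def[abs_def] EJ_def[abs_def])
    fix x assume x: "0 < x" "x < 1" "x \<notin> D"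
    show "0 \<le> EI' x + b x * EJ' x" using *[OF x] sg_bounds(3)[of x] by simp
  qed (use * n in auto)
  moreover have "0 \<le> b 0 * EJ 0" using b_pos[of 0] integral_square_nonneg by (simp add: EJ_def)
  moreover have "EI 0 = integral {- c..c} (poly (YY q 0 * YY q 0))" by (simp add: EI_def XX_0)
  moreover have "EI 1 = 0" by (simp add: EI_def YY_1)
  moreover have "EJ 1 = integral {- (tau + c)..tau + c} (poly (q * q))" by (simp add: EJ_def PP_1 tau_def)
  moreover have "EV * (b 1 * EJ 1) \<le> EV * (bu * EJ 1)"
    using integral_square_nonneg by (intro mult_left_mono mult_right_mono b_le) (auto simp: EJ_def EV_def)
  ultimately show ?thesis by simp
qed

definition e0 :: "real poly \<Rightarrow> real \<Rightarrow> real" where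
  "e0 q x = (poly (YY q x) 0)\<^sup>2 + b x * (poly (PP q x) 0)\<^sup>2"

lemma YY_cont: "continuous_on {0..1} (\<lambda>x. poly (YY q x) t)"
  and PP_cont: "continuous_on {0..1} (\<lambda>x. poly (PP q x) t)"
  by (intro pcont_poly YY_pcont PP_pcont continuous_on_const)+

lemma e0_int: "integrable U01 (e0 q)"
  unfolding e0_def[abs_def]
  by (intro Bochner_Integration.integrable_add integrable_continuous_MI b_int_cont continuous_on_power YY_cont PP_cont)

text \<open>With c = 0 the window shrinks to a point at x = 0, so the energy at x = 1 is produced
  entirely by the growth term \<open>sg * Zd\<close> and the variation of \<open>b\<close>. Here
  \<open>Zd\<close> is the energy crossing the two characteristics t = XX x and t = - XX x, and the
  conservation law in the triangle equates its integral with twice the energy at time 0. Bounding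
  \<open>sg\<close> by \<open>sqrt bl\<close> and \<open>sqrt bu\<close> gives the two
  inequalities.\<close>

lemma state_bounds_HK:
  shows "2 * sqrt bl * (LINT x|U01. e0 q x) \<le> EV * (b 1 * integral {- tau..tau} (poly (q * q)))"
    and "b 1 * integral {- tau..tau} (poly (q * q)) \<le> EV * (2 * sqrt bu * (LINT x|U01. e0 q x))"
proof -
  define EI where "EI x = integral {- XX x..XX x} (poly (YY q x * YY q x))" for x
  define EJ where "EJ x = integral {- XX x..XX x} (poly (PP q x * PP q x))" for x
  define Zd where "Zd x = (poly (YY q x) (XX x) + sg x * poly (PP q x) (XX x))\<^sup>2
        + (poly (YY q x) (- XX x) - sg x * poly (PP q x) (- XX x))\<^sup>2" for x
  obtain EI' EJ' K where *: "\<And>x. 0 < x \<Longrightarrow> x < 1 \<Longrightarrow> x \<notin> D \<Longrightarrow>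
      (EI has_real_derivative EI' x) (at x) \<and> (EJ has_real_derivative EJ' x) (at x) \<and>
      \<bar>EJ' x\<bar> \<le> K \<and> EI' x + b x * EJ' x = sg x * Zd x"
    using YY_energy(1)[OF order_refl, of q] unfolding EI_def[abs_def] EJ_def[abs_def] Zd_def add_0_right by blast
  \<comment> \<open>\<open>Z\<close> is the integrated balance of (y^2 + b p^2)_t = 2 (y p)_x over
    the parts of the triangle above and below t = 0. The first two integrals vanish at x = 1 because
    y does, leaving \<open>Z 1\<close> as twice the energy at time 0.\<close>
  define Z where "Z x = integral {0..XX x} (poly (smult 2 (YY q x * PP q x)))
      - integral {- XX x..0} (poly (smult 2 (YY q x * PP q x))) + 2 * Pr (e0 q) x" for x
  have pc: "pcont (\<lambda>x. smult 2 (YY q x * PP q x))"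
  proof -
    have "pcont (\<lambda>x. [:2:] * (YY q x * PP q x))"
      by (intro pcont_mult YY_pcont PP_pcont) (auto simp: pcont_def intro!: exI[of _ 0])
    then show ?thesis by simp
  qed
  have Zc: "continuous_on {0..1} Z"
    unfolding Z_def
    by (intro continuous_intros pcont_integral[OF pc] XX_cont Pr_cont e0_int XX_nonneg) (simp add: XX_nonneg)
  have Zdiff: "(Z has_real_derivative Zd x) (at x)" if x: "0 < x" "x < 1" "x \<notin> D" for x
  proof -
    let ?y = "YY q x" and ?p = "PP q x"
    \<comment> \<open>Energy density with \<open>b\<close> frozen at the current point; its
      t-derivative is the x-derivative of 2 y p.\<close>
    define H where "H = smult (b x) (?p * ?p) + ?y * ?y"
    have "pdiff (\<lambda>z. [:2:] * (YY q z * PP q z)) (0 * (?y * ?p) + [:2:] * (smult (b x) (pderiv ?p) * ?p + ?y * pderiv ?y)) x"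
      by (intro pdiff_mult[where p = "\<lambda>_. [:2:]"] pdiff_mult[OF YY_pdiff[OF x] PP_pdiff[OF x(1,2)]])
        (auto simp: pdiff_def intro!: exI[of _ 0])
    moreover have "0 * (?y * ?p) + [:2:] * (smult (b x) (pderiv ?p) * ?p + ?y * pderiv ?y) = pderiv H"
      by (rule poly_ext) (simp add: H_def pderiv_add pderiv_smult pderiv_mult algebra_simps)
    ultimately have pd: "pdiff (\<lambda>z. smult 2 (YY q z * PP q z)) (pderiv H) x" by simp
    have Xd: "(XX has_real_derivative sg x) (at x)" by (rule XX_deriv[OF x])
    have Xd': "((\<lambda>x. - XX x) has_real_derivative - sg x) (at x)" using Xd by (auto intro!: derivative_eq_intros)
    have "((\<lambda>x. integral {0..XX x} (poly (smult 2 (YY q x * PP q x)))) has_real_derivative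
      integral {0..XX x} (poly (pderiv H)) + poly (smult 2 (?y * ?p)) (XX x) * sg x - poly (smult 2 (?y * ?p)) 0 * 0) (at x)"
      by (rule leibniz_poly[OF pd Xd DERIV_const]) (rule XX_nonneg)
    moreover have "((\<lambda>x. integral {- XX x..0} (poly (smult 2 (YY q x * PP q x)))) has_real_derivative
      integral {- XX x..0} (poly (pderiv H)) + poly (smult 2 (?y * ?p)) 0 * 0 - poly (smult 2 (?y * ?p)) (- XX x) * (- sg x)) (at x)"
      by (rule leibniz_poly[OF pd DERIV_const Xd']) (simp add: XX_nonneg)
    moreover have "(Pr (e0 q) has_real_derivative e0 q x) (at x)"
      by (rule Pr_deriv[OF e0_int x(1,2)]) (auto simp: e0_def[abs_def] intro!: continuous_intros b_cont x isCont_interior[OF YY_cont] isCont_interior[OF PP_cont])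
    ultimately have "(Z has_real_derivative
        (integral {0..XX x} (poly (pderiv H)) + poly (smult 2 (?y * ?p)) (XX x) * sg x - poly (smult 2 (?y * ?p)) 0 * 0)
        - (integral {- XX x..0} (poly (pderiv H)) + poly (smult 2 (?y * ?p)) 0 * 0 - poly (smult 2 (?y * ?p)) (- XX x) * (- sg x))
        + 2 * e0 q x) (at x)"
      unfolding Z_def by (intro DERIV_add DERIV_diff DERIV_cmult)
    then show ?thesis
    proof (rule DERIV_cong)
      have i: "integral {0..XX x} (poly (pderiv H)) = poly H (XX x) - poly H 0"
        "integral {- XX x..0} (poly (pderiv H)) = poly H 0 - poly H (- XX x)"
        by (rule integral_pderiv, simp add: XX_nonneg)+
      have h: "poly H t = sg x * sg x * (poly ?p t)\<^sup>2 + (poly ?y t)\<^sup>2" for t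
        by (simp add: H_def sg_sq power2_eq_square)
      have e: "e0 q x = poly H 0" unfolding h sg_sq e0_def by simp
      show "(integral {0..XX x} (poly (pderiv H)) + poly (smult 2 (?y * ?p)) (XX x) * sg x - poly (smult 2 (?y * ?p)) 0 * 0)
        - (integral {- XX x..0} (poly (pderiv H)) + poly (smult 2 (?y * ?p)) 0 * 0 - poly (smult 2 (?y * ?p)) (- XX x) * (- sg x))
        + 2 * e0 q x = Zd x"
        unfolding i e h Zd_def by (simp add: power2_eq_square algebra_simps)
    qed
  qed
  have Z0: "Z 0 = 0" by (simp add: Z_def XX_0 Pr_0)
  have Z1: "Z 1 = 2 * (LINT x|U01. e0 q x)" by (simp add: Z_def YY_1 Pr_1)
  have E0: "EI 0 = 0" "EJ 0 = 0" by (simp_all add: EI_def EJ_def XX_0)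
  have E1: "EI 1 = 0" "EJ 1 = integral {- tau..tau} (poly (q * q))"
    by (simp_all add: EI_def EJ_def YY_1 PP_1 tau_def)
  have Zd0: "0 \<le> Zd x" for x by (simp add: Zd_def)
  have c: "continuous_on {0..1} EI" "continuous_on {0..1} EJ"
    using YY_energy(2,3)[OF order_refl, of q] by (simp_all add: EI_def[abs_def] EJ_def[abs_def])
  have n: "0 \<le> EI x" "0 \<le> EJ x" for x
    unfolding EI_def EJ_def by (rule integral_square_nonneg)+
  have "EI 0 + b 0 * EJ 0 + sqrt bl * Z 1 - sqrt bl * Z 0 \<le> EV * (EI 1 + b 1 * EJ 1)"
    by (rule bv_energy(2)[where P = "\<lambda>x. sqrt bl * Z x" and P' = "\<lambda>x. sqrt bl * Zd x" and EI' = EI' and EJ' = EJ' and K = K])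
      (use * Zdiff Zd0 bl sg_bounds in \<open>auto intro!: c n continuous_intros Zc DERIV_cmult mult_right_mono\<close>)
  then show "2 * sqrt bl * (LINT x|U01. e0 q x) \<le> EV * (b 1 * integral {- tau..tau} (poly (q * q)))"
    by (simp add: E0 E1 Z0 Z1)
  have "EI 1 + b 1 * EJ 1 \<le> EV * (EI 0 + b 0 * EJ 0 + sqrt bu * Z 1 - sqrt bu * Z 0)"
    by (rule bv_energy(1)[where P = "\<lambda>x. sqrt bu * Z x" and P' = "\<lambda>x. sqrt bu * Zd x" and EI' = EI' and EJ' = EJ' and K = K])
      (use * Zdiff Zd0 b_abs[of 0] sg_bounds in \<open>auto intro!: c n continuous_intros Zc DERIV_cmult mult_right_mono mult_nonneg_nonneg\<close>)
  then show "b 1 * integral {- tau..tau} (poly (q * q)) \<le> EV * (2 * sqrt bu * (LINT x|U01. e0 q x))"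
    by (simp add: E0 E1 Z0 Z1 mult_ac)
qed

end

section \<open>Density and estimates for states and traces\<close>

lemma continuous_integral_MI:
  fixes f :: "real \<Rightarrow> real"
  assumes "continuous_on {u..w} f"
  shows "(LINT x|MI u w. f x) = integral {u..w} f"
  using set_borel_integral_eq_integral(2)[of "{u..w}" f] integrable_continuous_MI[OF assms]
  by (simp add: set_integrable_MI LINT_MI)

lemma nrm_sq_HK:
  fixes f :: "real \<Rightarrow> real"
  assumes "continuous_on {u..w} f"
  shows "(nrm (MI u w) f)\<^sup>2 = integral {u..w} (\<lambda>x. (f x)\<^sup>2)"
  unfolding nrm_sq by (intro continuous_integral_MI continuous_intros assms)

lemma nrm_sq_poly: "(nrm (MI u w) (poly q))\<^sup>2 = integral {u..w} (poly (q * q))"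
proof -
  have "(\<lambda>x. (poly q x)\<^sup>2) = poly (q * q)" by (auto simp: power2_eq_square)
  then show ?thesis by (subst nrm_sq_HK) (auto intro: continuous_intros)
qed

lemma poly_L2: "poly q \<in> L2 (MI u w)"
  by (intro continuous_L2 continuous_intros)

lemma MI_mono:
  assumes f: "f \<in> L2 (MI u w)" and sub: "u \<le> u'" "w' \<le> w"
  shows "f \<in> L2 (MI u' w')" and "nrm (MI u' w') f \<le> nrm (MI u w) f"
proof -
  have meas: "f \<in> borel_measurable (MI u' w')"
  proof -
    have "(\<lambda>x. indicator {u..w} x *\<^sub>R f x) \<in> borel_measurable lborel"
      using L2_meas[OF f] by (subst (asm) borel_measurable_restrict_space_iff) auto
    then have "(\<lambda>x. indicator {u'..w'} x *\<^sub>R (indicator {u..w} x *\<^sub>R f x)) \<in> borel_measurable lborel"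
      by measurable
    moreover have "(\<lambda>x. indicator {u'..w'} x *\<^sub>R (indicator {u..w} x *\<^sub>R f x)) = (\<lambda>x. indicator {u'..w'} x *\<^sub>R f x)"
      using sub by (auto simp: indicator_def)
    ultimately show ?thesis by (subst borel_measurable_restrict_space_iff) auto
  qed
  have i: "integrable lborel (\<lambda>x. indicator {u..w} x *\<^sub>R (f x)\<^sup>2)"
    using L2_sq[OF f] by (subst (asm) integrable_restrict_space) auto
  then have si: "set_integrable lborel {u..w} (\<lambda>x. (f x)\<^sup>2)" by (simp add: set_integrable_def)
  have "set_integrable lborel {u'..w'} (\<lambda>x. (f x)\<^sup>2)"
    by (rule set_integrable_subset[OF si]) (use sub in auto)
  then have i': "integrable lborel (\<lambda>x. indicator {u'..w'} x *\<^sub>R (f x)\<^sup>2)" by (simp add: set_integrable_def)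
  show "f \<in> L2 (MI u' w')"
    unfolding L2_def using meas i' by (auto simp: integrable_restrict_space)
  have "(LINT x|lborel. indicator {u'..w'} x *\<^sub>R (f x)\<^sup>2) \<le> (LINT x|lborel. indicator {u..w} x *\<^sub>R (f x)\<^sup>2)"
    by (rule integral_mono[OF i' i]) (use sub in \<open>auto simp: indicator_def\<close>)
  then show "nrm (MI u' w') f \<le> nrm (MI u w) f"
    unfolding nrm_def by (simp add: integral_restrict_space)
qed

lemma MI_affine:
  fixes f :: "real \<Rightarrow> real"
  assumes "u < w"
  defines "g \<equiv> \<lambda>x. f (u + (w - u) * x)"
  shows "integrable (MI u w) f \<longleftrightarrow> integrable U01 g"
    and "(LINT x|MI u w. f x) = (w - u) * (LINT x|U01. g x)"
    and "f \<in> borel_measurable (MI u w) \<Longrightarrow> g \<in> borel_measurable U01"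
proof -
  have c: "w - u \<noteq> 0" "0 < w - u" using assms by auto
  have ind: "indicator {u..w} (u + (w - u) * x) = (indicator {0..1} x :: real)" for x
  proof -
    have "u + (w - u) * x \<le> w \<longleftrightarrow> (w - u) * x \<le> (w - u) * 1" by (simp add: algebra_simps)
    then show ?thesis using c by (auto simp: indicator_def zero_le_mult_iff mult_le_cancel_left)
  qed
  show "integrable (MI u w) f \<longleftrightarrow> integrable U01 g"
    using lborel_integrable_real_affine_iff[OF c(1), of "\<lambda>x. indicator {u..w} x *\<^sub>R f x" u]
    by (simp add: integrable_restrict_space ind g_def)
  show "(LINT x|MI u w. f x) = (w - u) * (LINT x|U01. g x)"
    using lborel_integral_real_affine[OF c(1), of "\<lambda>x. indicator {u..w} x *\<^sub>R f x" u] c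
    by (simp add: integral_restrict_space ind g_def)
  assume "f \<in> borel_measurable (MI u w)"
  then have "(\<lambda>x. indicator {u..w} x *\<^sub>R f x) \<in> borel_measurable borel"
    by (subst (asm) borel_measurable_restrict_space_iff) auto
  then have "(\<lambda>x. indicator {u..w} (u + (w - u) * x) *\<^sub>R f (u + (w - u) * x)) \<in> borel_measurable borel"
    by (rule measurable_compose[rotated]) measurable
  then show "g \<in> borel_measurable U01"
    by (subst borel_measurable_restrict_space_iff) (auto simp: ind g_def)
qed

lemma poly_antiderivative:
  fixes p :: "real poly"
  obtains P where "pderiv P = p"
proof
  show "pderiv (\<Sum>i\<le>degree p. monom (coeff p i / Suc i) (Suc i)) = p"
    by (simp add: pderiv_sum_poly pderiv_monom poly_as_sum_of_monoms del: of_nat_Suc)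
qed

text \<open>Coefficient b = 1, for which the \<open>cA j\<close> and \<open>cB j\<close> are
  polynomials in \<open>x\<close> on [0,1]: totality of the \<open>cB j\<close> then contains the
  density of polynomials in L^2.\<close>

interpretation unit: wave_coeff "\<lambda>_. 1" "\<lambda>_. 0" 1 1
  by unfold_locales (auto simp: mono_def)

lemma Tl_poly:
  assumes "x \<in> {0..1}"
  shows "Tl (poly (pderiv P)) x = poly P 1 - poly P x"
proof -
  have i: "integrable U01 (poly (pderiv P))" by (intro integrable_continuous_MI continuous_intros)
  show ?thesis
    using assms integral_pderiv[of 0 x P] integral_pderiv[of 0 1 P]
    by (simp add: Tl_eq[OF i] Pr_HK[OF i] integral_U01_HK[OF i])
qed

lemma Tl_cong: "(\<And>s. s \<in> {0..1} \<Longrightarrow> f s = g s) \<Longrightarrow> Tl f x = Tl g x"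
  unfolding Tl_def by (rule Bochner_Integration.integral_cong) (auto simp: space_restrict_space)

lemma unit_cA_cB_poly: "(\<exists>p. \<forall>x\<in>{0..1}. unit.cA j x = poly p x) \<and> (\<exists>p. \<forall>x\<in>{0..1}. unit.cB j x = poly p x)"
proof -
  have B: "\<exists>p. \<forall>x\<in>{0..1}. unit.cB j x = poly p x" if "\<exists>p. \<forall>x\<in>{0..1}. unit.cA j x = poly p x" for j
  proof -
    from that obtain p where p: "\<And>x. x \<in> {0..1} \<Longrightarrow> unit.cA j x = poly p x" by blast
    obtain P where P: "pderiv P = p" by (rule poly_antiderivative)
    have "unit.cB j x = poly (P - [:poly P 1:]) x" if x: "x \<in> {0..1}" for x
      using Tl_poly[OF x, of P] Tl_cong[of "unit.cA j" "poly p" x] p by (simp add: unit.cB.simps P)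
    then show ?thesis by blast
  qed
  show ?thesis
  proof (induction j)
    case 0
    have A: "\<exists>p. \<forall>x\<in>{0..1}. unit.cA 0 x = poly p x" by (intro exI[of _ "[:1:]"]) simp
    then show ?case using B by blast
  next
    case (Suc j)
    then obtain p where p: "\<And>x. x \<in> {0..1} \<Longrightarrow> unit.cB j x = poly p x" by blast
    obtain P where P: "pderiv P = p" by (rule poly_antiderivative)
    have "unit.cA (Suc j) x = poly (P - [:poly P 1:]) x" if x: "x \<in> {0..1}" for x
      using Tl_poly[OF x, of P] Tl_cong[of "unit.cB j" "poly p" x] p by (simp add: P)
    then have "\<exists>p. \<forall>x\<in>{0..1}. unit.cA (Suc j) x = poly p x" by blast
    then show ?case using B by blast
  qed
qed

text \<open>An \<open>h\<close> orthogonal to all polynomials, rescaled to [0,1], is orthogonal to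
  every \<open>unit.cB j\<close> and therefore null. The result is needed for data extended by zero,
  which are merely in L^2.\<close>

lemma poly_dense:
  assumes uw: "u < w" and f: "f \<in> L2 (MI u w)"
  shows "\<exists>s. (\<lambda>n::nat. nrm (MI u w) (\<lambda>x. poly (s n) x - f x)) \<longlonglongrightarrow> 0"
proof -
  have "\<exists>s. (\<forall>n::nat. s n \<in> range poly) \<and> (\<lambda>n. nrm (MI u w) (\<lambda>x. s n x - f x)) \<longlonglongrightarrow> 0"
  proof (rule L2_dense_subspace[OF finite_MI _ _ _ _ f])
    show "range poly \<subseteq> L2 (MI u w)" using poly_L2 by auto
    have "(\<lambda>x. 0) = poly (0 :: real poly)" by auto
    then show "(\<lambda>x. 0 :: real) \<in> range poly" by simp
    fix g h :: "real \<Rightarrow> real" and c :: real assume "g \<in> range poly" "h \<in> range poly"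
    then obtain p q where pq: "g = poly p" "h = poly q" by auto
    have "(\<lambda>x. g x + c * h x) = poly (p + smult c q)" by (auto simp: pq)
    then show "(\<lambda>x. g x + c * h x) \<in> range poly" by simp
  next
    fix h assume h: "h \<in> L2 (MI u w)" and o: "\<And>g. g \<in> range poly \<Longrightarrow> (LINT x|MI u w. h x * g x) = 0"
    let ?h = "\<lambda>x. h (u + (w - u) * x)"
    have hL: "?h \<in> L2 U01"
      using MI_affine(3)[OF uw L2_meas[OF h]] MI_affine(1)[OF uw, of "\<lambda>x. (h x)\<^sup>2"] L2_sq[OF h] by (simp add: L2_def)
    have "(LINT x|U01. ?h x * unit.cB j x) = 0" for j
    proof -
      obtain p where p: "\<And>x. x \<in> {0..1} \<Longrightarrow> unit.cB j x = poly p x" using unit_cA_cB_poly by blast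
      \<comment> \<open>Composition with the inverse of the affine map from [0,1] onto [u,w], so
        that \<open>r\<close> pulls back to \<open>p\<close>.\<close>
      define r where "r = pcompose p [:- u / (w - u), 1 / (w - u):]"
      have r: "poly r (u + (w - u) * x) = poly p x" for x
      proof -
        have "- u / (w - u) + (u + (w - u) * x) * (1 / (w - u)) = x" using uw by (simp add: add_divide_distrib)
        then show ?thesis by (simp add: r_def poly_pcompose)
      qed
      have "(LINT x|MI u w. h x * poly r x) = 0" by (rule o) simp
      then have "(LINT x|U01. ?h x * poly p x) = 0"
        using MI_affine(2)[OF uw, of "\<lambda>x. h x * poly r x"] uw by (simp add: r)
      moreover have "(LINT x|U01. ?h x * unit.cB j x) = (LINT x|U01. ?h x * poly p x)"
        by (rule ip_cong_U01) (rule p)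
      ultimately show ?thesis by simp
    qed
    then have "AE x in U01. ?h x = 0" by (rule unit.cB_total[OF hL])
    then have "nrm U01 ?h = 0" using nrm_eq_0_iff[OF hL] by simp
    then have "(LINT x|U01. (?h x)\<^sup>2) = 0" by (simp add: nrm_def)
    then have "nrm (MI u w) h = 0" using MI_affine(2)[OF uw, of "\<lambda>x. (h x)\<^sup>2"] by (simp add: nrm_def)
    then show "AE x in MI u w. h x = 0" using nrm_eq_0_iff[OF h] by simp
  qed
  then obtain s where s: "\<And>n::nat. s n \<in> range poly" "(\<lambda>n. nrm (MI u w) (\<lambda>x. s n x - f x)) \<longlonglongrightarrow> 0" by blast
  then have "\<forall>n. \<exists>p. s n = poly p" by blast
  then obtain p where "\<And>n. s n = poly (p n)" by metis
  then show ?thesis using s(2) by auto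
qed

section \<open>States and traces of polynomial solutions\<close>

context wave_coeff
begin

definition yv :: "real poly \<Rightarrow> real \<Rightarrow> real \<Rightarrow> real" where "yv q t x = poly (YY q x) t"
definition pv :: "real poly \<Rightarrow> real \<Rightarrow> real \<Rightarrow> real" where "pv q t x = poly (PP q x) t"

lemma yv_cont: "continuous_on {0..1} (yv q t)" and pv_cont: "continuous_on {0..1} (pv q t)"
  unfolding yv_def pv_def by (rule YY_cont PP_cont)+

lemma yv_L2: "yv q t \<in> L2 U01" and pv_L2: "pv q t \<in> L2 U01"
  by (rule continuous_L2[OF yv_cont] continuous_L2[OF pv_cont])+

lemma yv_diff: "yv (p - q) t x = yv p t x - yv q t x"
  using YY_lin[of p "- 1" q x] by (simp add: yv_def)

lemma pv_diff: "pv (p - q) t x = pv p t x - pv q t x"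
  using PP_lin[of p "- 1" q x] by (simp add: pv_def)

text \<open>The coefficient does not depend on t, so translating \<open>q\<close> translates the
  solution; estimates at time 0 thereby hold at all times.\<close>

lemma yv_shift: "yv (pcompose q [:s, 1:]) t x = yv q (s + t) x"
  by (simp add: yv_def YY_shift poly_pcompose)

lemma pv_shift: "pv (pcompose q [:s, 1:]) t x = pv q (s + t) x"
  by (simp add: pv_def PP_shift poly_pcompose)

lemma integral_shift_poly:
  fixes q :: "real poly"
  shows "integral {u..w} (poly (pcompose q [:s, 1:] * pcompose q [:s, 1:])) = integral {u + s..w + s} (poly (q * q))"
  by (subst integral_shift_Icc_real[of u w "poly (q * q)" s, symmetric])
    (rule arg_cong[of _ _ "integral _"], auto simp: poly_pcompose add.commute)

lemma EV_pos: "0 < EV" by (simp add: EV_def)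

lemma bu_pos: "0 < bu" using b_pos[of 0] b_le[of 0] by linarith

lemma tau_nonneg: "0 \<le> tau" by (simp add: tau_def XX_nonneg)

lemma e0_integral:
  "(LINT x|U01. e0 q x) \<ge> (nrm U01 (yv q 0))\<^sup>2 + bl * (nrm U01 (pv q 0))\<^sup>2"
  "(LINT x|U01. e0 q x) \<le> (nrm U01 (yv q 0))\<^sup>2 + bu * (nrm U01 (pv q 0))\<^sup>2"
proof -
  have i: "integrable U01 (\<lambda>x. (yv q 0 x)\<^sup>2)" "integrable U01 (\<lambda>x. (pv q 0 x)\<^sup>2)"
    by (rule L2_sq[OF yv_L2] L2_sq[OF pv_L2])+
  have *: "(nrm U01 (yv q 0))\<^sup>2 + k * (nrm U01 (pv q 0))\<^sup>2 = (LINT x|U01. (yv q 0 x)\<^sup>2 + k * (pv q 0 x)\<^sup>2)" for k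
    unfolding nrm_sq using i by simp
  show "(LINT x|U01. e0 q x) \<ge> (nrm U01 (yv q 0))\<^sup>2 + bl * (nrm U01 (pv q 0))\<^sup>2"
    unfolding * by (rule integral_mono) (use i e0_int[of q, unfolded e0_def[abs_def]] in \<open>auto simp: e0_def yv_def pv_def intro!: mult_right_mono b_ge\<close>)
  show "(LINT x|U01. e0 q x) \<le> (nrm U01 (yv q 0))\<^sup>2 + bu * (nrm U01 (pv q 0))\<^sup>2"
    unfolding * by (rule integral_mono) (use i e0_int[of q, unfolded e0_def[abs_def]] in \<open>auto simp: e0_def yv_def pv_def intro!: mult_right_mono b_le\<close>)
qed

text \<open>Domain of dependence: the state at time \<open>t\<close> sees \<open>q\<close> only on
  [t - tau, t + tau]. The constant collects \<open>EV\<close>, the bounds of \<open>b\<close>, and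
  the division by \<open>bl\<close> needed to bound p alone.\<close>

lemma state_upper:
  obtains C where "0 < C"
    "\<And>q t. nrm U01 (yv q t) \<le> C * nrm (MI (t - tau) (t + tau)) (poly q)"
    "\<And>q t. nrm U01 (pv q t) \<le> C * nrm (MI (t - tau) (t + tau)) (poly q)"
proof -
  define C0 where "C0 = EV * bu / (2 * sqrt bl)"
  define C where "C = sqrt (C0 + C0 / bl)"
  have C0: "0 < C0" using EV_pos bu_pos bl by (simp add: C0_def)
  have Cp: "0 < C" using C0 bl by (simp add: C_def add_pos_pos)
  have *: "nrm U01 (yv q t) \<le> C * nrm (MI (t - tau) (t + tau)) (poly q)
      \<and> nrm U01 (pv q t) \<le> C * nrm (MI (t - tau) (t + tau)) (poly q)" for q t
  proof -
    define q' where "q' = pcompose q [:t, 1:]"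
    have yq: "yv q' 0 = yv q t" and pq: "pv q' 0 = pv q t"
      by (auto simp: q'_def yv_shift pv_shift fun_eq_iff)
    define N where "N = (nrm (MI (t - tau) (t + tau)) (poly q))\<^sup>2"
    have N: "integral {- tau..tau} (poly (q' * q')) = N"
      unfolding q'_def integral_shift_poly N_def nrm_sq_poly by (simp add: algebra_simps)
    have N0: "0 \<le> N" by (simp add: N_def)
    have "2 * sqrt bl * (LINT x|U01. e0 q' x) \<le> EV * (b 1 * N)"
      using state_bounds_HK(1)[of q'] unfolding N .
    also have "\<dots> \<le> EV * (bu * N)"
      using EV_pos N0 by (intro mult_left_mono mult_right_mono b_le) auto
    finally have "(LINT x|U01. e0 q' x) \<le> C0 * N"
      using bl by (simp add: C0_def field_simps)
    with e0_integral(1)[of q'] have e: "(nrm U01 (yv q t))\<^sup>2 + bl * (nrm U01 (pv q t))\<^sup>2 \<le> C0 * N"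
      by (simp add: yq pq)
    have "bl * (nrm U01 (pv q t))\<^sup>2 \<le> C0 * N" using e zero_le_power2[of "nrm U01 (yv q t)"] by linarith
    then have p: "(nrm U01 (pv q t))\<^sup>2 \<le> C0 / bl * N" using bl by (simp add: field_simps)
    have "0 \<le> bl * (nrm U01 (pv q t))\<^sup>2" using bl by simp
    then have y: "(nrm U01 (yv q t))\<^sup>2 \<le> C0 * N" using e by linarith
    have nn: "0 \<le> C0 * N" "0 \<le> C0 / bl * N" using C0 bl N0 by auto
    have CN: "(C * nrm (MI (t - tau) (t + tau)) (poly q))\<^sup>2 = C0 * N + C0 / bl * N"
      using C0 bl by (simp add: C_def power_mult_distrib N_def distrib_right)
    have C0n: "0 \<le> C * nrm (MI (t - tau) (t + tau)) (poly q)" using Cp by simp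
    have "(nrm U01 (yv q t))\<^sup>2 \<le> C0 * N + C0 / bl * N" "(nrm U01 (pv q t))\<^sup>2 \<le> C0 * N + C0 / bl * N"
      using p y nn by linarith+
    then show ?thesis unfolding CN[symmetric] using C0n by (blast intro: power2_le_imp_le)
  qed
  show ?thesis by (rule that[OF Cp]) (use * in blast)+
qed

text \<open>The reverse inequality and the crux of controllability: the two components at time 0
  alone bound \<open>q\<close> on [-tau, tau]. No information on the trace at x = 0 enters.\<close>

lemma state_lower:
  obtains C where "0 < C"
    "\<And>q. nrm (MI (- tau) tau) (poly q) \<le> C * (nrm U01 (yv q 0) + nrm U01 (pv q 0))"
proof -
  define C0 where "C0 = EV * (2 * sqrt bu) / bl"
  define C where "C = sqrt (C0 * (1 + bu))"
  have C0: "0 < C0" using EV_pos bu_pos bl by (simp add: C0_def)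
  have Cp: "0 < C" using C0 bu_pos by (simp add: C_def add_pos_pos)
  have "nrm (MI (- tau) tau) (poly q) \<le> C * (nrm U01 (yv q 0) + nrm U01 (pv q 0))" for q
  proof (rule power2_le_imp_le)
    let ?y = "nrm U01 (yv q 0)" and ?p = "nrm U01 (pv q 0)"
    have "bl * (nrm (MI (- tau) tau) (poly q))\<^sup>2 \<le> b 1 * (nrm (MI (- tau) tau) (poly q))\<^sup>2"
      by (intro mult_right_mono b_ge) simp
    also have "\<dots> \<le> EV * (2 * sqrt bu * (LINT x|U01. e0 q x))"
      unfolding nrm_sq_poly by (rule state_bounds_HK(2))
    finally have "(nrm (MI (- tau) tau) (poly q))\<^sup>2 \<le> C0 * (LINT x|U01. e0 q x)"
      using bl by (simp add: C0_def field_simps)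
    also have "\<dots> \<le> C0 * (?y\<^sup>2 + bu * ?p\<^sup>2)"
      using e0_integral(2) C0 by (intro mult_left_mono) auto
    also have "\<dots> \<le> C0 * ((1 + bu) * (?y + ?p)\<^sup>2)"
    proof (intro mult_left_mono)
      have "?y\<^sup>2 \<le> (?y + ?p)\<^sup>2" "?p\<^sup>2 \<le> (?y + ?p)\<^sup>2" by (auto intro!: power_mono)
      then have "?y\<^sup>2 + bu * ?p\<^sup>2 \<le> 1 * (?y + ?p)\<^sup>2 + bu * (?y + ?p)\<^sup>2"
        using bu_pos by (intro add_mono mult_left_mono) auto
      then show "?y\<^sup>2 + bu * ?p\<^sup>2 \<le> (1 + bu) * (?y + ?p)\<^sup>2" by (simp add: distrib_right)
    qed (use C0 in simp)
    finally show "(nrm (MI (- tau) tau) (poly q))\<^sup>2 \<le> (C * (?y + ?p))\<^sup>2"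
      using C0 bu_pos by (simp add: C_def power_mult_distrib mult.assoc)
  qed (use Cp in simp)
  then show ?thesis using that[OF Cp] by blast
qed

text \<open>\<open>trace_bound_HK\<close> concerns windows symmetric about 0; translating by T / 2
  centres [0,T], and the margin \<open>tau\<close> on each side remains.\<close>

lemma trace_upper:
  obtains C where "0 < C"
    "\<And>q T. 0 \<le> T \<Longrightarrow> nrm (MI 0 T) (\<lambda>t. yv q t 0) \<le> C * nrm (MI (- tau) (T + tau)) (poly q)"
proof -
  define C where "C = sqrt (EV * bu)"
  have Cp: "0 < C" using EV_pos bu_pos by (simp add: C_def)
  have "nrm (MI 0 T) (\<lambda>t. yv q t 0) \<le> C * nrm (MI (- tau) (T + tau)) (poly q)" if T: "0 \<le> T" for q T
  proof (rule power2_le_imp_le)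
    define q' where "q' = pcompose q [:T / 2, 1:]"
    have "(nrm (MI 0 T) (\<lambda>t. yv q t 0))\<^sup>2 = integral {0..T} (poly (YY q 0 * YY q 0))"
      unfolding yv_def using nrm_sq_poly[of 0 T "YY q 0"] by simp
    also have "\<dots> = integral {- (T/2) + T/2..T/2 + T/2} (poly (YY q 0 * YY q 0))" by simp
    also have "\<dots> = integral {- (T/2)..T/2} (poly (YY q' 0 * YY q' 0))"
      unfolding q'_def YY_shift integral_shift_poly ..
    also have "\<dots> \<le> EV * bu * integral {- (tau + T/2)..tau + T/2} (poly (q' * q'))"
      by (rule trace_bound_HK) (use T in simp)
    also have "integral {- (tau + T/2)..tau + T/2} (poly (q' * q')) = (nrm (MI (- tau) (T + tau)) (poly q))\<^sup>2"
      unfolding q'_def integral_shift_poly nrm_sq_poly by (simp add: algebra_simps)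
    also have "EV * bu * (nrm (MI (- tau) (T + tau)) (poly q))\<^sup>2 = (C * nrm (MI (- tau) (T + tau)) (poly q))\<^sup>2"
      using EV_pos bu_pos by (simp add: C_def power_mult_distrib)
    finally show "(nrm (MI 0 T) (\<lambda>t. yv q t 0))\<^sup>2 \<le> (C * nrm (MI (- tau) (T + tau)) (poly q))\<^sup>2" .
  qed (use Cp in simp)
  then show ?thesis using that[OF Cp] by blast
qed

lemma poly_higher_pderiv_0: "poly ((pderiv ^^ m) q) 0 = fact m * coeff q m" for q :: "real poly"
  by (simp add: poly_0_coeff_0 coeff_higher_pderiv pochhammer_fact)

lemma yv_0: "yv q 0 x = (\<Sum>j\<le>degree q. cB j x * (fact (2 * j + 1) * coeff q (2 * j + 1)))"
  unfolding yv_def YY_def expn_def by (simp add: poly_sum poly_higher_pderiv_0 del: funpow.simps fact_Suc)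

lemma pv_0: "pv q 0 x = (\<Sum>j\<le>degree q. cA j x * (fact (2 * j) * coeff q (2 * j)))"
  unfolding pv_def PP_def expn_def by (simp add: poly_sum poly_higher_pderiv_0 del: funpow.simps)

lemma yv_lin: "yv (p + smult c q) t x = yv p t x + c * yv q t x"
  by (simp add: yv_def YY_lin)

lemma pv_lin: "pv (p + smult c q) t x = pv p t x + c * pv q t x"
  by (simp add: pv_def PP_lin)

text \<open>Odd monomials produce the states (cB_j, 0), even ones (0, cA_j), up to a factorial: the
  two components of a state can be approximated independently.\<close>

lemma state_monom:
  shows "yv (monom 1 (2 * j + 1)) 0 x = fact (2 * j + 1) * cB j x" "pv (monom 1 (2 * j + 1)) 0 x = 0"
    "pv (monom 1 (2 * j)) 0 x = fact (2 * j) * cA j x" "yv (monom 1 (2 * j)) 0 x = 0"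
proof -
  have "yv (monom 1 (2 * j + 1)) 0 x = (\<Sum>i\<le>2 * j + 1. if i = j then fact (2 * j + 1) * cB j x else 0)"
    unfolding yv_0 by (intro sum.cong) (auto simp: degree_monom_eq simp del: fact_Suc)
  then show "yv (monom 1 (2 * j + 1)) 0 x = fact (2 * j + 1) * cB j x" by (simp del: fact_Suc)
  have "pv (monom 1 (2 * j)) 0 x = (\<Sum>i\<le>2 * j. if i = j then fact (2 * j) * cA j x else 0)"
    unfolding pv_0 by (intro sum.cong) (auto simp: degree_monom_eq simp del: fact_Suc)
  then show "pv (monom 1 (2 * j)) 0 x = fact (2 * j) * cA j x" by simp
  have odd: "2 * j + 1 \<noteq> 2 * i" "2 * j \<noteq> 2 * i + 1" for i by presburger+
  show "pv (monom 1 (2 * j + 1)) 0 x = 0" unfolding pv_0 using odd(1) by (intro sum.neutral) auto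
  show "yv (monom 1 (2 * j)) 0 x = 0" unfolding yv_0 using odd(2) by (intro sum.neutral) auto
qed

text \<open>The kernel of \<open>B\<close> is mapped by \<open>A\<close> onto a subspace, and
  totality there gives density. This lets one component be approximated while the other stays
  exactly zero.\<close>

lemma kernel_range_dense:
  fixes A B :: "real poly \<Rightarrow> real \<Rightarrow> real"
  assumes L: "\<And>q. A q \<in> L2 U01"
    and A: "\<And>p q c x. A (p + smult c q) x = A p x + c * A q x"
    and B: "\<And>p q c x. B (p + smult c q) x = B p x + c * B q x"
    and tot: "\<And>k. k \<in> L2 U01 \<Longrightarrow> (\<And>q. B q = (\<lambda>_. 0) \<Longrightarrow> (LINT x|U01. k x * A q x) = 0) \<Longrightarrow> AE x in U01. k x = 0"
    and f: "f \<in> L2 U01"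
  obtains p where "\<And>n::nat. B (p n) = (\<lambda>_. 0)" "(\<lambda>n. nrm U01 (\<lambda>x. A (p n) x - f x)) \<longlonglongrightarrow> 0"
proof -
  define W where "W = {A q |q. B q = (\<lambda>_. 0)}"
  have "\<exists>s. (\<forall>n::nat. s n \<in> W) \<and> (\<lambda>n. nrm U01 (\<lambda>x. s n x - f x)) \<longlonglongrightarrow> 0"
  proof (rule L2_dense_subspace[OF finite_MI _ _ _ _ f])
    show "W \<subseteq> L2 U01" using L by (auto simp: W_def)
    have "A 0 = (\<lambda>_. 0)" "B 0 = (\<lambda>_. 0)" using A[of 0 "- 1" 0] B[of 0 "- 1" 0] by (auto simp: fun_eq_iff)
    then show "(\<lambda>x. 0) \<in> W" unfolding W_def by (intro CollectI exI[of _ 0]) auto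
    fix g k c assume "g \<in> W" "k \<in> W"
    then obtain p q where pq: "g = A p" "k = A q" "B p = (\<lambda>_. 0)" "B q = (\<lambda>_. 0)" by (auto simp: W_def)
    have "(\<lambda>x. g x + c * k x) = A (p + smult c q)" "B (p + smult c q) = (\<lambda>_. 0)"
      using pq by (auto simp: fun_eq_iff A B)
    then show "(\<lambda>x. g x + c * k x) \<in> W" by (auto simp: W_def)
  next
    fix k assume k: "k \<in> L2 U01" and o: "\<And>g. g \<in> W \<Longrightarrow> (LINT x|U01. k x * g x) = 0"
    show "AE x in U01. k x = 0" by (rule tot[OF k], rule o) (auto simp: W_def)
  qed
  then obtain s where s: "\<And>n::nat. s n \<in> W" "(\<lambda>n. nrm U01 (\<lambda>x. s n x - f x)) \<longlonglongrightarrow> 0" by blast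
  have "\<forall>n. \<exists>q. s n = A q \<and> B q = (\<lambda>_. 0)" using s(1) by (auto simp: W_def)
  then obtain p where p: "\<And>n. s n = A (p n)" "\<And>n. B (p n) = (\<lambda>_. 0)" by metis
  show ?thesis by (rule that[of p]) (use p s(2) in simp_all)
qed

lemma state_dense:
  assumes f: "f \<in> L2 U01" and h: "h \<in> L2 U01"
  obtains r where "(\<lambda>n::nat. nrm U01 (\<lambda>x. yv (r n) 0 x - f x)) \<longlonglongrightarrow> 0"
    "(\<lambda>n. nrm U01 (\<lambda>x. pv (r n) 0 x - h x)) \<longlonglongrightarrow> 0"
proof -
  have y: "AE x in U01. k x = 0"
    if k: "k \<in> L2 U01" and o: "\<And>q. pv q 0 = (\<lambda>_. 0) \<Longrightarrow> (LINT x|U01. k x * yv q 0 x) = 0" for k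
  proof (rule cB_total[OF k])
    fix j
    have "pv (monom 1 (2 * j + 1)) 0 = (\<lambda>_. 0)" by (rule ext) (rule state_monom(2))
    from o[OF this] have "(LINT x|U01. fact (2 * j + 1) * (k x * cB j x)) = 0"
      by (simp only: state_monom mult.left_commute)
    then show "(LINT x|U01. k x * cB j x) = 0" by (simp del: fact_Suc)
  qed
  have p: "AE x in U01. k x = 0"
    if k: "k \<in> L2 U01" and o: "\<And>q. yv q 0 = (\<lambda>_. 0) \<Longrightarrow> (LINT x|U01. k x * pv q 0 x) = 0" for k
  proof (rule cA_total[OF k])
    fix j
    have "yv (monom 1 (2 * j)) 0 = (\<lambda>_. 0)" by (rule ext) (rule state_monom(4))
    from o[OF this] have "(LINT x|U01. fact (2 * j) * (k x * cA j x)) = 0"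
      by (simp only: state_monom mult.left_commute)
    then show "(LINT x|U01. k x * cA j x) = 0" by simp
  qed
  obtain u where u: "\<And>n::nat. pv (u n) 0 = (\<lambda>_. 0)" "(\<lambda>n. nrm U01 (\<lambda>x. yv (u n) 0 x - f x)) \<longlonglongrightarrow> 0"
    by (rule kernel_range_dense[of "\<lambda>q. yv q 0" "\<lambda>q. pv q 0", OF yv_L2 yv_lin pv_lin y f]) (assumption, blast, (rule that; assumption))
  obtain w where w: "\<And>n::nat. yv (w n) 0 = (\<lambda>_. 0)" "(\<lambda>n. nrm U01 (\<lambda>x. pv (w n) 0 x - h x)) \<longlonglongrightarrow> 0"
    by (rule kernel_range_dense[of "\<lambda>q. pv q 0" "\<lambda>q. yv q 0", OF pv_L2 pv_lin yv_lin p h]) (assumption, blast, (rule that; assumption))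
  show ?thesis
    by (rule that[of "\<lambda>n. u n + smult 1 (w n)"], unfold yv_lin pv_lin) (use u w in simp_all)
qed

end

section \<open>The controlled limit\<close>

text \<open>The rate \<open>d\<close> survives the limit. When one \<open>d\<close> serves a whole
  family of sequences, here the states at all times, convergence is uniform over the family.\<close>

lemma L2_limit_rate:
  assumes fin: "finite_measure M" and f: "\<And>n::nat. f n \<in> L2 M"
    and d: "\<And>n m. nrm M (\<lambda>x. f n x - f m x) \<le> d n + d m" and d0: "d \<longlonglongrightarrow> 0"
  shows "\<exists>g\<in>L2 M. \<forall>n. nrm M (\<lambda>x. f n x - g x) \<le> d n"
proof -
  have "\<exists>N. \<forall>m\<ge>N. \<forall>n\<ge>N. nrm M (\<lambda>x. f m x - f n x) < e" if e: "e > 0" for e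
  proof -
    obtain N where N: "\<And>n. n \<ge> N \<Longrightarrow> \<bar>d n\<bar> < e / 2"
      using LIMSEQ_D[OF d0, of "e/2"] e by auto
    have "nrm M (\<lambda>x. f m x - f n x) < e" if "m \<ge> N" "n \<ge> N" for m n
      using d[of m n] N[OF that(1)] N[OF that(2)] by linarith
    then show ?thesis by blast
  qed
  from L2_complete[OF f fin this] obtain g where g: "g \<in> L2 M"
    and lim: "(\<lambda>n. nrm M (\<lambda>x. f n x - g x)) \<longlonglongrightarrow> 0" by blast
  have "nrm M (\<lambda>x. f n x - g x) \<le> d n" for n
  proof (rule LIMSEQ_le_const)
    have "(\<lambda>m. d n + d m + nrm M (\<lambda>x. f m x - g x)) \<longlonglongrightarrow> d n + 0 + 0"
      by (intro tendsto_intros d0 lim)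
    then show "(\<lambda>m. d n + d m + nrm M (\<lambda>x. f m x - g x)) \<longlonglongrightarrow> d n" by simp
    have "nrm M (\<lambda>x. f n x - g x) \<le> d n + d m + nrm M (\<lambda>x. f m x - g x)" for m
      using nrm_triangle_diff[OF f[of n] f[of m] g] d[of n m] by linarith
    then show "\<exists>N. \<forall>m\<ge>N. nrm M (\<lambda>x. f n x - g x) \<le> d n + d m + nrm M (\<lambda>x. f m x - g x)" by blast
  qed
  then show ?thesis using g by blast
qed

lemma L2_zero_extension:
  assumes q: "q \<in> L2 (MI u w')" and "u \<le> w'" "w' \<le> w"
  shows "(\<lambda>x. indicator {u..w'} x * q x) \<in> L2 (MI u w)"
proof -
  have e: "(\<lambda>x. indicator {u..w} x *\<^sub>R (indicator {u..w'} x * q x)) = (\<lambda>x. indicator {u..w'} x *\<^sub>R q x)"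
    "(\<lambda>x. indicator {u..w} x *\<^sub>R (indicator {u..w'} x * q x)\<^sup>2) = (\<lambda>x. indicator {u..w'} x *\<^sub>R (q x)\<^sup>2)"
    using assms by (auto simp: indicator_def)
  have "(\<lambda>x. indicator {u..w'} x *\<^sub>R q x) \<in> borel_measurable lborel"
    using L2_meas[OF q] by (subst (asm) borel_measurable_restrict_space_iff) auto
  moreover have "integrable lborel (\<lambda>x. indicator {u..w'} x *\<^sub>R (q x)\<^sup>2)"
    using L2_sq[OF q] by (subst (asm) integrable_restrict_space) auto
  ultimately show ?thesis
    unfolding L2_def mem_Collect_eq
    by (subst borel_measurable_restrict_space_iff, simp, subst integrable_restrict_space, simp, unfold e, simp)
qed

lemma nrm_eq_MI:
  assumes "\<And>x. x \<in> {u..w} \<Longrightarrow> f x = g x"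
  shows "nrm (MI u w) f = nrm (MI u w) g"
  unfolding nrm_def
  by (rule arg_cong[of _ _ sqrt], rule Bochner_Integration.integral_cong) (use assms in \<open>auto simp: space_restrict_space\<close>)

lemma diff_L2:
  assumes "f \<in> L2 M" "g \<in> L2 M" "nrm M (\<lambda>x. f x - g x) = 0"
  shows "AE x in M. f x = g x"
  using nrm_eq_0_iff[OF L2_diff[OF assms(1,2)]] assms(3) by simp

context wave_coeff
begin

text \<open>Two approximations are needed. Polynomials \<open>r n\<close> whose states approach the
  data are Cauchy on [-tau, tau] by \<open>state_lower\<close> and define \<open>q\<close> there,
  but nothing is known about them beyond \<open>tau\<close>. The polynomials \<open>s n\<close>
  approximate the zero extension of \<open>q\<close> on all of [-tau, T + tau], and
  \<open>state_upper\<close> and \<open>trace_upper\<close> then give limits with one rate for all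
  times.\<close>

lemma control_limit:
  assumes T: "0 < T" "2 * tau \<le> T" and y0: "y0 \<in> L2 U01" and p0: "p0 \<in> L2 U01"
  obtains s Y P v d where
    "\<And>t. t \<in> {0..T} \<Longrightarrow> Y t \<in> L2 U01" "\<And>t. t \<in> {0..T} \<Longrightarrow> P t \<in> L2 U01" "v \<in> L2 (MI 0 T)"
    "d \<longlonglongrightarrow> 0"
    "\<And>n t. t \<in> {0..T} \<Longrightarrow> nrm U01 (\<lambda>x. yv (s n) t x - Y t x) \<le> d n"
    "\<And>n t. t \<in> {0..T} \<Longrightarrow> nrm U01 (\<lambda>x. pv (s n) t x - P t x) \<le> d n"
    "\<And>n. nrm (MI 0 T) (\<lambda>t. yv (s n) t 0 - v t) \<le> d n"
    "AE x in U01. Y 0 x = y0 x" "AE x in U01. P 0 x = p0 x"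
    "AE x in U01. Y T x = 0" "AE x in U01. P T x = 0"
proof -
  obtain C where C: "0 < C"
    "\<And>q t. nrm U01 (yv q t) \<le> C * nrm (MI (t - tau) (t + tau)) (poly q)"
    "\<And>q t. nrm U01 (pv q t) \<le> C * nrm (MI (t - tau) (t + tau)) (poly q)" using state_upper by blast
  obtain C1 where C1: "0 < C1"
    "\<And>q. nrm (MI (- tau) tau) (poly q) \<le> C1 * (nrm U01 (yv q 0) + nrm U01 (pv q 0))" using state_lower by blast
  obtain C2 where C2: "0 < C2"
    "\<And>q T. 0 \<le> T \<Longrightarrow> nrm (MI 0 T) (\<lambda>t. yv q t 0) \<le> C2 * nrm (MI (- tau) (T + tau)) (poly q)" using trace_upper by blast
  obtain r where ry: "(\<lambda>n::nat. nrm U01 (\<lambda>x. yv (r n) 0 x - y0 x)) \<longlonglongrightarrow> 0"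
    and rp: "(\<lambda>n. nrm U01 (\<lambda>x. pv (r n) 0 x - p0 x)) \<longlonglongrightarrow> 0" using state_dense[OF y0 p0] by blast
  define e1 where "e1 n = nrm U01 (\<lambda>x. yv (r n) 0 x - y0 x)" for n
  define e2 where "e2 n = nrm U01 (\<lambda>x. pv (r n) 0 x - p0 x)" for n
  have "\<exists>q\<in>L2 (MI (- tau) tau). \<forall>n. nrm (MI (- tau) tau) (\<lambda>x. poly (r n) x - q x) \<le> C1 * (e1 n + e2 n)"
  proof (rule L2_limit_rate[OF finite_MI poly_L2])
    fix n m
    have "nrm (MI (- tau) tau) (\<lambda>x. poly (r n) x - poly (r m) x) = nrm (MI (- tau) tau) (poly (r n - r m))"
      by (rule nrm_eq_MI) simp
    also have "\<dots> \<le> C1 * (nrm U01 (yv (r n - r m) 0) + nrm U01 (pv (r n - r m) 0))" by (rule C1)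
    also have "\<dots> \<le> C1 * ((e1 n + e1 m) + (e2 n + e2 m))"
      using C1(1) nrm_triangle_diff[OF yv_L2[of "r n" 0] y0 yv_L2[of "r m" 0]] nrm_triangle_diff[OF pv_L2[of "r n" 0] p0 pv_L2[of "r m" 0]]
      unfolding e1_def e2_def
      by (intro mult_left_mono add_mono) (simp_all add: yv_diff[abs_def] pv_diff[abs_def] nrm_commute[of U01 y0] nrm_commute[of U01 p0])
    finally show "nrm (MI (- tau) tau) (\<lambda>x. poly (r n) x - poly (r m) x) \<le> C1 * (e1 n + e2 n) + C1 * (e1 m + e2 m)"
      by (simp add: algebra_simps)
  next
    have "(\<lambda>n. C1 * (e1 n + e2 n)) \<longlonglongrightarrow> C1 * (0 + 0)"
      unfolding e1_def e2_def by (intro tendsto_intros ry rp)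
    then show "(\<lambda>n. C1 * (e1 n + e2 n)) \<longlonglongrightarrow> 0" by simp
  qed
  then obtain q where q: "q \<in> L2 (MI (- tau) tau)"
    and rq: "\<And>n. nrm (MI (- tau) tau) (\<lambda>x. poly (r n) x - q x) \<le> C1 * (e1 n + e2 n)" by blast
  \<comment> \<open>As T \<ge> 2 tau, the dependence window [T - tau, T + tau] of the final time
    meets [-tau, tau] at most in the point \<open>tau\<close>, so this zero extension forces a zero
    state at \<open>T\<close>.\<close>
  define qe where "qe x = indicator {- tau..tau} x * q x" for x
  let ?J = "MI (- tau) (T + tau)"
  have qe: "qe \<in> L2 ?J" unfolding qe_def[abs_def] using q T tau_nonneg by (intro L2_zero_extension) auto
  obtain s where sq: "(\<lambda>n::nat. nrm ?J (\<lambda>x. poly (s n) x - qe x)) \<longlonglongrightarrow> 0"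
    using poly_dense[OF _ qe] T tau_nonneg by auto
  define e3 where "e3 n = nrm ?J (\<lambda>x. poly (s n) x - qe x)" for n
  have e30: "0 \<le> e3 n" for n by (simp add: e3_def)
  have ss: "nrm ?J (poly (s n - s m)) \<le> e3 n + e3 m" for n m
  proof -
    have "nrm ?J (poly (s n - s m)) = nrm ?J (\<lambda>x. poly (s n) x - poly (s m) x)" by (rule nrm_eq_MI) simp
    also have "\<dots> \<le> e3 n + e3 m"
      using nrm_triangle_diff[OF poly_L2[of "s n"] qe poly_L2[of "s m"]]
      by (simp add: e3_def nrm_commute[of ?J qe])
    finally show ?thesis .
  qed
  define d where "d n = (C + C2) * e3 n" for n
  have d0: "d \<longlonglongrightarrow> 0"
    using tendsto_mult[OF tendsto_const[of "C + C2"] sq] by (simp add: d_def[abs_def] e3_def)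
  have dC: "C * e3 n \<le> d n" "C2 * e3 n \<le> d n" for n
    using C(1) C2(1) e30[of n] by (auto simp: d_def distrib_right)
  have win: "nrm (MI (t - tau) (t + tau)) (poly (s n - s m)) \<le> e3 n + e3 m" if "t \<in> {0..T}" for t n m
    using MI_mono(2)[OF poly_L2, of "- tau" "t - tau" "t + tau" "T + tau" "s n - s m"] ss[of n m] that by auto
  have lim: "\<exists>g\<in>L2 U01. \<forall>n. nrm U01 (\<lambda>x. h (s n) x - g x) \<le> d n"
    if h: "\<And>q. h q \<in> L2 U01" "\<And>p q x. h (p - q) x = h p x - h q x"
      "\<And>q. nrm U01 (h q) \<le> C * nrm (MI (t - tau) (t + tau)) (poly q)" and t: "t \<in> {0..T}" for h t
  proof (rule L2_limit_rate[OF finite_MI h(1) _ d0])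
    fix n m
    have "nrm U01 (\<lambda>x. h (s n) x - h (s m) x) = nrm U01 (h (s n - s m))" by (simp add: h(2)[abs_def])
    also have "\<dots> \<le> C * nrm (MI (t - tau) (t + tau)) (poly (s n - s m))" by (rule h)
    also have "\<dots> \<le> C * (e3 n + e3 m)" using win[OF t] C(1) by (intro mult_left_mono) auto
    finally show "nrm U01 (\<lambda>x. h (s n) x - h (s m) x) \<le> d n + d m" using dC[of n] dC[of m] by (simp add: distrib_left)
  qed
  have "\<forall>t\<in>{0..T}. \<exists>g\<in>L2 U01. \<forall>n. nrm U01 (\<lambda>x. yv (s n) t x - g x) \<le> d n"
    by (intro ballI lim[of "\<lambda>q. yv q _", OF yv_L2 yv_diff C(2)])
  then obtain Y where Y: "\<And>t. t \<in> {0..T} \<Longrightarrow> Y t \<in> L2 U01"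
    "\<And>n t. t \<in> {0..T} \<Longrightarrow> nrm U01 (\<lambda>x. yv (s n) t x - Y t x) \<le> d n" by metis
  have "\<forall>t\<in>{0..T}. \<exists>g\<in>L2 U01. \<forall>n. nrm U01 (\<lambda>x. pv (s n) t x - g x) \<le> d n"
    by (intro ballI lim[of "\<lambda>q. pv q _", OF pv_L2 pv_diff C(3)])
  then obtain P where P: "\<And>t. t \<in> {0..T} \<Longrightarrow> P t \<in> L2 U01"
    "\<And>n t. t \<in> {0..T} \<Longrightarrow> nrm U01 (\<lambda>x. pv (s n) t x - P t x) \<le> d n" by metis
  have trL: "(\<lambda>t. yv q t 0) \<in> L2 (MI 0 T)" for q
    unfolding yv_def using poly_L2[of "YY q 0"] by simp
  have "\<exists>g\<in>L2 (MI 0 T). \<forall>n. nrm (MI 0 T) (\<lambda>t. yv (s n) t 0 - g t) \<le> d n"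
  proof (rule L2_limit_rate[OF finite_MI trL _ d0])
    fix n m
    have "nrm (MI 0 T) (\<lambda>t. yv (s n) t 0 - yv (s m) t 0) = nrm (MI 0 T) (\<lambda>t. yv (s n - s m) t 0)" by (simp add: yv_diff)
    also have "\<dots> \<le> C2 * nrm ?J (poly (s n - s m))" using T by (intro C2) simp
    also have "\<dots> \<le> C2 * (e3 n + e3 m)" using ss C2(1) by (intro mult_left_mono) auto
    finally show "nrm (MI 0 T) (\<lambda>t. yv (s n) t 0 - yv (s m) t 0) \<le> d n + d m" using dC[of n] dC[of m] by (simp add: distrib_left)
  qed
  then obtain v where v: "v \<in> L2 (MI 0 T)" "\<And>n. nrm (MI 0 T) (\<lambda>t. yv (s n) t 0 - v t) \<le> d n" by blast
  \<comment> \<open>Bounds the distance at time 0 between the states of \<open>s n\<close> and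
    \<open>r n\<close>, since both approximate \<open>q\<close> on [-tau, tau].\<close>
  define e4 where "e4 n = C * (e3 n + C1 * (e1 n + e2 n))" for n
  have e40: "e4 \<longlonglongrightarrow> 0"
  proof -
    have "e4 \<longlonglongrightarrow> C * (0 + C1 * (0 + 0))"
      unfolding e4_def[abs_def] e1_def e2_def e3_def by (intro tendsto_intros sq ry rp)
    then show ?thesis by simp
  qed
  have sr: "nrm (MI (- tau) tau) (poly (s n - r n)) \<le> e3 n + C1 * (e1 n + e2 n)" for n
  proof -
    have qe': "qe \<in> L2 (MI (- tau) tau)" using MI_mono(1)[OF qe, of "- tau" tau] T by auto
    have "nrm (MI (- tau) tau) (poly (s n - r n)) = nrm (MI (- tau) tau) (\<lambda>x. poly (s n) x - poly (r n) x)" by (rule nrm_eq_MI) simp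
    also have "\<dots> \<le> nrm (MI (- tau) tau) (\<lambda>x. poly (s n) x - qe x) + nrm (MI (- tau) tau) (\<lambda>x. qe x - poly (r n) x)"
      by (rule nrm_triangle_diff[OF poly_L2 qe' poly_L2])
    also have "nrm (MI (- tau) tau) (\<lambda>x. poly (s n) x - qe x) \<le> e3 n"
      unfolding e3_def using MI_mono(2)[OF L2_diff[OF poly_L2 qe], of "- tau" tau] T by auto
    also have "nrm (MI (- tau) tau) (\<lambda>x. qe x - poly (r n) x) = nrm (MI (- tau) tau) (\<lambda>x. poly (r n) x - q x)"
      by (subst nrm_commute) (rule nrm_eq_MI, simp add: qe_def)
    finally show ?thesis using rq[of n] by linarith
  qed
  have init: "AE x in U01. Y0 x = f x"
    if Y0: "Y0 \<in> L2 U01" "\<And>n. nrm U01 (\<lambda>x. h (s n) x - Y0 x) \<le> d n" and f: "f \<in> L2 U01"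
      and h: "\<And>q. h q \<in> L2 U01" "\<And>p q x. h (p - q) x = h p x - h q x" "\<And>q. nrm U01 (h q) \<le> C * nrm (MI (- tau) tau) (poly q)"
      and r: "(\<lambda>n. nrm U01 (\<lambda>x. h (r n) x - f x)) \<longlonglongrightarrow> 0" for Y0 f h
  proof (rule diff_L2[OF Y0(1) f])
    have "nrm U01 (\<lambda>x. Y0 x - f x) \<le> d n + (e4 n + nrm U01 (\<lambda>x. h (r n) x - f x))" for n
    proof -
      have "nrm U01 (\<lambda>x. h (s n) x - h (r n) x) \<le> e4 n"
      proof -
        have "nrm U01 (\<lambda>x. h (s n) x - h (r n) x) = nrm U01 (h (s n - r n))" by (simp add: h(2)[abs_def])
        also have "\<dots> \<le> C * nrm (MI (- tau) tau) (poly (s n - r n))" by (rule h)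
        also have "\<dots> \<le> e4 n" unfolding e4_def using sr C(1) by (intro mult_left_mono) auto
        finally show ?thesis .
      qed
      then show ?thesis
        using nrm_triangle_diff[OF Y0(1) h(1)[of "s n"] f] nrm_triangle_diff[OF h(1)[of "s n"] h(1)[of "r n"] f] Y0(2)[of n]
        by (simp add: nrm_commute[of U01 Y0])
    qed
    moreover have "(\<lambda>n. d n + (e4 n + nrm U01 (\<lambda>x. h (r n) x - f x))) \<longlonglongrightarrow> 0 + (0 + 0)"
      by (intro tendsto_intros d0 e40 r)
    ultimately have "nrm U01 (\<lambda>x. Y0 x - f x) \<le> 0" by (intro LIMSEQ_le_const[of _ 0]) auto
    then show "nrm U01 (\<lambda>x. Y0 x - f x) = 0" by (simp add: antisym)
  qed
  have final: "AE x in U01. YT x = 0"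
    if YT: "YT \<in> L2 U01" "\<And>n. nrm U01 (\<lambda>x. h (s n) x - YT x) \<le> d n"
      and h: "\<And>q. h q \<in> L2 U01" "\<And>q. nrm U01 (h q) \<le> C * nrm (MI (T - tau) (T + tau)) (poly q)" for YT h
  proof -
    have "nrm U01 YT \<le> d n + d n" for n
    proof -
      have "nrm (MI (T - tau) (T + tau)) (poly (s n)) = nrm (MI (T - tau) (T + tau)) (\<lambda>x. poly (s n) x - qe x)"
      proof (rule nrm_cong_AE)
        show "poly (s n) \<in> borel_measurable (MI (T - tau) (T + tau))" by (rule L2_meas[OF poly_L2])
        show "(\<lambda>x. poly (s n) x - qe x) \<in> borel_measurable (MI (T - tau) (T + tau))"
          by (rule L2_meas, rule MI_mono(1)[OF L2_diff[OF poly_L2 qe]]) (use T tau_nonneg in auto)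
        \<comment> \<open>When T = 2 tau the point \<open>tau\<close> lies in the window, and
          \<open>qe\<close> need not vanish there; a single point is null.\<close>
        show "AE x in MI (T - tau) (T + tau). poly (s n) x = poly (s n) x - qe x"
          using AE_MI_neq[of tau] AE_space
          by eventually_elim (use T in \<open>auto simp: qe_def indicator_def space_restrict_space\<close>)
      qed
      also have "\<dots> \<le> e3 n"
        unfolding e3_def by (rule MI_mono(2)[OF L2_diff[OF poly_L2 qe]]) (use T tau_nonneg in auto)
      finally have "C * nrm (MI (T - tau) (T + tau)) (poly (s n)) \<le> C * e3 n"
        using C(1) by (intro mult_left_mono) auto
      then have "C * nrm (MI (T - tau) (T + tau)) (poly (s n)) \<le> d n"
        using dC(1)[of n] by (rule order_trans)
      then show ?thesis
        using h(2)[of "s n"] YT(2)[of n] nrm_diff_ge[OF YT(1) h(1)[of "s n"]] by (simp add: nrm_commute[of U01 YT])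
    qed
    moreover have "(\<lambda>n. d n + d n) \<longlonglongrightarrow> 0" using tendsto_add[OF d0 d0] by simp
    ultimately have "nrm U01 YT \<le> 0" using LIMSEQ_le_const by blast
    then show ?thesis using nrm_eq_0_iff[OF YT(1)] nrm_ge0[of U01 YT] by linarith
  qed
  have T0: "0 \<in> {0..T}" and TT: "T \<in> {0..T}" using T by auto
  show ?thesis
  proof (rule that[OF Y(1) P(1) v(1) d0 Y(2) P(2) v(2)])
    show "AE x in U01. Y 0 x = y0 x"
      by (rule init[where h = "\<lambda>q. yv q 0"]) (use Y[OF T0] y0 yv_L2 yv_diff C(2)[of _ 0] ry in auto)
    show "AE x in U01. P 0 x = p0 x"
      by (rule init[where h = "\<lambda>q. pv q 0"]) (use P[OF T0] p0 pv_L2 pv_diff C(3)[of _ 0] rp in auto)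
    show "AE x in U01. Y T x = 0"
      by (rule final[where h = "\<lambda>q. yv q T"]) (use Y[OF TT] yv_L2 C(2) in auto)
    show "AE x in U01. P T x = 0"
      by (rule final[where h = "\<lambda>q. pv q T"]) (use P[OF TT] pv_L2 C(3) in auto)
  qed
qed

end

section \<open>Test functions, the dual space and weak identities for polynomial solutions\<close>

lemma Pr_lin:
  assumes "integrable U01 f" "integrable U01 g"
  shows "Pr (\<lambda>s. f s + c * g s) x = Pr f x + c * Pr g x"
proof -
  have "Pr (\<lambda>s. f s + c * g s) x = (LINT s|U01. indicator {0..x} s * f s + c * (indicator {0..x} s * g s))"
    unfolding Pr_def by (rule Bochner_Integration.integral_cong) (auto simp: algebra_simps)
  also have "\<dots> = Pr f x + c * Pr g x"
    unfolding Pr_def using assms by (simp add: integrable_indicator_mult)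
  finally show ?thesis .
qed

lemma H01_deriv_iff:
  "H01_deriv \<phi> g \<longleftrightarrow> g \<in> L2 U01 \<and> (\<forall>x\<in>{0..1}. \<phi> x = Pr g x) \<and> \<phi> 1 = 0"
  unfolding H01_deriv_def L2on_iff by (auto simp: Pr_LINT)

lemma H01_deriv_unique:
  assumes "H01_deriv \<phi> g" "H01_deriv \<phi> h"
  shows "AE x in U01. g x = h x"
proof -
  have L: "g \<in> L2 U01" "h \<in> L2 U01" using assms by (auto simp: H01_deriv_iff)
  have "AE x in U01. g x + (- 1) * h x = 0"
  proof (rule Pr_zero_AE)
    show "integrable U01 (\<lambda>x. g x + (- 1) * h x)"
      using L2_integrable[OF L2_diff[OF L]] by simp
    show "Pr (\<lambda>x. g x + (- 1) * h x) x = 0" if "0 \<le> x" "x \<le> 1" for x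
      unfolding Pr_lin[OF L2_integrable[OF L(1)] L2_integrable[OF L(2)]]
      using assms that by (auto simp: H01_deriv_iff)
  qed
  then show ?thesis by eventually_elim simp
qed

lemma H01_deriv_lin:
  assumes "H01_deriv \<phi> g" "H01_deriv \<psi> h"
  shows "H01_deriv (\<lambda>x. \<phi> x + c * \<psi> x) (\<lambda>x. g x + c * h x)"
  using assms Pr_lin[OF L2_integrable[of g] L2_integrable[of h], of c]
  by (auto simp: H01_deriv_iff intro!: L2_add L2_scale)

lemma H01_deriv_integral: "H01_deriv \<phi> g \<Longrightarrow> (LINT x|U01. g x) = 0"
  by (auto simp: H01_deriv_iff Pr_1[symmetric])

text \<open>One choice of weak derivative, total in \<open>\<phi>\<close>; pairings do not depend on
  the choice by \<open>ip_dl\<close>.\<close>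

definition dl :: "(real \<Rightarrow> real) \<Rightarrow> real \<Rightarrow> real" where
  "dl \<phi> = (SOME g. H01_deriv \<phi> g)"

lemma dl: "H01 \<phi> \<Longrightarrow> H01_deriv \<phi> (dl \<phi>)"
  using someI_ex[of "H01_deriv \<phi>"] by (simp add: dl_def H01_def)

lemma ip_dl:
  assumes "H01_deriv \<phi> g" "p \<in> L2 U01"
  shows "(LINT x|U01. p x * dl \<phi> x) = (LINT x|U01. p x * g x)"
proof -
  have d: "H01_deriv \<phi> (dl \<phi>)" using assms(1) by (intro dl) (auto simp: H01_def)
  then have L: "dl \<phi> \<in> L2 U01" "g \<in> L2 U01" using assms(1) by (auto simp: H01_deriv_iff)
  show ?thesis
    using H01_deriv_unique[OF d assms(1)] L2_mult[OF assms(2) L(1)] L2_mult[OF assms(2) L(2)]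
    by (intro integral_cong_AE) (auto elim: eventually_mono)
qed

lemma sqrt_LINT_nrm: "sqrt (LINT x:{0..1}|lborel. (g x)\<^sup>2) = nrm U01 g"
  by (simp add: nrm_def LINT_MI)

text \<open>Riesz representation of \<open>l\<close> composed with \<open>Pr\<close> on the
  derivatives of H^1_0 functions. The sign makes \<open>l\<close> the distributional derivative of
  \<open>p\<close>, matching y' = p_x.\<close>

lemma Hm1_repr:
  assumes l: "Hm1 l"
  obtains p where "p \<in> L2 U01" "\<And>\<phi> g. H01_deriv \<phi> g \<Longrightarrow> l \<phi> = - (LINT x|U01. p x * g x)"
proof -
  obtain C where C: "\<And>\<phi> g. H01_deriv \<phi> g \<Longrightarrow> \<bar>l \<phi>\<bar> \<le> C * nrm U01 g"
    using l unfolding Hm1_def sqrt_LINT_nrm by blast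
  have lin: "l (\<lambda>x. \<phi> x + c * \<psi> x) = l \<phi> + c * l \<psi>" if "H01_deriv \<phi> g" "H01_deriv \<psi> h" for \<phi> \<psi> g h c
  proof -
    have z: "H01_deriv (\<lambda>_. 0) (\<lambda>_. 0)" by (auto simp: H01_deriv_iff L2_zero Pr_def)
    have "H01 \<phi>" "H01 \<psi>" "H01 (\<lambda>x. c * \<psi> x)"
      using that H01_deriv_lin[OF z that(2), of c] by (auto simp: H01_def)
    then show ?thesis using l unfolding Hm1_def by metis
  qed
  define W where "W = {g. H01_deriv (Pr g) g}"
  have W: "H01_deriv (Pr g) g" if "g \<in> W" for g using that by (simp add: W_def)
  have Pl: "Pr (\<lambda>x. f x + c * g x) = (\<lambda>x. Pr f x + c * Pr g x)" if "f \<in> W" "g \<in> W" for f g c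
    using W[OF that(1)] W[OF that(2)] Pr_lin[OF L2_integrable[of f] L2_integrable[of g], of c]
    by (auto simp: H01_deriv_iff)
  have "\<exists>p\<in>L2 U01. \<exists>f. (\<forall>n::nat. f n \<in> W) \<and> (\<lambda>n. nrm U01 (\<lambda>x. f n x - p x)) \<longlonglongrightarrow> 0 \<and>
           (\<forall>g\<in>W. l (Pr g) = (LINT x|U01. p x * g x))"
  proof (rule L2_Riesz_subspace[OF finite_MI])
    show "W \<subseteq> L2 U01" by (auto simp: W_def H01_deriv_iff)
    show "(\<lambda>x. 0) \<in> W" by (auto simp: W_def H01_deriv_iff L2_zero Pr_def)
    show "(\<lambda>x. f x + c * g x) \<in> W" if "f \<in> W" "g \<in> W" for f g c
      using H01_deriv_lin[OF W[OF that(1)] W[OF that(2)], of c] Pl[OF that, of c] by (simp add: W_def)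
    show "l (Pr (\<lambda>x. f x + c * g x)) = l (Pr f) + c * l (Pr g)" if "f \<in> W" "g \<in> W" for f g c
      unfolding Pl[OF that] by (rule lin[OF W[OF that(1)] W[OF that(2)]])
    show "\<bar>l (Pr f)\<bar> \<le> C * nrm U01 f" if "f \<in> W" for f by (rule C[OF W[OF that]])
  qed
  then obtain p where p: "p \<in> L2 U01" "\<And>g. g \<in> W \<Longrightarrow> l (Pr g) = (LINT x|U01. p x * g x)" by blast
  have "l \<phi> = - (LINT x|U01. - p x * g x)" if \<phi>: "H01_deriv \<phi> g" for \<phi> g
  proof -
    have gW: "g \<in> W" using \<phi> by (auto simp: W_def H01_deriv_iff)
    \<comment> \<open>\<open>\<phi>\<close> and \<open>Pr g\<close> agree on [0,1] only. Their
      difference has derivative zero, so the norm bound makes \<open>l\<close> vanish on it: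
      \<open>l\<close> does not see values outside the interval.\<close>
    have "H01_deriv (\<lambda>x. \<phi> x + (- 1) * Pr g x) (\<lambda>_. 0)"
      using \<phi> by (auto simp: H01_deriv_iff L2_zero Pr_def[of "\<lambda>_. 0"])
    from C[OF this] have "l (\<lambda>x. \<phi> x + (- 1) * Pr g x) = 0" by (simp add: nrm_def)
    then have "l \<phi> = l (Pr g)" using lin[OF \<phi> W[OF gW], of "- 1"] by simp
    then show ?thesis using p(2)[OF gW] by simp
  qed
  then show ?thesis using that[OF L2_uminus[OF p(1)]] by blast
qed

text \<open>For fixed \<open>f\<close> the pairing is a polynomial in \<open>t\<close> whose
  coefficients are the moments \<open>m i\<close>.\<close>

lemma poly_ip_deriv:
  assumes p: "pcont p" and f: "integrable U01 f"
  shows "((\<lambda>t. \<integral>x. poly (p x) t * f x \<partial>U01) has_real_derivative (LINT x|U01. poly (pderiv (p x)) t * f x)) (at t)"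
proof -
  obtain n where n: "\<And>z. degree (p z) \<le> n" using p by (auto simp: pcont_def)
  define m where "m i = (LINT x|U01. coeff (p x) i * f x)" for i
  have i: "integrable U01 (\<lambda>x. coeff (p x) i * f x)" for i
    using p by (intro integrable_continuous_mult[OF f]) (auto simp: pcont_def)
  have pd: "poly (pderiv (p x)) t = (\<Sum>i\<le>n. coeff (p x) i * (real i * t ^ (i - 1)))" for x t
  proof (rule DERIV_unique[OF poly_DERIV])
    show "(poly (p x) has_real_derivative (\<Sum>i\<le>n. coeff (p x) i * (real i * t ^ (i - 1)))) (at t)"
      unfolding poly_sum_upto[OF n, abs_def]
      by (intro DERIV_sum DERIV_cmult) (use DERIV_pow in auto)
  qed
  have int: "(LINT x|U01. (\<Sum>i\<le>n. coeff (p x) i * c i) * f x) = (\<Sum>i\<le>n. m i * c i)" for c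
  proof -
    have "(LINT x|U01. (\<Sum>i\<le>n. coeff (p x) i * c i) * f x) = (LINT x|U01. (\<Sum>i\<le>n. coeff (p x) i * f x * c i))"
      by (intro Bochner_Integration.integral_cong refl) (simp add: sum_distrib_left sum_distrib_right mult_ac)
    also have "\<dots> = (\<Sum>i\<le>n. m i * c i)"
      unfolding m_def using i by (subst Bochner_Integration.integral_sum) auto
    finally show ?thesis .
  qed
  show ?thesis
    unfolding pd int unfolding poly_sum_upto[OF n] int
    by (intro DERIV_sum DERIV_cmult) (use DERIV_pow in auto)
qed

text \<open>Expanding the square leaves pairings that are polynomials in the time variable, hence
  continuous.\<close>

lemma poly_nrm_cont:
  assumes p: "pcont p"
  shows "((\<lambda>s. nrm U01 (\<lambda>x. poly (p x) s - poly (p x) t)) \<longlongrightarrow> 0) (at t)"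
proof -
  have L: "(\<lambda>x. poly (p x) s) \<in> L2 U01" for s
    by (intro continuous_L2 pcont_poly[OF p] continuous_on_const)
  have c1: "isCont (\<lambda>s. \<integral>x. poly (p x * p x) s * 1 \<partial>U01) t"
    by (rule DERIV_isCont[OF poly_ip_deriv[OF pcont_mult[OF p p]]]) simp
  have c2: "isCont (\<lambda>s. \<integral>x. poly (p x) s * poly (p x) t \<partial>U01) t"
    by (rule DERIV_isCont[OF poly_ip_deriv[OF p L2_integrable[OF L]]])
  have eq: "(nrm U01 (\<lambda>x. poly (p x) s - poly (p x) t))\<^sup>2
      = (LINT x|U01. poly (p x * p x) s * 1) - 2 * (LINT x|U01. poly (p x) s * poly (p x) t) + (nrm U01 (\<lambda>x. poly (p x) t))\<^sup>2" for s
  proof -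
    have "(nrm U01 (\<lambda>x. poly (p x) s))\<^sup>2 = (LINT x|U01. poly (p x * p x) s * 1)"
      unfolding nrm_sq by (simp add: power2_eq_square)
    then show ?thesis using nrm_sq_add[OF L[of s] L[of t], of "- 1"] by simp
  qed
  have "isCont (\<lambda>s. (nrm U01 (\<lambda>x. poly (p x) s - poly (p x) t))\<^sup>2) t"
    unfolding eq by (intro continuous_intros c1 c2)
  then have "((\<lambda>s. sqrt ((nrm U01 (\<lambda>x. poly (p x) s - poly (p x) t))\<^sup>2)) \<longlongrightarrow> sqrt ((nrm U01 (\<lambda>x. poly (p x) t - poly (p x) t))\<^sup>2)) (at t)"
    unfolding isCont_def by (rule tendsto_real_sqrt)
  then show ?thesis by (simp add: nrm_def)
qed

lemma Tl_sum:
  assumes "\<And>j. j \<in> J \<Longrightarrow> integrable U01 (f j)"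
  shows "Tl (\<lambda>s. \<Sum>j\<in>J. f j s * c j) x = (\<Sum>j\<in>J. Tl (f j) x * c j)"
proof -
  have "Tl (\<lambda>s. \<Sum>j\<in>J. f j s * c j) x = (LINT s|U01. (\<Sum>j\<in>J. (indicator {x..1} s * f j s) * c j))"
    unfolding Tl_def by (rule Bochner_Integration.integral_cong) (auto simp: sum_distrib_left mult.assoc)
  also have "\<dots> = (\<Sum>j\<in>J. Tl (f j) x * c j)"
    unfolding Tl_def using assms by (subst Bochner_Integration.integral_sum) (auto intro!: integrable_indicator_mult)
  finally show ?thesis .
qed

context wave_coeff
begin

text \<open>p_x = y_t integrated from the side x = 1, where p = q.\<close>

lemma pv_Tl: "pv q t x = poly q t - Tl (yv (pderiv q) t) x"
proof -
  define c where "c j = poly ((pderiv ^^ (2 * Suc j)) q) t" for j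
  have "PP q x = expn cA 0 (Suc (degree q)) q x" by (rule PP_upto) simp
  also have "\<dots> = q + (\<Sum>j\<le>degree q. smult (cA (Suc j) x) ((pderiv ^^ (2 * Suc j)) q))"
    unfolding expn_def by (subst sum.atMost_Suc_shift) simp
  finally have "pv q t x = poly q t + (\<Sum>j\<le>degree q. cA (Suc j) x * c j)"
    unfolding pv_def c_def by (simp add: poly_sum del: cA.simps funpow.simps)
  also have "(\<Sum>j\<le>degree q. cA (Suc j) x * c j) = - (\<Sum>j\<le>degree q. Tl (cB j) x * c j)"
    by (simp add: sum_negf)
  also have "(\<Sum>j\<le>degree q. Tl (cB j) x * c j) = Tl (\<lambda>s. \<Sum>j\<le>degree q. cB j s * c j) x"
    by (rule Tl_sum[symmetric]) (intro integrable_continuous_MI cB_cont)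
  also have "(\<lambda>s. \<Sum>j\<le>degree q. cB j s * c j) = yv (pderiv q) t"
  proof
    fix s
    have "yv (pderiv q) t s = poly (pderiv (YY q s)) t" by (simp add: yv_def pderiv_YY)
    then show "(\<Sum>j\<le>degree q. cB j s * c j) = yv (pderiv q) t s"
      by (simp add: YY_def expn_def c_def poly_sum pderiv_sum_poly pderiv_smult)
  qed
  finally show ?thesis by simp
qed

lemma yv_Tl: "yv q t x = - Tl (\<lambda>s. b s * pv (pderiv q) t s) x"
proof -
  define c where "c j = poly ((pderiv ^^ (2 * j + 1)) q) t" for j
  have "yv q t x = (\<Sum>j\<le>degree q. cB j x * c j)"
    unfolding yv_def YY_def expn_def c_def by (simp add: poly_sum del: funpow.simps)
  also have "\<dots> = - (\<Sum>j\<le>degree q. Tl (\<lambda>s. b s * cA j s) x * c j)"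
    by (simp add: cB.simps sum_negf)
  also have "(\<Sum>j\<le>degree q. Tl (\<lambda>s. b s * cA j s) x * c j) = Tl (\<lambda>s. \<Sum>j\<le>degree q. b s * cA j s * c j) x"
    by (rule Tl_sum[symmetric]) (intro b_int_cont cA_cont)
  also have "(\<lambda>s. \<Sum>j\<le>degree q. b s * cA j s * c j) = (\<lambda>s. b s * pv (pderiv q) t s)"
  proof
    fix s
    have "pv (pderiv q) t s = poly (pderiv (PP q s)) t" by (simp add: pv_def pderiv_PP)
    then show "(\<Sum>j\<le>degree q. b s * cA j s * c j) = b s * pv (pderiv q) t s"
      by (simp add: PP_def expn_def c_def poly_sum pderiv_sum_poly pderiv_smult sum_distrib_left mult.assoc)
  qed
  finally show ?thesis .
qed

lemma yv_ip_deriv: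
  assumes "integrable U01 f"
  shows "((\<lambda>t. \<integral>x. yv q t x * f x \<partial>U01) has_real_derivative (LINT x|U01. yv (pderiv q) t x * f x)) (at t)"
  using poly_ip_deriv[OF YY_pcont assms, of q t] by (simp add: yv_def pderiv_YY)

lemma pv_ip_deriv:
  assumes "integrable U01 f"
  shows "((\<lambda>t. \<integral>x. pv q t x * f x \<partial>U01) has_real_derivative (LINT x|U01. pv (pderiv q) t x * f x)) (at t)"
  using poly_ip_deriv[OF PP_pcont assms, of q t] by (simp add: pv_def pderiv_PP)

text \<open>The weak form of y_t = p_x. By \<open>pv_Tl\<close> and Fubini it remains to drop the
  x-independent part \<open>poly q t\<close>, which is orthogonal to \<open>g\<close> because
  \<open>\<phi>\<close> vanishes at both ends.\<close>

lemma yv_H01: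
  assumes "H01_deriv \<phi> g"
  shows "(LINT x|U01. yv (pderiv q) t x * \<phi> x) = - (LINT x|U01. pv q t x * g x)"
proof -
  have g: "g \<in> L2 U01" and \<phi>: "\<And>x. x \<in> {0..1} \<Longrightarrow> \<phi> x = Pr g x" using assms by (auto simp: H01_deriv_iff)
  note gi = L2_integrable[OF g] and yi = L2_integrable[OF yv_L2]
  have "(LINT x|U01. pv q t x * g x) = (LINT x|U01. poly q t * g x - g x * Tl (yv (pderiv q) t) x)"
    by (simp add: pv_Tl algebra_simps)
  also have "\<dots> = poly q t * (LINT x|U01. g x) - (LINT x|U01. g x * Tl (yv (pderiv q) t) x)"
    using gi L2_mult[OF g continuous_L2[OF Tl_cont[OF yi[of "pderiv q" t]]]] by simp
  also have "(LINT x|U01. g x * Tl (yv (pderiv q) t) x) = (LINT x|U01. yv (pderiv q) t x * Pr g x)"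
    by (rule swap_Tl_Pr[OF gi yi])
  also have "\<dots> = (LINT x|U01. yv (pderiv q) t x * \<phi> x)"
    by (rule ip_cong_U01) (simp add: \<phi>)
  finally show ?thesis using H01_deriv_integral[OF assms] by simp
qed

text \<open>Here the boundary value through which the control acts appears: \<open>g\<close> is
  \<open>b\<close> times the flux c + Pr k, and the integral of b p_t = y_x over (0,1) is minus y at
  x = 0, as y = 0 at x = 1.\<close>

lemma pv_domA:
  assumes k: "k \<in> L2 U01" and g: "g \<in> L2 U01" and eq: "AE x in U01. g x = b x * (c + Pr k x)"
  shows "- (LINT x|U01. pv (pderiv q) t x * g x) = (LINT x|U01. yv q t x * k x) + yv q t 0 * c"
proof -
  note ki = L2_integrable[OF k]
  let ?p = "pv (pderiv q) t"
  let ?h = "\<lambda>x. b x * ?p x"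
  have hi: "integrable U01 ?h" by (rule b_int_cont[OF pv_cont])
  have hP: "integrable U01 (\<lambda>x. Pr k x * ?h x)" by (rule integrable_continuous_mult[OF hi Pr_cont[OF ki]])
  have "(LINT x|U01. ?p x * g x) = (LINT x|U01. c * ?h x + Pr k x * ?h x)"
    using eq L2_mult[OF pv_L2 g] hi hP
    by (intro integral_cong_AE) (auto elim!: eventually_mono simp: algebra_simps)
  also have "\<dots> = c * (LINT x|U01. ?h x) + (LINT x|U01. Pr k x * ?h x)" using hi hP by simp
  also have "(LINT x|U01. ?h x) = - yv q t 0" using Tl_0[OF hi] by (simp add: yv_Tl)
  also have "(LINT x|U01. Pr k x * ?h x) = (LINT x|U01. k x * Tl ?h x)"
    using swap_Tl_Pr[OF ki hi] by (simp add: mult.commute)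
  also have "\<dots> = - (LINT x|U01. yv q t x * k x)" by (simp add: yv_Tl mult.commute)
  finally show ?thesis by simp
qed

end

section \<open>Weak solutions and uniqueness\<close>

lemma measure_MI: "u \<le> w \<Longrightarrow> measure (MI u w) (space (MI u w)) = w - u"
  by (simp add: space_restrict_space measure_restrict_space)

lemma integral_bound_MI:
  fixes f :: "real \<Rightarrow> real"
  assumes uw: "u \<le> w" and f: "f \<in> borel_measurable (MI u w)" and K: "\<And>x. x \<in> {u..w} \<Longrightarrow> \<bar>f x\<bar> \<le> K"
  shows "\<bar>\<integral>x. f x \<partial>MI u w\<bar> \<le> K * (w - u)" and "nrm (MI u w) f \<le> K * sqrt (w - u)"
proof -
  have f1: "integrable (MI u w) f"
    using integrable_bounded_mult[OF integrable_const_MI[where c=1] f, of K] K by (simp add: space_restrict_space)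
  have K0: "0 \<le> K" using K[of u] uw by auto
  have "\<bar>\<integral>x. f x \<partial>MI u w\<bar> \<le> (LINT x|MI u w. \<bar>f x\<bar>)" by (rule integral_abs_bound)
  also have "\<dots> \<le> (LINT x|MI u w. K)" by (rule integral_mono) (use f1 K in \<open>auto simp: space_restrict_space\<close>)
  also have "\<dots> = K * (w - u)" using measure_MI[OF uw] by simp
  finally show "\<bar>\<integral>x. f x \<partial>MI u w\<bar> \<le> K * (w - u)" .
  have sq: "(f x)\<^sup>2 \<le> K\<^sup>2" if "x \<in> {u..w}" for x using power_mono[OF K[OF that], of 2] by simp
  have i2: "integrable (MI u w) (\<lambda>x. (f x)\<^sup>2)"
    using integrable_bounded_mult[OF f1 f, of K] K by (simp add: power2_eq_square space_restrict_space)
  have "(LINT x|MI u w. (f x)\<^sup>2) \<le> (LINT x|MI u w. K\<^sup>2)"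
    by (rule integral_mono) (use i2 sq in \<open>auto simp: space_restrict_space\<close>)
  also have "\<dots> = (K * sqrt (w - u))\<^sup>2" using measure_MI[OF uw] uw by (simp add: power_mult_distrib)
  finally show "nrm (MI u w) f \<le> K * sqrt (w - u)"
    unfolding nrm_def using K0 uw by (intro real_le_lsqrt) auto
qed

text \<open>Three-term estimate: the limit is uniform on \<open>S\<close>, and each approximant is
  continuous in norm.\<close>

lemma uniform_limit_nrm_cont:
  assumes F: "\<And>n t. F n t \<in> L2 M" and Y: "\<And>t. t \<in> S \<Longrightarrow> Y t \<in> L2 M"
    and Yd: "\<And>n t. t \<in> S \<Longrightarrow> nrm M (\<lambda>x. F n t x - Y t x) \<le> d n" and d0: "d \<longlonglongrightarrow> 0"
    and Fc: "\<And>n t. ((\<lambda>s. nrm M (\<lambda>x. F n s x - F n t x)) \<longlongrightarrow> 0) (at (t::real))"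
    and t: "t \<in> S" and e: "(0::real) < e"
  shows "\<exists>\<delta>>0. \<forall>s\<in>S. \<bar>s - t\<bar> < \<delta> \<longrightarrow> nrm M (\<lambda>x. Y s x - Y t x) < e"
proof -
  obtain n where n: "\<bar>d n\<bar> < e / 3" using LIMSEQ_D[OF d0, of "e/3"] e by auto
  obtain \<delta> where \<delta>: "\<delta> > 0" "\<And>s. s \<noteq> t \<Longrightarrow> \<bar>s - t\<bar> < \<delta> \<Longrightarrow> nrm M (\<lambda>x. F n s x - F n t x) < e / 3"
    using LIM_D[OF Fc[of n t], of "e/3"] e by auto
  have "nrm M (\<lambda>x. Y s x - Y t x) < e" if s: "s \<in> S" "\<bar>s - t\<bar> < \<delta>" for s
  proof (cases "s = t")
    case False
    have "nrm M (\<lambda>x. Y s x - Y t x) \<le> nrm M (\<lambda>x. Y s x - F n s x) + nrm M (\<lambda>x. F n s x - Y t x)"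
      by (rule nrm_triangle_diff[OF Y[OF s(1)] F Y[OF t]])
    also have "nrm M (\<lambda>x. F n s x - Y t x) \<le> nrm M (\<lambda>x. F n s x - F n t x) + nrm M (\<lambda>x. F n t x - Y t x)"
      by (rule nrm_triangle_diff[OF F F Y[OF t]])
    finally show ?thesis
      using Yd[OF s(1), of n] Yd[OF t, of n] \<delta>(2)[OF False s(2)] n by (simp add: nrm_commute[of M "Y s"])
  qed (use e in \<open>simp add: nrm_def\<close>)
  then show ?thesis using \<delta>(1) by blast
qed

lemma ip_cont_on:
  assumes Y: "\<And>t. t \<in> S \<Longrightarrow> Y t \<in> L2 M" and f: "f \<in> L2 M"
    and c: "\<And>t e. t \<in> S \<Longrightarrow> (0::real) < e \<Longrightarrow> \<exists>\<delta>>0. \<forall>s\<in>S. \<bar>s - t\<bar> < \<delta> \<longrightarrow> nrm M (\<lambda>x. Y s x - Y t x) < e"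
  shows "continuous_on (S :: real set) (\<lambda>t. \<integral>x. Y t x * f x \<partial>M)"
  unfolding continuous_on_iff dist_real_def
proof (intro ballI allI impI)
  fix t e :: real assume t: "t \<in> S" and e: "0 < e"
  define k where "k = nrm M f + 1"
  have k: "k > 0" unfolding k_def by (rule add_nonneg_pos[OF nrm_ge0 zero_less_one])
  obtain \<delta> where \<delta>: "\<delta> > 0" "\<And>s. s \<in> S \<Longrightarrow> \<bar>s - t\<bar> < \<delta> \<Longrightarrow> nrm M (\<lambda>x. Y s x - Y t x) < e / k"
    using c[OF t, of "e / k"] e k by auto
  have "\<bar>(LINT x|M. Y s x * f x) - (LINT x|M. Y t x * f x)\<bar> < e" if s: "s \<in> S" "\<bar>s - t\<bar> < \<delta>" for s
  proof -
    have "\<bar>(LINT x|M. Y s x * f x) - (LINT x|M. Y t x * f x)\<bar> \<le> nrm M (\<lambda>x. Y s x - Y t x) * nrm M f"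
      by (rule ip_diff_bound[OF Y[OF s(1)] Y[OF t] f])
    also have "\<dots> \<le> nrm M (\<lambda>x. Y s x - Y t x) * k" by (intro mult_left_mono) (auto simp: k_def)
    also have "\<dots> < e" using \<delta>(2)[OF s] k by (simp add: pos_less_divide_eq)
    finally show ?thesis .
  qed
  then show "\<exists>\<delta>>0. \<forall>s\<in>S. \<bar>s - t\<bar> < \<delta> \<longrightarrow> \<bar>(LINT x|M. Y s x * f x) - (LINT x|M. Y t x * f x)\<bar> < e"
    using \<delta>(1) by blast
qed

lemma H01_L2:
  assumes "H01_deriv \<phi> g"
  shows "\<phi> \<in> L2 U01"
proof -
  have "continuous_on {0..1} \<phi>"
    using assms Pr_cont[OF L2_integrable, of g] by (subst continuous_on_cong[of _ _ _ "Pr g"]) (auto simp: H01_deriv_iff)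
  then show ?thesis by (rule continuous_L2)
qed

lemma L2_to_Hm1_quotient:
  assumes "f \<in> L2 U01" "g \<in> L2 U01" "\<phi> \<in> L2 U01"
  shows "L2_to_Hm1 (\<lambda>x. (f x - g x) / r) \<phi> = ((LINT x|U01. f x * \<phi> x) - (LINT x|U01. g x * \<phi> x)) / r"
proof -
  have "L2_to_Hm1 (\<lambda>x. (f x - g x) / r) \<phi> = (LINT x|U01. (f x * \<phi> x - g x * \<phi> x) / r)"
    by (simp add: L2_to_Hm1_def LINT_MI left_diff_distrib)
  then show ?thesis using L2_mult[OF assms(1,3)] L2_mult[OF assms(2,3)] by simp
qed

section \<open>The limit of polynomial solutions is a weak solution\<close>

locale wave_limit = wave_coeff +
  fixes a :: "real \<Rightarrow> real" and T :: real and s :: "nat \<Rightarrow> real poly" and Y P :: "real \<Rightarrow> real \<Rightarrow> real"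
    and v :: "real \<Rightarrow> real" and d :: "nat \<Rightarrow> real"
  assumes ab: "\<And>x. 0 < x \<Longrightarrow> x < 1 \<Longrightarrow> a x * b x = 1" and T: "0 < T"
    and YL: "\<And>t. t \<in> {0..T} \<Longrightarrow> Y t \<in> L2 U01" and PL: "\<And>t. t \<in> {0..T} \<Longrightarrow> P t \<in> L2 U01"
    and vL: "v \<in> L2 (MI 0 T)" and d0: "d \<longlonglongrightarrow> 0"
    and Yd: "\<And>n t. t \<in> {0..T} \<Longrightarrow> nrm U01 (\<lambda>x. yv (s n) t x - Y t x) \<le> d n"
    and Pd: "\<And>n t. t \<in> {0..T} \<Longrightarrow> nrm U01 (\<lambda>x. pv (s n) t x - P t x) \<le> d n"
    and vd: "\<And>n. nrm (MI 0 T) (\<lambda>t. yv (s n) t 0 - v t) \<le> d n"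
begin

text \<open>The candidate for y'(t): the distributional x-derivative of \<open>P t\<close>.\<close>

definition wf :: "real \<Rightarrow> (real \<Rightarrow> real) \<Rightarrow> real" where
  "wf t \<phi> = - (LINT x|U01. P t x * dl \<phi> x)"

lemma wf_eq:
  assumes "H01_deriv \<phi> g" "t \<in> {0..T}"
  shows "wf t \<phi> = - (LINT x|U01. P t x * g x)"
  unfolding wf_def using ip_dl[OF assms(1) PL[OF assms(2)]] by simp

lemma Y_cont:
  assumes "t \<in> {0..T}" "0 < e"
  shows "\<exists>\<delta>>0. \<forall>s\<in>{0..T}. \<bar>s - t\<bar> < \<delta> \<longrightarrow> nrm U01 (\<lambda>x. Y s x - Y t x) < e"
  by (rule uniform_limit_nrm_cont[where F = "\<lambda>n. yv (s n)" and d = d])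
    (use yv_L2 YL Yd d0 assms poly_nrm_cont[OF YY_pcont] in \<open>auto simp: yv_def\<close>)

lemma P_cont:
  assumes "t \<in> {0..T}" "0 < e"
  shows "\<exists>\<delta>>0. \<forall>s\<in>{0..T}. \<bar>s - t\<bar> < \<delta> \<longrightarrow> nrm U01 (\<lambda>x. P s x - P t x) < e"
  by (rule uniform_limit_nrm_cont[where F = "\<lambda>n. pv (s n)" and d = d])
    (use pv_L2 PL Pd d0 assms poly_nrm_cont[OF PP_pcont] in \<open>auto simp: pv_def\<close>)

lemma d_nrm_tendsto:
  assumes "\<And>n. nrm M (f n) \<le> d n"
  shows "(\<lambda>n. nrm M (f n)) \<longlonglongrightarrow> 0"
  by (rule Lim_null_comparison[OF _ d0]) (use assms in \<open>auto intro!: always_eventually\<close>)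

lemma Y_ip: "t \<in> {0..T} \<Longrightarrow> f \<in> L2 U01 \<Longrightarrow> (\<lambda>n. \<integral>x. yv (s n) t x * f x \<partial>U01) \<longlonglongrightarrow> (LINT x|U01. Y t x * f x)"
  by (rule ip_tendsto[OF yv_L2 YL _ d_nrm_tendsto[OF Yd]])

lemma P_ip: "t \<in> {0..T} \<Longrightarrow> f \<in> L2 U01 \<Longrightarrow> (\<lambda>n. \<integral>x. pv (s n) t x * f x \<partial>U01) \<longlonglongrightarrow> (LINT x|U01. P t x * f x)"
  by (rule ip_tendsto[OF pv_L2 PL _ d_nrm_tendsto[OF Pd]])

text \<open>The difference quotient of the pairing with y equals minus the pairing of
  \<open>g\<close> with p at an intermediate time, which involves only quantities that converge
  uniformly in time.\<close>

lemma yv_mvt: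
  assumes \<phi>: "H01_deriv \<phi> g" and "s' \<noteq> t"
  shows "\<exists>\<xi>. \<bar>\<xi> - t\<bar> \<le> \<bar>s' - t\<bar> \<and> min s' t \<le> \<xi> \<and> \<xi> \<le> max s' t \<and>
    (LINT x|U01. yv q s' x * \<phi> x) - (LINT x|U01. yv q t x * \<phi> x) = (s' - t) * - (LINT x|U01. pv q \<xi> x * g x)"
proof -
  let ?f = "\<lambda>t. \<integral>x. yv q t x * \<phi> x \<partial>U01"
  have D: "(?f has_real_derivative - (LINT x|U01. pv q u x * g x)) (at u)" for u
    using yv_ip_deriv[OF L2_integrable[OF H01_L2[OF \<phi>]], of q u] yv_H01[OF \<phi>, of q u] by simp
  show ?thesis
  proof (cases "t < s'")
    case True
    from MVT2[OF this D] obtain \<xi> where "t < \<xi>" "\<xi> < s'" "?f s' - ?f t = (s' - t) * - (LINT x|U01. pv q \<xi> x * g x)" by auto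
    then show ?thesis by (intro exI[of _ \<xi>]) auto
  next
    case False
    then have "s' < t" using assms by simp
    from MVT2[OF this D] obtain \<xi> where "s' < \<xi>" "\<xi> < t" "?f t - ?f s' = (t - s') * - (LINT x|U01. pv q \<xi> x * g x)" by auto
    then show ?thesis by (intro exI[of _ \<xi>]) (auto simp: algebra_simps)
  qed
qed

text \<open>The intermediate time lies between \<open>t\<close> and \<open>s'\<close>, where
  \<open>P\<close> is within \<open>e\<close> of \<open>P t\<close>. The bound depends on
  \<open>\<phi>\<close> only through the norm of \<open>g\<close>, and this is what
  differentiability in H^-1 asks for.\<close>

lemma quotient_close:
  assumes \<phi>: "H01_deriv \<phi> g" and t: "t \<in> {0..T}" and s': "s' \<in> {0..T}" "s' \<noteq> t"
    and e: "\<And>r. r \<in> {0..T} \<Longrightarrow> \<bar>r - t\<bar> \<le> \<bar>s' - t\<bar> \<Longrightarrow> nrm U01 (\<lambda>x. P r x - P t x) \<le> e"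
  shows "\<bar>((LINT x|U01. Y s' x * \<phi> x) - (LINT x|U01. Y t x * \<phi> x)) / (s' - t) - wf t \<phi>\<bar> \<le> e * nrm U01 g"
proof (rule LIMSEQ_le)
  have g: "g \<in> L2 U01" using \<phi> by (simp add: H01_deriv_iff)
  note \<phi>L = H01_L2[OF \<phi>]
  let ?I = "\<lambda>n r. \<integral>x. yv (s n) r x * \<phi> x \<partial>U01"
  show "(\<lambda>n. \<bar>(?I n s' - ?I n t) / (s' - t) - wf t \<phi>\<bar>)
     \<longlonglongrightarrow> \<bar>((LINT x|U01. Y s' x * \<phi> x) - (LINT x|U01. Y t x * \<phi> x)) / (s' - t) - wf t \<phi>\<bar>"
    using s' by (intro tendsto_intros Y_ip \<phi>L t) auto
  have "(\<lambda>n. (d n + e) * nrm U01 g) \<longlonglongrightarrow> (0 + e) * nrm U01 g"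
    by (intro tendsto_intros d0)
  then show "(\<lambda>n. (d n + e) * nrm U01 g) \<longlonglongrightarrow> e * nrm U01 g" by simp
  have "\<bar>(?I n s' - ?I n t) / (s' - t) - wf t \<phi>\<bar> \<le> (d n + e) * nrm U01 g" for n
  proof -
    obtain \<xi> where \<xi>: "\<bar>\<xi> - t\<bar> \<le> \<bar>s' - t\<bar>" "min s' t \<le> \<xi>" "\<xi> \<le> max s' t"
      and eq: "?I n s' - ?I n t = (s' - t) * - (LINT x|U01. pv (s n) \<xi> x * g x)"
      using yv_mvt[OF \<phi> s'(2), of "s n"] by blast
    have \<xi>T: "\<xi> \<in> {0..T}" using \<xi>(2,3) t s'(1) by auto
    have "\<bar>(?I n s' - ?I n t) / (s' - t) - wf t \<phi>\<bar> = \<bar>(LINT x|U01. pv (s n) \<xi> x * g x) - (LINT x|U01. P t x * g x)\<bar>"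
      unfolding eq wf_eq[OF \<phi> t] using s'(2) by simp
    also have "\<dots> \<le> nrm U01 (\<lambda>x. pv (s n) \<xi> x - P t x) * nrm U01 g"
      by (rule ip_diff_bound[OF pv_L2 PL[OF t] g])
    also have "\<dots> \<le> (d n + e) * nrm U01 g"
      using nrm_triangle_diff[OF pv_L2[of "s n" \<xi>] PL[OF \<xi>T] PL[OF t]] Pd[OF \<xi>T, of n] e[OF \<xi>T \<xi>(1)]
      by (intro mult_right_mono) auto
    finally show ?thesis .
  qed
  then show "\<exists>N. \<forall>n\<ge>N. \<bar>(?I n s' - ?I n t) / (s' - t) - wf t \<phi>\<bar> \<le> (d n + e) * nrm U01 g" by blast
qed

text \<open>For \<open>s n\<close> this is the fundamental theorem of calculus applied to the
  pairing of p with \<open>g\<close>. In the limit the interior term converges uniformly in time and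
  the trace in L^2(0,t), so the time integral converges.\<close>

lemma weak_equation:
  assumes dom: "domA a \<phi> c k" and t: "t \<in> {0..T}"
  shows "wf t \<phi> - wf 0 \<phi> = (LINT r|MI 0 t. (LINT x|U01. Y r x * k x) + v r * c)"
proof -
  have t0: "0 \<le> t" "t \<le> T" and T0: "0 \<in> {0..T}" using t by auto
  obtain g where \<phi>: "H01_deriv \<phi> g" and k: "k \<in> L2 U01"
    and ag: "AE x in lborel. x \<in> {0..1} \<longrightarrow> a x * g x = c + (LINT s:{0..x}|lborel. k s)"
    using dom unfolding domA_def L2on_iff by blast
  have g: "g \<in> L2 U01" using \<phi> by (simp add: H01_deriv_iff)
  \<comment> \<open>a * b = 1 is available on the open interval; the endpoints are discarded as null
    sets.\<close>
  have gb: "AE x in U01. g x = b x * (c + Pr k x)"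
    using ag[folded AE_MI] AE_MI_neq[of 0] AE_MI_neq[of 1] AE_space
  proof eventually_elim
    case (elim x)
    then have x: "0 < x" "x < 1" by (auto simp: space_restrict_space)
    have "b x * (a x * g x) = b x * (c + Pr k x)" using elim x by (simp add: Pr_LINT)
    moreover have "b x * (a x * g x) = g x"
      using ab[OF x] by (metis mult.assoc mult.commute mult_1)
    ultimately show ?case by simp
  qed
  let ?h = "\<lambda>n r. (LINT x|U01. yv (s n) r x * k x)"
  let ?H = "\<lambda>r. \<integral>x. Y r x * k x \<partial>U01"
  have hc: "continuous_on S (?h n)" for n S
    by (intro continuous_at_imp_continuous_on ballI DERIV_isCont[OF yv_ip_deriv[OF L2_integrable[OF k]]])
  have trc: "continuous_on S (\<lambda>r. yv (s n) r 0)" for n S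
    unfolding yv_def by (intro continuous_intros)
  have HcT: "continuous_on {0..T} ?H" by (rule ip_cont_on[OF YL k]) (use Y_cont in auto)
  then have Hc: "continuous_on {0..t} ?H" by (rule continuous_on_subset) (use t0 in auto)
  \<comment> \<open>The factor 1 turns the time integral into an inner product, the form in which
    \<open>ip_tendsto\<close> is applied below.\<close>
  have eqn: "- (LINT x|U01. pv (s n) t x * g x) - - (LINT x|U01. pv (s n) 0 x * g x)
      = (LINT r|MI 0 t. (?h n r + yv (s n) r 0 * c) * 1)" for n
  proof -
    let ?F = "\<lambda>r. - (LINT x|U01. pv (s n) r x * g x)"
    have D: "(?F has_real_derivative ?h n r + yv (s n) r 0 * c) (at r)" for r
      using DERIV_minus[OF pv_ip_deriv[OF L2_integrable[OF g], of "s n" r]] pv_domA[OF k g gb, of "s n" r] by simp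
    have "((\<lambda>r. ?h n r + yv (s n) r 0 * c) has_integral ?F t - ?F 0) {0..t}"
      using D by (intro fundamental_theorem_of_calculus[OF t0(1)])
        (auto simp: has_real_derivative_iff_has_vector_derivative[symmetric] intro: DERIV_subset)
    then have "integral {0..t} (\<lambda>r. ?h n r + yv (s n) r 0 * c) = ?F t - ?F 0" by (rule integral_unique)
    moreover have "(LINT r|MI 0 t. ?h n r + yv (s n) r 0 * c) = integral {0..t} (\<lambda>r. ?h n r + yv (s n) r 0 * c)"
      by (intro continuous_integral_MI continuous_on_add continuous_on_mult hc trc continuous_on_const)
    ultimately show ?thesis by simp
  qed
  have vLt: "v \<in> L2 (MI 0 t)" by (rule MI_mono(1)[OF vL]) (use t0 in auto)
  have HL: "?H \<in> L2 (MI 0 t)" by (rule continuous_L2[OF Hc])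
  have gL: "(\<lambda>r. ?H r + v r * c) \<in> L2 (MI 0 t)"
    using L2_add[OF HL L2_scale[OF vLt, of c]] by (simp add: mult.commute)
  have fL: "(\<lambda>r. ?h n r + yv (s n) r 0 * c) \<in> L2 (MI 0 t)" for n
    by (intro continuous_L2 continuous_on_add continuous_on_mult hc trc continuous_on_const)
  have lim: "(\<lambda>n. nrm (MI 0 t) (\<lambda>r. (?h n r + yv (s n) r 0 * c) - (?H r + v r * c))) \<longlonglongrightarrow> 0"
  proof (rule Lim_null_comparison)
    define K where "K = nrm U01 k * sqrt t + \<bar>c\<bar>"
    have "nrm (MI 0 t) (\<lambda>r. (?h n r + yv (s n) r 0 * c) - (?H r + v r * c)) \<le> d n * K" for n
    proof -
      have "\<bar>?h n r - ?H r\<bar> \<le> d n * nrm U01 k" if r: "r \<in> {0..t}" for r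
      proof -
        have rT: "r \<in> {0..T}" using r t0 by auto
        have "\<bar>?h n r - ?H r\<bar> \<le> nrm U01 (\<lambda>x. yv (s n) r x - Y r x) * nrm U01 k"
          by (rule ip_diff_bound[OF yv_L2 YL[OF rT] k])
        also have "\<dots> \<le> d n * nrm U01 k" using Yd[OF rT] by (intro mult_right_mono) auto
        finally show ?thesis .
      qed
      then have 1: "nrm (MI 0 t) (\<lambda>r. ?h n r - ?H r) \<le> d n * nrm U01 k * sqrt (t - 0)"
        by (intro integral_bound_MI(2) t0 L2_meas[OF continuous_L2] continuous_on_diff hc Hc)
      have trL: "(\<lambda>r. yv (s n) r 0 - v r) \<in> L2 (MI 0 T)" by (intro L2_diff continuous_L2 trc vL)
      have "nrm (MI 0 t) (\<lambda>r. yv (s n) r 0 - v r) \<le> d n"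
        using MI_mono(2)[OF trL, of 0 t] t0 vd[of n] by simp
      then have 2: "nrm (MI 0 t) (\<lambda>r. c * (yv (s n) r 0 - v r)) \<le> \<bar>c\<bar> * d n"
        unfolding nrm_scale by (intro mult_left_mono) auto
      have "nrm (MI 0 t) (\<lambda>r. (?h n r - ?H r) + c * (yv (s n) r 0 - v r)) \<le> d n * nrm U01 k * sqrt (t - 0) + \<bar>c\<bar> * d n"
        using nrm_triangle[OF L2_diff[OF continuous_L2[OF hc[of "{0..t}" n]] HL] L2_scale[OF MI_mono(1)[OF trL, of 0 t], of c]] 1 2 t0 by simp
      moreover have "(\<lambda>r. (?h n r - ?H r) + c * (yv (s n) r 0 - v r)) = (\<lambda>r. (?h n r + yv (s n) r 0 * c) - (?H r + v r * c))"
        by (auto simp: algebra_simps)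
      ultimately show ?thesis by (simp add: K_def algebra_simps)
    qed
    then show "\<forall>\<^sub>F n in sequentially. norm (nrm (MI 0 t) (\<lambda>r. (?h n r + yv (s n) r 0 * c) - (?H r + v r * c))) \<le> d n * K"
      by (intro always_eventually allI) simp
    show "(\<lambda>n. d n * K) \<longlonglongrightarrow> 0" using tendsto_mult_left_zero[OF d0] by simp
  qed
  have "(\<lambda>n. \<integral>r. (?h n r + yv (s n) r 0 * c) * 1 \<partial>MI 0 t) \<longlonglongrightarrow> (LINT r|MI 0 t. (?H r + v r * c) * 1)"
    by (rule ip_tendsto[OF fL gL continuous_L2[OF continuous_on_const] lim])
  moreover have "(\<lambda>n. \<integral>r. (?h n r + yv (s n) r 0 * c) * 1 \<partial>MI 0 t) \<longlonglongrightarrow> wf t \<phi> - wf 0 \<phi>"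
    unfolding eqn[symmetric] wf_eq[OF \<phi> t] wf_eq[OF \<phi> T0] by (intro tendsto_intros P_ip t T0 g)
  ultimately show ?thesis using LIMSEQ_unique by fastforce
qed

lemma wave_solution_limit:
  assumes y0: "AE x in U01. Y 0 x = y0 x"
    and y1: "\<And>\<phi> g. H01_deriv \<phi> g \<Longrightarrow> y1 \<phi> = - (LINT x|U01. p0 x * g x)"
    and p0: "p0 \<in> L2 U01" "AE x in U01. P 0 x = p0 x"
  shows "wave_solution a T y0 y1 v (\<lambda>x t. Y t x) wf"
proof -
  have T0: "0 \<in> {0..T}" using T by simp
  have w0: "wf 0 \<phi> = y1 \<phi>" if \<phi>: "H01 \<phi>" for \<phi>
  proof -
    obtain g where g: "H01_deriv \<phi> g" using \<phi> by (auto simp: H01_def)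
    then have gL: "g \<in> L2 U01" by (simp add: H01_deriv_iff)
    have "(LINT x|U01. P 0 x * g x) = (LINT x|U01. p0 x * g x)"
      using p0(2) L2_mult[OF PL[OF T0] gL] L2_mult[OF p0(1) gL]
      by (intro integral_cong_AE) (auto elim: eventually_mono)
    then show ?thesis using wf_eq[OF g T0] y1[OF g] by simp
  qed
  show ?thesis
    unfolding wave_solution_def
  proof (intro conjI ballI allI impI)
    show "L2on {0..1} (\<lambda>x. Y t x)" if "t \<in> {0..T}" for t using YL[OF that] by (simp add: L2on_iff)
    show "\<exists>\<delta>>0. \<forall>s\<in>{0..T}. \<bar>s - t\<bar> < \<delta> \<longrightarrow> (LINT x:{0..1}|lborel. (Y s x - Y t x)\<^sup>2) < e"
      if t: "t \<in> {0..T}" and e: "0 < e" for t e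
    proof -
      obtain \<delta> where \<delta>: "\<delta> > 0" "\<And>s. s \<in> {0..T} \<Longrightarrow> \<bar>s - t\<bar> < \<delta> \<Longrightarrow> nrm U01 (\<lambda>x. Y s x - Y t x) < sqrt e"
        using Y_cont[OF t, of "sqrt e"] e by auto
      have "(LINT x:{0..1}|lborel. (Y s x - Y t x)\<^sup>2) < e" if "s \<in> {0..T}" "\<bar>s - t\<bar> < \<delta>" for s
        using \<delta>(2)[OF that] by (simp add: LINT_MI nrm_def)
      then show ?thesis using \<delta>(1) by blast
    qed
    show "Hm1 (wf t)" if t: "t \<in> {0..T}" for t
      unfolding Hm1_def sqrt_LINT_nrm
    proof (intro conjI allI impI)
      fix \<phi> \<psi> assume "H01 \<phi>" "H01 \<psi>"
      then obtain g h where gh: "H01_deriv \<phi> g" "H01_deriv \<psi> h" by (auto simp: H01_def)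
      then have L: "g \<in> L2 U01" "h \<in> L2 U01" by (auto simp: H01_deriv_iff)
      have "H01_deriv (\<lambda>x. \<phi> x + \<psi> x) (\<lambda>x. g x + h x)" using H01_deriv_lin[OF gh, of 1] by simp
      from wf_eq[OF this t] show "wf t (\<lambda>x. \<phi> x + \<psi> x) = wf t \<phi> + wf t \<psi>"
        using L2_mult[OF PL[OF t] L(1)] L2_mult[OF PL[OF t] L(2)] by (simp add: wf_eq[OF gh(1) t] wf_eq[OF gh(2) t] distrib_left)
    next
      fix \<phi> c assume "H01 \<phi>"
      then obtain g where g: "H01_deriv \<phi> g" by (auto simp: H01_def)
      have z: "H01_deriv (\<lambda>_. 0) (\<lambda>_. 0)" by (auto simp: H01_deriv_iff L2_zero Pr_def)
      have "H01_deriv (\<lambda>x. c * \<phi> x) (\<lambda>x. c * g x)" using H01_deriv_lin[OF z g, of c] by simp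
      from wf_eq[OF this t] show "wf t (\<lambda>x. c * \<phi> x) = c * wf t \<phi>"
        by (simp add: wf_eq[OF g t] mult.left_commute)
    next
      show "\<exists>C. \<forall>\<phi> g. H01_deriv \<phi> g \<longrightarrow> \<bar>wf t \<phi>\<bar> \<le> C * nrm U01 g"
      proof (intro exI allI impI)
        fix \<phi> g assume g: "H01_deriv \<phi> g"
        then have "g \<in> L2 U01" by (simp add: H01_deriv_iff)
        from L2_CS[OF PL[OF t] this] show "\<bar>wf t \<phi>\<bar> \<le> nrm U01 (P t) * nrm U01 g" by (simp add: wf_eq[OF g t])
      qed
    qed
    show "\<exists>\<delta>>0. \<forall>s\<in>{0..T}. \<bar>s - t\<bar> < \<delta> \<longrightarrow> Hm1_close (wf s) (wf t) e"
      if t: "t \<in> {0..T}" and e: "0 < e" for t e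
    proof -
      obtain \<delta> where \<delta>: "\<delta> > 0" "\<And>s. s \<in> {0..T} \<Longrightarrow> \<bar>s - t\<bar> < \<delta> \<Longrightarrow> nrm U01 (\<lambda>x. P s x - P t x) < e"
        using P_cont[OF t e] by auto
      have "Hm1_close (wf s) (wf t) e" if s: "s \<in> {0..T}" "\<bar>s - t\<bar> < \<delta>" for s
        unfolding Hm1_close_def sqrt_LINT_nrm
      proof (intro allI impI)
        fix \<phi> g assume g: "H01_deriv \<phi> g"
        then have gL: "g \<in> L2 U01" by (simp add: H01_deriv_iff)
        have "\<bar>wf s \<phi> - wf t \<phi>\<bar> \<le> nrm U01 (\<lambda>x. P s x - P t x) * nrm U01 g"
          using ip_diff_bound[OF PL[OF s(1)] PL[OF t] gL] by (simp add: wf_eq[OF g t] wf_eq[OF g s(1)])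
        also have "\<dots> \<le> e * nrm U01 g" using \<delta>(2)[OF s] by (intro mult_right_mono) auto
        finally show "\<bar>wf s \<phi> - wf t \<phi>\<bar> \<le> e * nrm U01 g" .
      qed
      then show ?thesis using \<delta>(1) by blast
    qed
    show "\<exists>\<delta>>0. \<forall>s\<in>{0..T}. s \<noteq> t \<and> \<bar>s - t\<bar> < \<delta> \<longrightarrow> Hm1_close (L2_to_Hm1 (\<lambda>x. (Y s x - Y t x) / (s - t))) (wf t) e"
      if t: "t \<in> {0..T}" and e: "0 < e" for t e
    proof -
      obtain \<delta> where \<delta>: "\<delta> > 0" "\<And>s. s \<in> {0..T} \<Longrightarrow> \<bar>s - t\<bar> < \<delta> \<Longrightarrow> nrm U01 (\<lambda>x. P s x - P t x) < e"
        using P_cont[OF t e] by auto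
      have "Hm1_close (L2_to_Hm1 (\<lambda>x. (Y s x - Y t x) / (s - t))) (wf t) e"
        if s: "s \<in> {0..T}" "s \<noteq> t" "\<bar>s - t\<bar> < \<delta>" for s
        unfolding Hm1_close_def sqrt_LINT_nrm
      proof (intro allI impI)
        fix \<phi> g assume g: "H01_deriv \<phi> g"
        show "\<bar>L2_to_Hm1 (\<lambda>x. (Y s x - Y t x) / (s - t)) \<phi> - wf t \<phi>\<bar> \<le> e * nrm U01 g"
          unfolding L2_to_Hm1_quotient[OF YL[OF s(1)] YL[OF t] H01_L2[OF g]]
          using quotient_close[OF g t s(1,2), of e] \<delta>(2) s(3) by (simp add: less_imp_le)
      qed
      then show ?thesis using \<delta>(1) by blast
    qed
    show "AE x in lborel. x \<in> {0..1} \<longrightarrow> Y 0 x = y0 x" using y0 by (simp add: AE_MI)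
    show "wf 0 \<phi> = y1 \<phi>" if "H01 \<phi>" for \<phi> by (rule w0[OF that])
    show "wf t \<phi> - y1 \<phi> = (LINT s:{0..t}|lborel. (LINT x:{0..1}|lborel. Y s x * k x) + v s * c)"
      if "domA a \<phi> c k" "t \<in> {0..T}" for \<phi> c k t
    proof -
      have "H01 \<phi>" using that(1) by (auto simp: domA_def H01_def)
      then show ?thesis using weak_equation[OF that] w0 by (simp add: LINT_MI)
    qed
  qed
qed

end

section \<open>Uniqueness of weak solutions\<close>

context wave_coeff
begin

text \<open>Makes \<open>G f\<close> available as a test function: (a u_x)_x = -f, and its flux
  \<open>Tl f + cc f\<close> at x = 0 is \<open>cc f\<close> plus the full integral of
  \<open>f\<close>.\<close>

lemma domA_G:
  assumes f: "f \<in> L2 U01" and ab: "\<And>x. 0 < x \<Longrightarrow> x < 1 \<Longrightarrow> a x * b x = 1"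
  shows "H01_deriv (G f) (Gd f)" and "domA a (G f) (cc f + (LINT x|U01. f x)) (\<lambda>x. - f x)"
proof -
  show H: "H01_deriv (G f) (Gd f)"
    using Gd_L2[OF f] Gd_integral[OF f] by (auto simp: H01_deriv_iff G_def Pr_1)
  have "AE x in U01. a x * Gd f x = cc f + (LINT x|U01. f x) + (LINT s:{0..x}|lborel. - f s)"
    using AE_MI_neq[of 0] AE_MI_neq[of 1] AE_space
  proof eventually_elim
    case (elim x)
    then have x: "0 < x" "x < 1" by (auto simp: space_restrict_space)
    have "a x * Gd f x = (a x * b x) * (Tl f x + cc f)" by (simp add: Gd_def)
    also have "\<dots> = cc f + (LINT x|U01. f x) - Pr f x"
      using ab[OF x] Tl_eq[OF L2_integrable[OF f], of x] x by simp
    also have "\<dots> = cc f + (LINT x|U01. f x) + Pr (\<lambda>s. - f s) x" by (simp add: Pr_def)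
    finally show ?case using x by (simp add: Pr_LINT)
  qed
  then show "domA a (G f) (cc f + (LINT x|U01. f x)) (\<lambda>x. - f x)"
    unfolding domA_def L2on_iff AE_MI using H L2_uminus[OF f] by blast
qed

lemma Gn_symm:
  assumes "f \<in> L2 U01" "h \<in> L2 U01"
  shows "(LINT x|U01. (G ^^ n) f x * h x) = (LINT x|U01. f x * (G ^^ n) h x)"
  using assms
proof (induction n arbitrary: h)
  case (Suc n)
  have "(LINT x|U01. (G ^^ Suc n) f x * h x) = (LINT x|U01. (G ^^ n) f x * G h x)"
    using G_symm[OF Gn_L2[OF Suc.prems(1)] Suc.prems(2)] by simp
  also have "\<dots> = (LINT x|U01. f x * (G ^^ Suc n) h x)"
    using Suc.IH[OF Suc.prems(1) G_L2[OF Suc.prems(2)]] by (simp add: funpow_swap1)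
  finally show ?case .
qed simp

lemma wave_solutionD:
  assumes "wave_solution a T y0 y1 v y w"
  shows "t \<in> {0..T} \<Longrightarrow> (\<lambda>x. y x t) \<in> L2 U01"
    and "t \<in> {0..T} \<Longrightarrow> 0 < e \<Longrightarrow> \<exists>\<delta>>0. \<forall>s\<in>{0..T}. \<bar>s - t\<bar> < \<delta> \<longrightarrow> nrm U01 (\<lambda>x. y x s - y x t) < e"
    and "t \<in> {0..T} \<Longrightarrow> 0 < e \<Longrightarrow> \<exists>\<delta>>0. \<forall>s\<in>{0..T}. s \<noteq> t \<and> \<bar>s - t\<bar> < \<delta> \<longrightarrow>
      Hm1_close (L2_to_Hm1 (\<lambda>x. (y x s - y x t) / (s - t))) (w t) e"
    and "AE x in U01. y x 0 = y0 x"
    and "domA a \<phi> c k \<Longrightarrow> t \<in> {0..T} \<Longrightarrow>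
      w t \<phi> - y1 \<phi> = (LINT r|MI 0 t. (LINT x|U01. y x r * k x) + v r * c)"
proof -
  note D = assms[unfolded wave_solution_def L2on_iff LINT_MI AE_MI[symmetric]]
  show "t \<in> {0..T} \<Longrightarrow> (\<lambda>x. y x t) \<in> L2 U01"
    by (rule D[THEN conjunct1, THEN bspec])
  note D = D[THEN conjunct2]
  show "\<exists>\<delta>>0. \<forall>s\<in>{0..T}. \<bar>s - t\<bar> < \<delta> \<longrightarrow> nrm U01 (\<lambda>x. y x s - y x t) < e"
    if t: "t \<in> {0..T}" and e: "0 < e"
  proof -
    have "e\<^sup>2 > 0" using e by simp
    with D[THEN conjunct1, THEN bspec, OF t] obtain \<delta> where \<delta>: "\<delta> > 0"
      "\<And>s. s \<in> {0..T} \<Longrightarrow> \<bar>s - t\<bar> < \<delta> \<Longrightarrow> (LINT x|U01. (y x s - y x t)\<^sup>2) < e\<^sup>2" by blast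
    have "nrm U01 (\<lambda>x. y x s - y x t) < e" if "s \<in> {0..T}" "\<bar>s - t\<bar> < \<delta>" for s
      using \<delta>(2)[OF that] e unfolding nrm_def by (intro real_less_lsqrt) auto
    then show ?thesis using \<delta>(1) by blast
  qed
  note D = D[THEN conjunct2, THEN conjunct2, THEN conjunct2]
  show "t \<in> {0..T} \<Longrightarrow> 0 < e \<Longrightarrow> \<exists>\<delta>>0. \<forall>s\<in>{0..T}. s \<noteq> t \<and> \<bar>s - t\<bar> < \<delta> \<longrightarrow>
      Hm1_close (L2_to_Hm1 (\<lambda>x. (y x s - y x t) / (s - t))) (w t) e"
    by (rule D[THEN conjunct1, THEN bspec, THEN spec, THEN mp])
  note D = D[THEN conjunct2]
  show "AE x in U01. y x 0 = y0 x" by (rule D[THEN conjunct1])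
  show "domA a \<phi> c k \<Longrightarrow> t \<in> {0..T} \<Longrightarrow>
      w t \<phi> - y1 \<phi> = (LINT r|MI 0 t. (LINT x|U01. y x r * k x) + v r * c)"
    by (rule D[THEN conjunct2, THEN conjunct2, rule_format])
qed

text \<open>The difference \<open>z\<close> of two solutions satisfies \<open>(G z)'' = - z\<close>, so \<open>G\<^sup>n z\<close> decays factorially in \<open>n\<close>.\<close>

lemma wave_solution_unique:
  assumes ab: "\<And>x. 0 < x \<Longrightarrow> x < 1 \<Longrightarrow> a x * b x = 1" and T: "0 < T" and v: "v \<in> L2 (MI 0 T)"
    and s1: "wave_solution a T y0 y1 v y w" and s2: "wave_solution a T y0 y1 v y' w'" and t: "t \<in> {0..T}"
  shows "AE x in U01. y x t = y' x t" and "\<And>\<phi>. H01 \<phi> \<Longrightarrow> w t \<phi> = w' t \<phi>"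
proof -
  define z where "z t x = y x t - y' x t" for t x
  have yL: "(\<lambda>x. y x t) \<in> L2 U01" "(\<lambda>x. y' x t) \<in> L2 U01" if "t \<in> {0..T}" for t
    using wave_solutionD(1)[OF s1 that] wave_solutionD(1)[OF s2 that] by auto
  have zL: "z t \<in> L2 U01" if "t \<in> {0..T}" for t
    unfolding z_def[abs_def] by (intro L2_diff yL that)
  note ycont = wave_solutionD(2)
  have zcont: "\<exists>\<delta>>0. \<forall>s\<in>{0..T}. \<bar>s - t\<bar> < \<delta> \<longrightarrow> nrm U01 (\<lambda>x. z s x - z t x) < e"
    if t: "t \<in> {0..T}" and e: "0 < e" for t e
  proof -
    have e2: "0 < e / 2" using e by simp
    obtain \<delta>1 where 1: "\<delta>1 > 0" "\<And>s. s \<in> {0..T} \<Longrightarrow> \<bar>s - t\<bar> < \<delta>1 \<Longrightarrow> nrm U01 (\<lambda>x. y x s - y x t) < e / 2"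
      using ycont[OF s1 t e2] by blast
    obtain \<delta>2 where 2: "\<delta>2 > 0" "\<And>s. s \<in> {0..T} \<Longrightarrow> \<bar>s - t\<bar> < \<delta>2 \<Longrightarrow> nrm U01 (\<lambda>x. y' x s - y' x t) < e / 2"
      using ycont[OF s2 t e2] by blast
    have "nrm U01 (\<lambda>x. z s x - z t x) < e" if s: "s \<in> {0..T}" "\<bar>s - t\<bar> < min \<delta>1 \<delta>2" for s
    proof -
      have "(\<lambda>x. z s x - z t x) = (\<lambda>x. (y x s - y x t) + - (y' x s - y' x t))" by (auto simp: z_def)
      then show ?thesis
        using nrm_triangle[OF L2_diff[OF yL(1)[OF s(1)] yL(1)[OF t]] L2_uminus[OF L2_diff[OF yL(2)[OF s(1)] yL(2)[OF t]]]]
          1(2)[OF s(1)] 2(2)[OF s(1)] s(2) nrm_uminus[of U01 "\<lambda>x. y' x s - y' x t"] by simp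
    qed
    then show ?thesis using 1(1) 2(1) by (intro exI[of _ "min \<delta>1 \<delta>2"]) auto
  qed
  have "continuous_on {0..T} (\<lambda>t. nrm U01 (z t))"
    unfolding continuous_on_iff dist_real_def
  proof (intro ballI allI impI)
    fix t e :: real assume t: "t \<in> {0..T}" and e: "0 < e"
    then obtain \<delta> where \<delta>: "\<delta> > 0" "\<And>s. s \<in> {0..T} \<Longrightarrow> \<bar>s - t\<bar> < \<delta> \<Longrightarrow> nrm U01 (\<lambda>x. z s x - z t x) < e"
      using zcont by blast
    have "\<bar>nrm U01 (z s) - nrm U01 (z t)\<bar> < e" if "s \<in> {0..T}" "\<bar>s - t\<bar> < \<delta>" for s
      using nrm_diff_ge[OF zL[OF that(1)] zL[OF t]] \<delta>(2)[OF that] by (rule le_less_trans)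
    then show "\<exists>\<delta>>0. \<forall>s\<in>{0..T}. \<bar>s - t\<bar> < \<delta> \<longrightarrow> \<bar>nrm U01 (z s) - nrm U01 (z t)\<bar> < e"
      using \<delta>(1) by blast
  qed
  then obtain C where C: "\<And>t. t \<in> {0..T} \<Longrightarrow> \<bar>nrm U01 (z t)\<bar> \<le> C" using continuous_bounded_MI by blast
  have C0: "0 \<le> C" using order_trans[OF abs_ge_zero C[of 0]] T by simp
  define I where "I f t = (LINT x|U01. z t x * f x)" for f t
  have Ic: "continuous_on {0..T} (I f)" if "f \<in> L2 U01" for f
    unfolding I_def[abs_def] by (rule ip_cont_on[OF zL that]) (use zcont in auto)
  define W where "W t \<phi> = w t \<phi> - w' t \<phi>" for t \<phi>
  have quot: "\<exists>\<delta>>0. \<forall>s\<in>{0..T}. s \<noteq> t \<and> \<bar>s - t\<bar> < \<delta> \<longrightarrow> \<bar>(I \<phi> s - I \<phi> t) / (s - t) - W t \<phi>\<bar> < e"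
    if \<phi>: "H01_deriv \<phi> g" and t: "t \<in> {0..T}" and e: "0 < e" for \<phi> g t e
  proof -
    \<comment> \<open>Two errors, each e' times the norm of \<open>g\<close>, must add up to less
      than \<open>e\<close>; the added 1 covers norm zero.\<close>
    define e' where "e' = e / (2 * (nrm U01 g + 1))"
    have n1: "0 < nrm U01 g + 1" by (rule add_nonneg_pos[OF nrm_ge0 zero_less_one])
    have e': "0 < e'" unfolding e'_def by (intro divide_pos_pos mult_pos_pos e n1) simp
    have ee: "e' * nrm U01 g + e' * nrm U01 g < e"
    proof -
      have "e' * (2 * (nrm U01 g + 1)) = e"
        unfolding e'_def using n1 by (metis less_irrefl mult_eq_0_iff nonzero_divide_mult_cancel_right nonzero_mult_div_cancel_right times_divide_eq_left zero_neq_numeral)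
      moreover have "e' * (2 * (nrm U01 g + 1)) = e' * nrm U01 g + e' * nrm U01 g + 2 * e'" by (simp add: algebra_simps)
      ultimately show ?thesis using e' by linarith
    qed
    obtain \<delta>1 where 1: "\<delta>1 > 0" "\<And>s. s \<in> {0..T} \<Longrightarrow> s \<noteq> t \<and> \<bar>s - t\<bar> < \<delta>1 \<Longrightarrow>
        Hm1_close (L2_to_Hm1 (\<lambda>x. (y x s - y x t) / (s - t))) (w t) e'"
      using wave_solutionD(3)[OF s1 t e'] by blast
    obtain \<delta>2 where 2: "\<delta>2 > 0" "\<And>s. s \<in> {0..T} \<Longrightarrow> s \<noteq> t \<and> \<bar>s - t\<bar> < \<delta>2 \<Longrightarrow>
        Hm1_close (L2_to_Hm1 (\<lambda>x. (y' x s - y' x t) / (s - t))) (w' t) e'"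
      using wave_solutionD(3)[OF s2 t e'] by blast
    have "\<bar>(I \<phi> s - I \<phi> t) / (s - t) - W t \<phi>\<bar> < e" if s: "s \<in> {0..T}" "s \<noteq> t" "\<bar>s - t\<bar> < min \<delta>1 \<delta>2" for s
    proof -
      let ?l1 = "L2_to_Hm1 (\<lambda>x. (y x s - y x t) / (s - t)) \<phi>" and ?l2 = "L2_to_Hm1 (\<lambda>x. (y' x s - y' x t) / (s - t)) \<phi>"
      have Iy: "I \<phi> r = (LINT x|U01. y x r * \<phi> x) - (LINT x|U01. y' x r * \<phi> x)" if "r \<in> {0..T}" for r
        using L2_mult[OF yL(1)[OF that] H01_L2[OF \<phi>]] L2_mult[OF yL(2)[OF that] H01_L2[OF \<phi>]]
        by (simp add: I_def z_def left_diff_distrib)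
      have "(I \<phi> s - I \<phi> t) / (s - t) = ?l1 - ?l2"
        unfolding L2_to_Hm1_quotient[OF yL(1)[OF s(1)] yL(1)[OF t] H01_L2[OF \<phi>]]
          L2_to_Hm1_quotient[OF yL(2)[OF s(1)] yL(2)[OF t] H01_L2[OF \<phi>]] Iy[OF s(1)] Iy[OF t]
        by (simp add: diff_divide_distrib[symmetric])
      moreover have "\<bar>?l1 - w t \<phi>\<bar> \<le> e' * nrm U01 g" "\<bar>?l2 - w' t \<phi>\<bar> \<le> e' * nrm U01 g"
        using 1(2)[OF s(1)] 2(2)[OF s(1)] s \<phi> unfolding Hm1_close_def sqrt_LINT_nrm by auto
      ultimately show ?thesis using ee unfolding W_def by linarith
    qed
    then show ?thesis using 1(1) 2(1) by (intro exI[of _ "min \<delta>1 \<delta>2"]) auto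
  qed
  have Ider: "(I \<phi> has_real_derivative W t \<phi>) (at t)" if \<phi>: "H01_deriv \<phi> g" and t: "0 < t" "t < T" for \<phi> g t
  proof -
    have "((\<lambda>s. (I \<phi> s - I \<phi> t) / (s - t)) \<longlongrightarrow> W t \<phi>) (at t)"
    proof (rule LIM_I)
      fix e :: real assume "0 < e"
      from quot[OF \<phi> _ this, of t] t obtain \<delta> where \<delta>: "\<delta> > 0"
        "\<And>s. s \<in> {0..T} \<Longrightarrow> s \<noteq> t \<and> \<bar>s - t\<bar> < \<delta> \<Longrightarrow> \<bar>(I \<phi> s - I \<phi> t) / (s - t) - W t \<phi>\<bar> < e" by auto
      show "\<exists>\<delta>>0. \<forall>s. s \<noteq> t \<and> norm (s - t) < \<delta> \<longrightarrow> norm ((I \<phi> s - I \<phi> t) / (s - t) - W t \<phi>) < e"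
      proof (intro exI[of _ "min \<delta> (min t (T - t))"] conjI allI impI)
        fix s assume s: "s \<noteq> t \<and> norm (s - t) < min \<delta> (min t (T - t))"
        then have "s \<in> {0..T}" by (auto simp: abs_if split: if_splits)
        then show "norm ((I \<phi> s - I \<phi> t) / (s - t) - W t \<phi>) < e" using \<delta>(2)[of s] s by simp
      qed (use \<delta>(1) t in simp)
    qed
    then show ?thesis by (simp add: has_field_derivative_iff)
  qed
  \<comment> \<open>Both solutions have the same \<open>v\<close> and \<open>y1\<close>, so control
    and initial terms cancel: z' paired with \<open>G f\<close> is minus the time integral of z
    paired with \<open>f\<close>.\<close>
  have WG: "W t (G f) = - (LINT r|MI 0 t. I f r)" if f: "f \<in> L2 U01" and t: "t \<in> {0..T}" for f t
  proof -
    let ?c = "cc f + (LINT x|U01. f x)"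
    note dom = domA_G(2)[OF f ab]
    note e1 = wave_solutionD(5)[OF s1 dom t]
    note e2 = wave_solutionD(5)[OF s2 dom t]
    have sub: "{0..t} \<subseteq> {0..T}" using t by auto
    have vi: "integrable (MI 0 t) (\<lambda>r. v r * ?c)"
      using L2_integrable[OF MI_mono(1)[OF v, of 0 t]] t by simp
    have c1: "continuous_on {0..t} (\<lambda>r. \<integral>x. y x r * - f x \<partial>U01)"
      by (rule continuous_on_subset[OF ip_cont_on[OF yL(1) L2_uminus[OF f]] sub]) (use ycont[OF s1] in auto)
    have c2: "continuous_on {0..t} (\<lambda>r. \<integral>x. y' x r * - f x \<partial>U01)"
      by (rule continuous_on_subset[OF ip_cont_on[OF yL(2) L2_uminus[OF f]] sub]) (use ycont[OF s2] in auto)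
    have "W t (G f) = (LINT r|MI 0 t. ((LINT x|U01. y x r * - f x) + v r * ?c) - ((LINT x|U01. y' x r * - f x) + v r * ?c))"
      using e1 e2 integrable_continuous_MI[OF c1] integrable_continuous_MI[OF c2] vi
      by (subst Bochner_Integration.integral_diff) (auto simp: W_def)
    also have "\<dots> = (LINT r|MI 0 t. - I f r)"
    proof (rule Bochner_Integration.integral_cong[OF refl])
      fix r assume "r \<in> space (MI 0 t)"
      then have r: "r \<in> {0..T}" using sub by (auto simp: space_restrict_space)
      show "((LINT x|U01. y x r * - f x) + v r * ?c) - ((LINT x|U01. y' x r * - f x) + v r * ?c) = - I f r"
        using L2_mult[OF yL(1)[OF r] f] L2_mult[OF yL(2)[OF r] f]
        by (simp add: I_def z_def left_diff_distrib)
    qed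
    finally show ?thesis by simp
  qed
  have I0: "I f 0 = 0" if f: "f \<in> L2 U01" for f
  proof -
    have "AE x in U01. y x 0 = y0 x" "AE x in U01. y' x 0 = y0 x"
      by (rule wave_solutionD(4)[OF s1] wave_solutionD(4)[OF s2])+
    then have "AE x in U01. z 0 x * f x = 0" by eventually_elim (simp add: z_def)
    then have "I f 0 = (LINT x|U01. 0)"
      unfolding I_def using L2_mult[OF zL f, of 0] T by (intro integral_cong_AE) auto
    then show ?thesis by simp
  qed
  \<comment> \<open>Each \<open>G\<close> allows two time integrations. The inner one is bounded
    crudely by a factor \<open>T\<close>; the outer one builds up t^n / n!, which is enough.\<close>
  have bound: "\<bar>I ((G ^^ n) f) t\<bar> \<le> C * nrm U01 f * T ^ n * t ^ n / fact n"
    if f: "f \<in> L2 U01" and t: "t \<in> {0..T}" for n f t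
    using t
  proof (induction n arbitrary: t)
    case 0
    have "\<bar>I f t\<bar> \<le> nrm U01 (z t) * nrm U01 f" unfolding I_def by (rule L2_CS[OF zL[OF 0] f])
    also have "\<dots> \<le> C * nrm U01 f" using C[OF 0] by (intro mult_right_mono) auto
    finally show ?case by simp
  next
    case (Suc n)
    let ?h = "(G ^^ n) f"
    define B where "B = C * nrm U01 f * T ^ n / fact n"
    have B0: "0 \<le> B" using C0 T by (simp add: B_def)
    have hL: "?h \<in> L2 U01" by (rule Gn_L2[OF f])
    have GhH: "H01_deriv (G ?h) (Gd ?h)" by (rule domA_G(1)[OF hL ab])
    have t0: "0 \<le> t" "t \<le> T" using Suc.prems by auto
    have Wb: "\<bar>W r (G ?h)\<bar> \<le> T * B * r ^ n" if r: "r \<in> {0..T}" for r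
    proof -
      have r0: "0 \<le> r" "r \<le> T" using r by auto
      have Ib: "\<bar>I ?h u\<bar> \<le> B * r ^ n" if u: "u \<in> {0..r}" for u
      proof -
        have "\<bar>I ?h u\<bar> \<le> B * u ^ n" using Suc.IH[of u] u r0 by (simp add: B_def)
        also have "\<dots> \<le> B * r ^ n" using u B0 by (intro mult_left_mono power_mono) auto
        finally show ?thesis .
      qed
      have "I ?h \<in> borel_measurable (MI 0 r)"
        by (rule continuous_MI_meas, rule continuous_on_subset[OF Ic[OF hL]]) (use r0 in auto)
      from integral_bound_MI(1)[OF r0(1) this Ib] have "\<bar>W r (G ?h)\<bar> \<le> B * r ^ n * (r - 0)"
        unfolding WG[OF hL r] by simp
      also have "\<dots> \<le> B * r ^ n * T" using B0 r0 by (intro mult_left_mono) auto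
      finally show ?thesis by (simp add: mult_ac)
    qed
    define Q where "Q r = T * B * (r ^ Suc n / Suc n)" for r
    have Qd: "(Q has_real_derivative T * B * r ^ n) (at r)" for r
    proof -
      have "((\<lambda>r. r ^ Suc n / Suc n) has_real_derivative r ^ n) (at r)"
      proof -
        have "((\<lambda>r. r ^ Suc n / Suc n) has_real_derivative real (Suc n) * r ^ n / Suc n) (at r)"
          using DERIV_cdivide[OF DERIV_pow[of "Suc n" r], of "real (Suc n)"] by simp
        then show ?thesis by (simp del: of_nat_Suc)
      qed
      from DERIV_cmult[OF this, of "T * B"] show ?thesis by (simp add: Q_def[abs_def])
    qed
    have Qc: "continuous_on {0..t} Q" by (intro continuous_at_imp_continuous_on ballI DERIV_isCont[OF Qd])
    have IG: "continuous_on {0..t} (I (G ?h))"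
      by (rule continuous_on_subset[OF Ic[OF G_L2[OF hL]]]) (use t0 in auto)
    \<comment> \<open>The signs \<sigma> = 1 and \<sigma> = -1 give both halves of the absolute
      value.\<close>
    have mono: "Q 0 + \<sigma> * I (G ?h) 0 \<le> Q t + \<sigma> * I (G ?h) t" if \<sigma>: "\<bar>\<sigma>\<bar> = 1" for \<sigma>
    proof (rule mono_countable_exceptions[OF countable_empty t0(1), where f' = "\<lambda>r. T * B * r ^ n + \<sigma> * W r (G ?h)"])
      show "continuous_on {0..t} (\<lambda>r. Q r + \<sigma> * I (G ?h) r)" by (intro continuous_intros Qc IG)
      fix r assume r: "0 < r" "r < t"
      show "((\<lambda>r. Q r + \<sigma> * I (G ?h) r) has_real_derivative T * B * r ^ n + \<sigma> * W r (G ?h)) (at r)"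
        using r t0 by (intro DERIV_add Qd DERIV_cmult Ider[OF GhH]) auto
      have "\<bar>\<sigma> * W r (G ?h)\<bar> \<le> T * B * r ^ n" using Wb[of r] r t0 \<sigma> by (simp add: abs_mult)
      then show "0 \<le> T * B * r ^ n + \<sigma> * W r (G ?h)" by linarith
    qed
    have "\<bar>I (G ?h) t\<bar> \<le> Q t"
      using mono[of 1] mono[of "- 1"] I0[OF G_L2[OF hL]] by (simp add: Q_def)
    also have "Q t = C * nrm U01 f * T ^ Suc n * t ^ Suc n / fact (Suc n)"
      by (simp add: Q_def B_def mult_ac)
    finally show ?case by simp
  qed
  \<comment> \<open>At a fixed time the test function may be G^n z(t) itself; symmetry rewrites its
    squared norm as the pairing of z(t) with G^n applied to it, and \<open>bound\<close>
    applies.\<close>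
  have z0: "AE x in U01. z t x = 0" if t: "t \<in> {0..T}" for t
  proof (rule G_decay_zero[OF zL[OF t]])
    fix n
    let ?h = "(G ^^ n) (z t)"
    have hL: "?h \<in> L2 U01" by (rule Gn_L2[OF zL[OF t]])
    have "(nrm U01 ?h)\<^sup>2 = (LINT x|U01. ?h x * ?h x)" unfolding nrm_sq by (simp add: power2_eq_square)
    also have "\<dots> = I ((G ^^ n) ?h) t" unfolding I_def by (rule Gn_symm[OF zL[OF t] hL])
    also have "\<dots> \<le> C * nrm U01 ?h * T ^ n * t ^ n / fact n" using bound[OF hL t, of n] by linarith
    finally have *: "nrm U01 ?h * nrm U01 ?h \<le> nrm U01 ?h * (C * (T * t) ^ n / fact n)"
      by (simp add: power2_eq_square power_mult_distrib mult_ac)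
    then have "nrm U01 ?h = 0 \<or> nrm U01 ?h \<le> C * (T * t) ^ n / fact n"
      using nrm_ge0[of U01 ?h] by (metis less_le mult_le_cancel_left_pos)
    then show "nrm U01 ?h \<le> C * (T * t) ^ n / fact n"
      using C0 T t by (elim disjE) simp_all
  qed
  show "AE x in U01. y x t = y' x t"
    using z0[OF t] by eventually_elim (simp add: z_def)
  fix \<phi> assume "H01 \<phi>"
  then obtain g where \<phi>: "H01_deriv \<phi> g" by (auto simp: H01_def)
  have Iz: "I \<phi> r = 0" if r: "r \<in> {0..T}" for r
  proof -
    have "I \<phi> r = (LINT x|U01. 0)"
      unfolding I_def using L2_mult[OF zL[OF r] H01_L2[OF \<phi>]] z0[OF r]
      by (intro integral_cong_AE) (auto elim: eventually_mono)
    then show ?thesis by simp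
  qed
  have "W t \<phi> = 0"
  proof (rule ccontr)
    assume "W t \<phi> \<noteq> 0"
    then obtain \<delta> where \<delta>: "\<delta> > 0" "\<And>s. s \<in> {0..T} \<Longrightarrow> s \<noteq> t \<and> \<bar>s - t\<bar> < \<delta> \<Longrightarrow> \<bar>(I \<phi> s - I \<phi> t) / (s - t) - W t \<phi>\<bar> < \<bar>W t \<phi>\<bar>"
      using quot[OF \<phi> t, of "\<bar>W t \<phi>\<bar>"] by auto
    \<comment> \<open>A time in [0,T] within \<delta> of \<open>t\<close>, to its right unless t =
      T; one such point suffices because \<open>I \<phi>\<close> vanishes at all times.\<close>
    define s where "s = (if t < T then min T (t + \<delta> / 2) else max 0 (t - \<delta> / 2))"
    have "s \<in> {0..T}" "s \<noteq> t" "\<bar>s - t\<bar> < \<delta>" using \<delta>(1) t T by (auto simp: s_def)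
    then show False using \<delta>(2)[of s] Iz[OF t] Iz[of s] by simp
  qed
  then show "w t \<phi> = w' t \<phi>" by (simp add: W_def)
qed

end

section \<open>The reciprocal of a coefficient of bounded variation, and the conclusion\<close>

lemma BV01_variation:
  assumes "BV01 a"
  obtains U where "\<And>x y. 0 \<le> x \<Longrightarrow> x \<le> y \<Longrightarrow> y \<le> 1 \<Longrightarrow> \<bar>a y - a x\<bar> \<le> U y - (U x :: real)"
proof -
  obtain M where M: "\<And>n p. p 0 = 0 \<Longrightarrow> p n = 1 \<Longrightarrow> (\<forall>i<n. p i \<le> p (Suc i)) \<Longrightarrow>
      (\<Sum>i<n. \<bar>a (p (Suc i)) - a (p i)\<bar>) \<le> M"
    using assms unfolding BV01_def by blast
  \<comment> \<open>Variation sums over chains from 0 to \<open>x\<close>; their supremum is the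
    variation function. Appending a last point \<open>y\<close> gives the increment estimate,
    appending 1 gives boundedness by \<open>M\<close>.\<close>
  define S where "S x = {\<Sum>i<n. \<bar>a (p (Suc i)) - a (p i)\<bar> | (n::nat) p. p 0 = 0 \<and> p n = x \<and> (\<forall>i<n. p i \<le> p (Suc i))}" for x
  have ext: "r + \<bar>a y - a x\<bar> \<in> S y" if r: "r \<in> S x" and xy: "x \<le> y" for r x y
  proof -
    obtain n p where p: "r = (\<Sum>i<n. \<bar>a (p (Suc i)) - a (p i)\<bar>)" "p 0 = 0" "p n = x" "\<forall>i<n. p i \<le> p (Suc i)"
      using r unfolding S_def by blast
    define p' where "p' i = (if i \<le> n then p i else y)" for i
    have "(\<Sum>i<Suc n. \<bar>a (p' (Suc i)) - a (p' i)\<bar>) = r + \<bar>a y - a x\<bar>"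
      using p by (simp add: p'_def)
    moreover have "p' 0 = 0" "p' (Suc n) = y" "\<forall>i<Suc n. p' i \<le> p' (Suc i)"
      using p xy by (auto simp: p'_def less_Suc_eq)
    ultimately show ?thesis unfolding S_def by (intro CollectI exI[of _ "Suc n"] exI[of _ p']) auto
  qed
  have bdd: "bdd_above (S x)" if "x \<le> 1" for x
  proof (rule bdd_aboveI)
    fix r assume "r \<in> S x"
    from ext[OF this that] have "r + \<bar>a 1 - a x\<bar> \<le> M" unfolding S_def using M by auto
    then show "r \<le> M" by linarith
  qed
  have ne: "S x \<noteq> {}" if "0 \<le> x" for x
  proof -
    have "0 \<in> S 0" unfolding S_def by (intro CollectI exI[of _ "0::nat"] exI[of _ "\<lambda>_. 0"]) auto
    from ext[OF this that] show ?thesis by blast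
  qed
  show ?thesis
  proof (rule that[of "\<lambda>x. Sup (S x)"])
    fix x y :: real assume xy: "0 \<le> x" "x \<le> y" "y \<le> 1"
    have "Sup (S x) \<le> Sup (S y) - \<bar>a y - a x\<bar>"
    proof (rule cSup_least[OF ne[OF xy(1)]])
      fix r assume "r \<in> S x"
      from cSup_upper[OF ext[OF this xy(2)] bdd[OF xy(3)]] show "r \<le> Sup (S y) - \<bar>a y - a x\<bar>" by linarith
    qed
    then show "\<bar>a y - a x\<bar> \<le> Sup (S y) - Sup (S x)" by linarith
  qed
qed

text \<open>\<open>b\<close> is given the value \<open>1 / a0\<close> outside (0,1), because
  \<open>a\<close> is bounded below only in the open interval and may even vanish at 0 or 1. This
  affects only a null set of [0,1] and keeps the upper bound \<open>1 / a0\<close>.\<close>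

lemma BV01_reciprocal:
  assumes bv: "BV01 a" and a0: "0 < a0" "\<And>x. 0 < x \<Longrightarrow> x < 1 \<Longrightarrow> a0 \<le> a x"
  obtains V bl where "wave_coeff (\<lambda>x. if 0 < x \<and> x < 1 then 1 / a x else 1 / a0) V bl (1 / a0)"
proof -
  obtain U where U: "\<And>x y. 0 \<le> x \<Longrightarrow> x \<le> y \<Longrightarrow> y \<le> 1 \<Longrightarrow> \<bar>a y - a x\<bar> \<le> U y - (U x :: real)"
    using BV01_variation[OF bv] by blast
  define b where "b x = (if 0 < x \<and> x < 1 then 1 / a x else 1 / a0)" for x
  \<comment> \<open>Upper bound for \<open>a\<close> on (0,1) from its value at 0 and its variation;
    the maximum with \<open>a0\<close> puts 1 / A below both values in the definition of
    \<open>b\<close>.\<close>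
  define A where "A = max a0 (a 0 + (U 1 - U 0))"
  have A: "0 < A" "a0 \<le> A" using a0 by (auto simp: A_def)
  have Um: "U x \<le> U y" if "0 \<le> x" "x \<le> y" "y \<le> 1" for x y using U[OF that] by linarith
  have aA: "a x \<le> A" if "0 < x" "x < 1" for x
    using U[of 0 x] Um[of x 1] that by (auto simp: A_def)
  have b_ge: "1 / A \<le> b x" for x
    using aA[of x] a0(2)[of x] a0(1) A by (auto simp: b_def intro!: divide_left_mono mult_pos_pos)
  have b_le: "b x \<le> 1 / a0" for x
    using a0(2)[of x] a0(1) by (auto simp: b_def intro!: divide_left_mono mult_pos_pos)
  have b0: "0 < b x" for x using b_ge[of x] A by (meson less_le_trans zero_less_divide_1_iff)
  define cl where "cl x = max 0 (min 1 x)" for x :: real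
  \<comment> \<open>The reciprocal is Lipschitz with constant 1 / a0^2 on [a0, \<infinity>); the two
    step functions pay for the possible jumps of \<open>b\<close> at 0 and 1, each at most
    \<open>1 / a0\<close>. Clamping keeps the arguments of \<open>U\<close> in [0,1].\<close>
  define V where "V x = U (cl x) / a0\<^sup>2 + (if 0 < x then 1 / a0 else 0) + (if 1 \<le> x then 1 / a0 else 0)" for x
  have bV: "\<bar>b y - b x\<bar> \<le> V y - V x" if xy: "x \<le> y" for x y
  proof -
    have Ucl: "U (cl x) / a0\<^sup>2 \<le> U (cl y) / a0\<^sup>2"
      using Um[of "cl x" "cl y"] xy by (intro divide_right_mono) (auto simp: cl_def)
    have gap: "\<bar>b y - b x\<bar> \<le> 1 / a0" using b_le[of x] b_le[of y] b0[of x] b0[of y] by linarith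
    have p0: "0 \<le> 1 / a0" using a0 by simp
    consider "x \<le> 0" "0 < y" | "x < 1" "1 \<le> y" | "y \<le> 0" | "1 \<le> x" | "0 < x" "y < 1" by linarith
    then show ?thesis
    proof cases
      case 1 then show ?thesis using Ucl gap p0 by (auto simp: V_def)
    next
      case 2 then show ?thesis using Ucl gap p0 by (auto simp: V_def)
    next
      case 3 then show ?thesis using Ucl xy by (auto simp: V_def b_def)
    next
      case 4 then show ?thesis using Ucl xy by (auto simp: V_def b_def)
    next
      case 5
      then have xy': "0 < x" "x < 1" "0 < y" "y < 1" using xy by auto
      have ax: "a0 \<le> a x" "a0 \<le> a y" using a0(2) xy' by auto
      then have pos: "0 < a x" "0 < a y" using a0(1) by auto
      have "b y - b x = (a x - a y) / (a x * a y)"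
        using xy' pos by (simp add: b_def field_simps)
      then have "\<bar>b y - b x\<bar> = \<bar>a y - a x\<bar> / (a x * a y)"
        using pos by (simp add: abs_mult abs_minus_commute)
      also have "\<dots> \<le> \<bar>a y - a x\<bar> / a0\<^sup>2"
        using ax a0(1) pos by (intro divide_left_mono) (auto simp: power2_eq_square intro!: mult_mono mult_pos_pos)
      also have "\<dots> \<le> (U y - U x) / a0\<^sup>2"
        using U[of x y] xy' xy by (intro divide_right_mono) auto
      also have "\<dots> = V y - V x" using xy' by (simp add: V_def cl_def diff_divide_distrib)
      finally show ?thesis .
    qed
  qed
  have "wave_coeff b V (1 / A) (1 / a0)"
  proof
    show "mono V" by (rule monoI) (use bV in \<open>smt (verit)\<close>)
  qed (use A b_ge b_le bV in auto)
  then show ?thesis using that unfolding b_def[abs_def] by blast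
qed

theorem theorem2p5:
  fixes a :: "real \<Rightarrow> real" and a0 T :: real
    and y0 :: "real \<Rightarrow> real" and y1 :: "(real \<Rightarrow> real) \<Rightarrow> real"
  assumes "BV01 a"
    and "a0 > 0"
    and "\<forall>x\<in>{0<..<1}. a x \<ge> a0"
    and "T > 2 / sqrt a0"
    and "L2on {0..1} y0"
    and "Hm1 y1"
  shows "\<exists>v. L2on {0..T} v \<and>
           (\<exists>y w. wave_solution a T y0 y1 v y w) \<and>
           (\<forall>y w. wave_solution a T y0 y1 v y w \<longrightarrow>
              (AE x in lborel. x \<in> {0..1} \<longrightarrow> y x T = 0) \<and>
              (\<forall>\<phi>. H01 \<phi> \<longrightarrow> w T \<phi> = 0))"
proof -
  define b where "b x = (if 0 < x \<and> x < 1 then 1 / a x else 1 / a0)" for x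
  have age: "a0 \<le> a x" if "0 < x" "x < 1" for x using assms(3) that by auto
  obtain V bl where "wave_coeff b V bl (1 / a0)"
    using BV01_reciprocal[OF assms(1,2) age] unfolding b_def[abs_def] by blast
  then interpret wave_coeff b V bl "1 / a0" .
  have T: "0 < T" using assms(2,4) by (smt (verit) divide_pos_pos real_sqrt_gt_zero)
  have TT: "T \<in> {0..T}" using T by simp
  have ab: "a x * b x = 1" if "0 < x" "x < 1" for x
    using age[OF that] assms(2) that by (simp add: b_def)
  \<comment> \<open>\<open>sg\<close> is at most \<open>sqrt (1 / a0)\<close>, so the crossing time
    is at most 1 / sqrt a0, and the hypothesis on \<open>T\<close> gives T \<ge> 2 tau.\<close>
  have "tau = (LINT x|U01. sg x)" by (simp add: tau_def XX_def Pr_1)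
  also have "\<dots> \<le> (LINT x|U01. sqrt (1 / a0))"
    by (rule integral_mono[OF sg_int]) (auto intro: sg_bounds)
  also have "\<dots> = 1 / sqrt a0" using measure_MI[of 0 1] by (simp add: real_sqrt_divide)
  finally have tau: "2 * tau \<le> T" using assms(4) by simp
  obtain p0 where p0: "p0 \<in> L2 U01" "\<And>\<phi> g. H01_deriv \<phi> g \<Longrightarrow> y1 \<phi> = - (LINT x|U01. p0 x * g x)"
    using Hm1_repr[OF assms(6)] by blast
  have y0: "y0 \<in> L2 U01" using assms(5) by (simp add: L2on_iff)
  obtain s Y P v d where lim:
    "\<And>t. t \<in> {0..T} \<Longrightarrow> Y t \<in> L2 U01" "\<And>t. t \<in> {0..T} \<Longrightarrow> P t \<in> L2 U01" "v \<in> L2 (MI 0 T)"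
    "d \<longlonglongrightarrow> 0"
    "\<And>n t. t \<in> {0..T} \<Longrightarrow> nrm U01 (\<lambda>x. yv (s n) t x - Y t x) \<le> d n"
    "\<And>n t. t \<in> {0..T} \<Longrightarrow> nrm U01 (\<lambda>x. pv (s n) t x - P t x) \<le> d n"
    "\<And>n. nrm (MI 0 T) (\<lambda>t. yv (s n) t 0 - v t) \<le> d n"
    and init: "AE x in U01. Y 0 x = y0 x" "AE x in U01. P 0 x = p0 x"
    and final: "AE x in U01. Y T x = 0" "AE x in U01. P T x = 0"
    by (rule control_limit[OF T tau y0 p0(1)]) (rule that; assumption)
  interpret wave_limit b V bl "1 / a0" a T s Y P v d
    by unfold_locales (use ab T lim in auto)
  have sol: "wave_solution a T y0 y1 v (\<lambda>x t. Y t x) wf"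
    by (rule wave_solution_limit[OF init(1) p0(2,1) init(2)])
  have wT: "wf T \<phi> = 0" for \<phi>
  proof -
    have "AE x in U01. P T x * dl \<phi> x = 0" using final(2) by eventually_elim simp
    then show ?thesis unfolding wf_def by (simp add: integral_eq_zero_AE)
  qed
  \<comment> \<open>The control is fixed before the solution; uniqueness transfers the zero final
    state from the constructed solution to any other.\<close>
  have null: "(AE x in lborel. x \<in> {0..1} \<longrightarrow> y x T = 0) \<and> (\<forall>\<phi>. H01 \<phi> \<longrightarrow> w T \<phi> = 0)"
    if yw: "wave_solution a T y0 y1 v y w" for y w
  proof (intro conjI allI impI)
    have "AE x in U01. y x T = Y T x"
      by (rule wave_solution_unique(1)[OF _ T lim(3) yw sol TT]) (rule ab)
    then show "AE x in lborel. x \<in> {0..1} \<longrightarrow> y x T = 0"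
      using final(1) unfolding AE_MI by eventually_elim simp
  next
    fix \<phi> assume \<phi>: "H01 \<phi>"
    have "w T \<phi> = wf T \<phi>"
      by (rule wave_solution_unique(2)[OF _ T lim(3) yw sol TT \<phi>]) (rule ab)
    then show "w T \<phi> = 0" using wT by simp
  qed
  have "L2on {0..T} v" using lim(3) by (simp add: L2on_iff)
  then show ?thesis using sol null by blast
qed

end
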